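(* Let $G$ be a finite group and $k$ a field whose characteristic does not divide $|G|$. Let $Q = kG_{\mathrm{ad}}$. Then $$d_{\mathrm{odd}}(kG, D(G)) = 2\, d(Q, \mathcal{M}_{kG}) + 1.$$ If moreover $k$ is algebraically closed of characteristic $0$ and the center of $G$ is trivial, then $Q$ is conditionally faithful and $$d(kG,D(G)) = 2\ell_Q +1 .$$
   Context: $D(G)$ is the Drinfeld double of $kG$: $(kG)^*\otimes_k kG$ with multiplication $(p_x\bowtie g)(p_y\bowtie h)=p_xp_{gyg^{-1}}\bowtie gh$ for $g,h,x,y\in G$, where $\{p_x\}_{x\in G}$ is the basis of $(kG)^*$ dual to $G$ (so $p_xp_y=\delta_{x,y}p_x$). $kG$ is identified with the subalgebra $1\bowtie kG$, $1=\sum_x p_x$. $kG_{\mathrm{ad}}$ is the right $kG$-module $kG$ with action $g\cdot x=x^{-1}gx$ for $g,x\in G$. For a right $kG$-module $W$, tensor powers are over $k$ with the diagonal action and $W^{\otimes 0}=k$ is the trivial module. $T_n(W)=W\oplus\cdots\oplus W^{\otimes n}$. $W$ has depth $n\ge 1$ if $T_{n+1}(W)$ is isomorphic to a direct summand of $q\cdot T_n(W)$ ($q$ copies) for some positive integer $q$, and depth $0$ if $W$ is a direct sum of copies of the trivial module. $d(W,\mathcal{M}_{kG})$ is the least $n\ge 0$ such that $W$ has depth $n$. For $Q=kG_{\mathrm{ad}}$ put $I_n=\mathrm{Ann}_{kG}\,Q^{\otimes n}$ for $n\ge 0$; $I_0\supseteq I_1\supseteq\cdots$. $Q$ is conditionally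 faithful if $\bigcap_{n\ge1} I_n=0$; in that case $\ell_Q$ is the least $n\ge 0$ with $I_n=0$, i.e. such that $Q^{\otimes n}$ is a faithful $kG$-module. Modules $X, Y$ are similar if each is isomorphic to a direct summand of a finite direct sum of copies of the other. For a unital subalgebra $B\subseteq C$ of finite-dimensional algebras let $C^{\otimes_B n}$ be the $n$-fold tensor product of $C$ over $B$, $C^{\otimes_B 0}=B$. The extension has depth $2n+1$ ($n\ge 0$) if $C^{\otimes_B(n+1)}$ and $C^{\otimes_B n}$ are similar as $B$-$B$-bimodules, and depth $2n$ ($n\ge 1$) if they are similar as $B$-$C$-bimodules or as $C$-$B$-bimodules. $d(B,C)$ is the least $m\geq 1$ such that $B\subseteq C$ has depth $m$ ($\infty$ if none), and $d_{\mathrm{odd}}(B,C)=2\lceil\frac{d(B,C)-1}{2}\rceil+1$ is the least odd integer greater than or equal to $d(B,C)$. *)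

theory Defs
  imports
    "HOL-Library.Function_Algebras"
    "HOL-Library.Extended_Nat"
    "HOL-Computational_Algebra.Polynomial"
    "HOL-Algebra.Module"
begin

section \<open>Vector spaces with operators\<close>

text \<open>
  A single record serves for right modules and for bimodules: a \<open>k\<close>-vector space together
  with a family of operators. For a right module over \<open>A\<close> the operators are the elements of
  \<open>A\<close>; for a \<open>B\<close>-\<open>C\<close>-bimodule they are \<open>Inl b\<close> (left action of
  \<open>b \<in> B\<close>) and \<open>Inr c\<close> (right action of \<open>c \<in> C\<close>). Submodules and homomorphisms
  are taken relative to a set \<open>\<Omega>\<close> of operators, so that the same object can be regarded as
  a \<open>B\<close>-\<open>B\<close>-, \<open>B\<close>-\<open>C\<close>- or \<open>C\<close>-\<open>B\<close>-bimodule. The fields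
  \<open>mult\<close> and \<open>one\<close> inherited from the library record are not used for modules.
\<close>

record ('k, 'm, 'o) opmod = "('k, 'm) module" +
  act :: "'o \<Rightarrow> 'm \<Rightarrow> 'm"

definition opmod_iso :: "'o set \<Rightarrow> ('k, 'm, 'o) opmod \<Rightarrow> ('k, 'n, 'o) opmod \<Rightarrow> ('m \<Rightarrow> 'n) \<Rightarrow> bool" where
  "opmod_iso \<Omega> M N f \<longleftrightarrow>
     bij_betw f (carrier M) (carrier N) \<and>
     (\<forall>x\<in>carrier M. \<forall>y\<in>carrier M. f (x \<oplus>\<^bsub>M\<^esub> y) = f x \<oplus>\<^bsub>N\<^esub> f y) \<and>
     (\<forall>c. \<forall>x\<in>carrier M. f (c \<odot>\<^bsub>M\<^esub> x) = c \<odot>\<^bsub>N\<^esub> f x) \<and>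
     (\<forall>\<omega>\<in>\<Omega>. \<forall>x\<in>carrier M. f (act M \<omega> x) = act N \<omega> (f x))"

definition opmod_isomorphic :: "'o set \<Rightarrow> ('k, 'm, 'o) opmod \<Rightarrow> ('k, 'n, 'o) opmod \<Rightarrow> bool" where
  "opmod_isomorphic \<Omega> M N \<longleftrightarrow> (\<exists>f. opmod_iso \<Omega> M N f)"

definition opsubmod :: "'o set \<Rightarrow> 'm set \<Rightarrow> ('k, 'm, 'o) opmod \<Rightarrow> bool" where
  "opsubmod \<Omega> P M \<longleftrightarrow>
     P \<subseteq> carrier M \<and> \<zero>\<^bsub>M\<^esub> \<in> P \<and>
     (\<forall>x\<in>P. \<forall>y\<in>P. x \<oplus>\<^bsub>M\<^esub> y \<in> P) \<and>
     (\<forall>c. \<forall>x\<in>P. c \<odot>\<^bsub>M\<^esub> x \<in> P) \<and>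
     (\<forall>\<omega>\<in>\<Omega>. \<forall>x\<in>P. act M \<omega> x \<in> P)"

definition iso_to_summand :: "'o set \<Rightarrow> ('k, 'm, 'o) opmod \<Rightarrow> ('k, 'n, 'o) opmod \<Rightarrow> bool" where
  "iso_to_summand \<Omega> M N \<longleftrightarrow>
     (\<exists>P P'. opsubmod \<Omega> P N \<and> opsubmod \<Omega> P' N \<and>
        P \<inter> P' = {\<zero>\<^bsub>N\<^esub>} \<and> {x \<oplus>\<^bsub>N\<^esub> y | x y. x \<in> P \<and> y \<in> P'} = carrier N \<and>
        opmod_isomorphic \<Omega> M (N\<lparr>carrier := P\<rparr>))"

text \<open>The direct sum of a finite family (\<open>I\<close> is always finite below).\<close>

definition direct_sum :: "'i set \<Rightarrow> ('i \<Rightarrow> ('k, 'm, 'o) opmod) \<Rightarrow> ('k, 'i \<Rightarrow> 'm, 'o) opmod" where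
  "direct_sum I M =
     \<lparr>carrier = (\<Pi>\<^sub>E i\<in>I. carrier (M i)), monoid.mult = undefined, one = undefined,
      zero = (\<lambda>i\<in>I. \<zero>\<^bsub>M i\<^esub>),
      add = (\<lambda>f g. \<lambda>i\<in>I. f i \<oplus>\<^bsub>M i\<^esub> g i),
      smult = (\<lambda>c f. \<lambda>i\<in>I. c \<odot>\<^bsub>M i\<^esub> f i),
      act = (\<lambda>\<omega> f. \<lambda>i\<in>I. act (M i) \<omega> (f i))\<rparr>"

definition copies :: "nat \<Rightarrow> ('k, 'm, 'o) opmod \<Rightarrow> ('k, nat \<Rightarrow> 'm, 'o) opmod" where
  "copies q M = direct_sum {..<q} (\<lambda>_. M)"

definition similar_mod :: "'o set \<Rightarrow> ('k, 'm, 'o) opmod \<Rightarrow> ('k, 'n, 'o) opmod \<Rightarrow> bool" where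
  "similar_mod \<Omega> M N \<longleftrightarrow>
     (\<exists>q. iso_to_summand \<Omega> M (copies q N)) \<and> (\<exists>q. iso_to_summand \<Omega> N (copies q M))"

section \<open>Free spaces and their quotients\<close>

definition free_on :: "'x set \<Rightarrow> ('x \<Rightarrow> 'k::field) set" where
  "free_on X = {F. finite {x. F x \<noteq> 0} \<and> {x. F x \<noteq> 0} \<subseteq> X}"

definition delta :: "'x \<Rightarrow> 'x \<Rightarrow> 'k::field" where
  "delta x = (\<lambda>y. if y = x then 1 else 0)"

definition fscale :: "'k::field \<Rightarrow> ('x \<Rightarrow> 'k) \<Rightarrow> 'x \<Rightarrow> 'k" where
  "fscale c F = (\<lambda>x. c * F x)"

text \<open>The linear extension of \<open>delta x \<mapsto> h x\<close>.\<close>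

definition lin_ext :: "('x \<Rightarrow> 'y \<Rightarrow> 'k::field) \<Rightarrow> ('x \<Rightarrow> 'k) \<Rightarrow> 'y \<Rightarrow> 'k" where
  "lin_ext h F = (\<Sum>x | F x \<noteq> 0. fscale (F x) (h x))"

definition fspan :: "('x \<Rightarrow> 'k::field) set \<Rightarrow> ('x \<Rightarrow> 'k) set" where
  "fspan S = Modules.module.span fscale S"

definition coset :: "('x \<Rightarrow> 'k::field) set \<Rightarrow> ('x \<Rightarrow> 'k) \<Rightarrow> ('x \<Rightarrow> 'k) set" where
  "coset N F = {F + H | H. H \<in> N}"

text \<open>The quotient \<open>V/N\<close>, with the operators induced by \<open>T \<omega> : V \<rightarrow> V\<close>.\<close>

definition quot_mod ::
  "('x \<Rightarrow> 'k::field) set \<Rightarrow> ('x \<Rightarrow> 'k) set \<Rightarrow> ('o \<Rightarrow> ('x \<Rightarrow> 'k) \<Rightarrow> ('x \<Rightarrow> 'k))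
     \<Rightarrow> ('k, ('x \<Rightarrow> 'k) set, 'o) opmod" where
  "quot_mod V N T =
     \<lparr>carrier = coset N ` V, monoid.mult = undefined, one = undefined,
      zero = coset N 0,
      add = (\<lambda>X Y. \<Union>F\<in>X. \<Union>H\<in>Y. coset N (F + H)),
      smult = (\<lambda>c X. \<Union>F\<in>X. coset N (fscale c F)),
      act = (\<lambda>\<omega> X. \<Union>F\<in>X. coset N (T \<omega> F))\<rparr>"

section \<open>Tensor powers\<close>

definition tuples :: "('k, 'v, 'z) module_scheme \<Rightarrow> nat \<Rightarrow> 'v list set" where
  "tuples V n = {vs. set vs \<subseteq> carrier V \<and> length vs = n}"

definition multilinear_rels ::
  "('k::field, 'v, 'z) module_scheme \<Rightarrow> nat \<Rightarrow> ('v list \<Rightarrow> 'k) set" where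
  "multilinear_rels V n =
     {delta (us @ [v \<oplus>\<^bsub>V\<^esub> w] @ ws) - delta (us @ [v] @ ws) - delta (us @ [w] @ ws) | us v w ws.
        us @ [v] @ ws \<in> tuples V n \<and> us @ [w] @ ws \<in> tuples V n}
   \<union> {delta (us @ [c \<odot>\<^bsub>V\<^esub> v] @ ws) - fscale c (delta (us @ [v] @ ws)) | us c v ws.
        us @ [v] @ ws \<in> tuples V n}"

definition balanced_rels ::
  "'c set \<Rightarrow> ('k::field, 'c, 'z) module_scheme \<Rightarrow> nat \<Rightarrow> ('c list \<Rightarrow> 'k) set" where
  "balanced_rels B C n =
     {delta (us @ [v \<otimes>\<^bsub>C\<^esub> b, w] @ ws) - delta (us @ [v, b \<otimes>\<^bsub>C\<^esub> w] @ ws) | us v b w ws.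
        us @ [v, w] @ ws \<in> tuples C n \<and> b \<in> B}"

section \<open>Right modules over a group algebra\<close>

text \<open>
  Elements of the group algebra are functions supported on the group; \<open>delta x\<close> is the
  group element \<open>x\<close>.
\<close>

definition group_alg :: "('g, 'z) monoid_scheme \<Rightarrow> ('g \<Rightarrow> 'k::field) set" where
  "group_alg G = free_on (carrier G)"

definition triv_mod :: "('g, 'z) monoid_scheme \<Rightarrow> ('k::field, 'k, 'g \<Rightarrow> 'k) opmod" where
  "triv_mod G =
     \<lparr>carrier = UNIV, monoid.mult = undefined, one = undefined, zero = 0, add = (+), smult = (*),
      act = (\<lambda>a c. c * (\<Sum>x\<in>carrier G. a x))\<rparr>"

text \<open>
  The diagonal action: \<open>(w\<^sub>1 \<otimes> \<dots> \<otimes> w\<^sub>n) \<cdot> \<Sum>\<^sub>x a\<^sub>x x = \<Sum>\<^sub>x a\<^sub>x (w\<^sub>1 x \<otimes> \<dots> \<otimes> w\<^sub>n x)\<close>.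
  For \<open>n = (0::nat)\<close> the only tuple is \<open>[]\<close>, there are no relations, and every group
  element fixes \<open>delta []\<close>: this is the trivial module.
\<close>

definition tensor_pow ::
  "('g, 'z) monoid_scheme \<Rightarrow> ('k::field, 'w, 'g \<Rightarrow> 'k) opmod \<Rightarrow> nat
     \<Rightarrow> ('k, ('w list \<Rightarrow> 'k) set, 'g \<Rightarrow> 'k) opmod" where
  "tensor_pow G W n =
     quot_mod (free_on (tuples W n)) (fspan (multilinear_rels W n))
       (\<lambda>a. lin_ext (\<lambda>ws. \<Sum>x\<in>carrier G. fscale (a x) (delta (map (act W (delta x)) ws))))"

definition T_mod ::
  "('g, 'z) monoid_scheme \<Rightarrow> ('k::field, 'w, 'g \<Rightarrow> 'k) opmod \<Rightarrow> nat
     \<Rightarrow> ('k, nat \<Rightarrow> ('w list \<Rightarrow> 'k) set, 'g \<Rightarrow> 'k) opmod" where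
  "T_mod G W n = direct_sum {1..n} (tensor_pow G W)"

definition module_has_depth ::
  "('g, 'z) monoid_scheme \<Rightarrow> ('k::field, 'w, 'g \<Rightarrow> 'k) opmod \<Rightarrow> nat \<Rightarrow> bool" where
  "module_has_depth G W n \<longleftrightarrow>
     (if n = 0 then \<exists>q. opmod_isomorphic (group_alg G) W (copies q (triv_mod G))
      else \<exists>q>0. iso_to_summand (group_alg G) (T_mod G W (n + 1)) (copies q (T_mod G W n)))"

definition module_depth ::
  "('g, 'z) monoid_scheme \<Rightarrow> ('k::field, 'w, 'g \<Rightarrow> 'k) opmod \<Rightarrow> enat" where
  "module_depth G W = Inf {enat n | n. module_has_depth G W n}"

definition Ann ::
  "('g, 'z) monoid_scheme \<Rightarrow> ('k::field, 'w, 'g \<Rightarrow> 'k) opmod \<Rightarrow> ('g \<Rightarrow> 'k) set" where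
  "Ann G W = {a \<in> group_alg G. \<forall>w\<in>carrier W. act W a w = \<zero>\<^bsub>W\<^esub>}"

definition conditionally_faithful ::
  "('g, 'z) monoid_scheme \<Rightarrow> ('k::field, 'w, 'g \<Rightarrow> 'k) opmod \<Rightarrow> bool" where
  "conditionally_faithful G W \<longleftrightarrow> (\<Inter>n\<in>{1..}. Ann G (tensor_pow G W n)) = {0}"

definition faithful_length ::
  "('g, 'z) monoid_scheme \<Rightarrow> ('k::field, 'w, 'g \<Rightarrow> 'k) opmod \<Rightarrow> enat" where
  "faithful_length G W = Inf {enat n | n. Ann G (tensor_pow G W n) = {0}}"

definition adjoint_mod :: "('g, 'z) monoid_scheme \<Rightarrow> ('k::field, 'g \<Rightarrow> 'k, 'g \<Rightarrow> 'k) opmod" where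
  "adjoint_mod G =
     \<lparr>carrier = group_alg G, monoid.mult = undefined, one = undefined,
      zero = 0, add = (+), smult = fscale,
      act = (\<lambda>a v. \<Sum>g\<in>carrier G. \<Sum>x\<in>carrier G.
               fscale (v g * a x) (delta (inv\<^bsub>G\<^esub> x \<otimes>\<^bsub>G\<^esub> g \<otimes>\<^bsub>G\<^esub> x)))\<rparr>"

section \<open>Hypotheses on the field and the group\<close>

text \<open>A predicate rather than the type class, because only part of the result assumes it.\<close>

definition alg_closed_type :: "'k::field itself \<Rightarrow> bool" where
  "alg_closed_type _ \<longleftrightarrow> (\<forall>p :: 'k poly. degree p > 0 \<longrightarrow> (\<exists>z. poly p z = 0))"

definition group_center :: "('g, 'z) monoid_scheme \<Rightarrow> 'g set" where
  "group_center G = {z \<in> carrier G. \<forall>g\<in>carrier G. g \<otimes>\<^bsub>G\<^esub> z = z \<otimes>\<^bsub>G\<^esub> g}"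

section \<open>Depth of a subalgebra\<close>

text \<open>
  Here \<open>C\<close> is an algebra and \<open>B\<close> the underlying set of a unital subalgebra.
  \<open>rel_tensor_pow B C n\<close> is the \<open>n\<close>-fold tensor product of \<open>C\<close> over \<open>B\<close> for \<open>n \<ge> 1\<close>; the
  \<open>0\<close>-fold tensor product \<open>B\<close>, which only occurs as a \<open>B\<close>-\<open>B\<close>-bimodule, is \<open>base_bimod B C\<close>.
\<close>

definition rel_tensor_pow ::
  "'c set \<Rightarrow> ('k::field, 'c, 'z) module_scheme \<Rightarrow> nat
     \<Rightarrow> ('k, ('c list \<Rightarrow> 'k) set, 'c + 'c) opmod" where
  "rel_tensor_pow B C n =
     quot_mod (free_on (tuples C n)) (fspan (multilinear_rels C n \<union> balanced_rels B C n))
       (\<lambda>\<omega>. lin_ext (\<lambda>cs. delta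
          (case \<omega> of
             Inl b \<Rightarrow> (b \<otimes>\<^bsub>C\<^esub> hd cs) # tl cs
           | Inr c \<Rightarrow> butlast cs @ [last cs \<otimes>\<^bsub>C\<^esub> c])))"

definition base_bimod ::
  "'c set \<Rightarrow> ('k, 'c, 'z) module_scheme \<Rightarrow> ('k, 'c, 'c + 'c) opmod" where
  "base_bimod B C =
     \<lparr>carrier = B, monoid.mult = undefined, one = undefined,
      zero = \<zero>\<^bsub>C\<^esub>, add = add C, smult = smult C,
      act = (\<lambda>\<omega> v. case \<omega> of Inl b \<Rightarrow> b \<otimes>\<^bsub>C\<^esub> v | Inr c \<Rightarrow> v \<otimes>\<^bsub>C\<^esub> c)\<rparr>"

definition odd_depth :: "'c set \<Rightarrow> ('k::field, 'c, 'z) module_scheme \<Rightarrow> nat \<Rightarrow> bool" where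
  "odd_depth B C n \<longleftrightarrow>
     (if n = 0 then similar_mod (B <+> B) (rel_tensor_pow B C 1) (base_bimod B C)
      else similar_mod (B <+> B) (rel_tensor_pow B C (n + 1)) (rel_tensor_pow B C n))"

definition even_depth :: "'c set \<Rightarrow> ('k::field, 'c, 'z) module_scheme \<Rightarrow> nat \<Rightarrow> bool" where
  "even_depth B C n \<longleftrightarrow>
     similar_mod (B <+> carrier C) (rel_tensor_pow B C (n + 1)) (rel_tensor_pow B C n) \<or>
     similar_mod (carrier C <+> B) (rel_tensor_pow B C (n + 1)) (rel_tensor_pow B C n)"

definition subalg_has_depth :: "'c set \<Rightarrow> ('k::field, 'c, 'z) module_scheme \<Rightarrow> nat \<Rightarrow> bool" where
  "subalg_has_depth B C m \<longleftrightarrow>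
     (\<exists>n. m = 2 * n + 1 \<and> odd_depth B C n) \<or> (\<exists>n\<ge>1. m = 2 * n \<and> even_depth B C n)"

definition subalg_depth :: "'c set \<Rightarrow> ('k::field, 'c, 'z) module_scheme \<Rightarrow> enat" where
  "subalg_depth B C = Inf {enat m | m. m \<ge> 1 \<and> subalg_has_depth B C m}"

definition subalg_depth_odd :: "'c set \<Rightarrow> ('k::field, 'c, 'z) module_scheme \<Rightarrow> enat" where
  "subalg_depth_odd B C =
     (case subalg_depth B C of
        enat m \<Rightarrow> enat (2 * nat \<lceil>(real m - 1) / 2\<rceil> + 1)
      | \<infinity> \<Rightarrow> \<infinity>)"

section \<open>The Drinfeld double of a group algebra\<close>

text \<open>The value of \<open>u\<close> at \<open>(x, g)\<close> is the coefficient of \<open>p\<^sub>x \<bowtie> g\<close>.\<close>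

definition double_basis_mult ::
  "('g, 'z) monoid_scheme \<Rightarrow> 'g \<times> 'g \<Rightarrow> 'g \<times> 'g \<Rightarrow> 'g \<times> 'g \<Rightarrow> 'k::field" where
  "double_basis_mult G = (\<lambda>(x, g) (y, h).
     if x = g \<otimes>\<^bsub>G\<^esub> y \<otimes>\<^bsub>G\<^esub> inv\<^bsub>G\<^esub> g then delta (x, g \<otimes>\<^bsub>G\<^esub> h) else 0)"

definition double :: "('g, 'z) monoid_scheme \<Rightarrow> ('k::field, 'g \<times> 'g \<Rightarrow> 'k) module" where
  "double G =
     \<lparr>carrier = free_on (carrier G \<times> carrier G),
      monoid.mult = (\<lambda>u v. \<Sum>s\<in>carrier G \<times> carrier G. \<Sum>t\<in>carrier G \<times> carrier G.
                fscale (u s * v t) (double_basis_mult G s t)),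
      one = (\<Sum>x\<in>carrier G. delta (x, \<one>\<^bsub>G\<^esub>)),
      zero = 0, add = (+), smult = fscale\<rparr>"

text \<open>The copy \<open>1 \<bowtie> kG\<close> of the group algebra, where \<open>1 = \<Sum>\<^sub>x p\<^sub>x\<close>.\<close>

definition group_alg_in_double :: "('g, 'z) monoid_scheme \<Rightarrow> ('g \<times> 'g \<Rightarrow> 'k::field) set" where
  "group_alg_in_double G =
     (\<lambda>a. \<Sum>x\<in>carrier G. \<Sum>g\<in>carrier G. fscale (a g) (delta (x, g))) ` group_alg G"

end

theory Submission
  imports Defs
begin

text \<open>
  Write \<open>B = kG\<close>, \<open>C = D(G)\<close> and \<open>X\<^sub>n = G\<^sup>n\<close> with \<open>G\<close> acting by simultaneous conjugation. Then \<open>Q\<^sup>\<otimes>\<^sup>n\<close> is the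
  permutation module \<open>k[X\<^sub>n]\<close>, and sliding group elements to the right across the tensor signs identifies the
  \<open>n\<close>-fold tensor product of \<open>C\<close> over \<open>B\<close>, as a \<open>B\<close>-\<open>B\<close>-bimodule, with \<open>k[X\<^sub>n \<times> G]\<close>. Between such bimodules
  divisibility is the same as between the modules \<open>k[X\<^sub>n]\<close>, since the coinvariants of the right action recover
  \<open>k[X\<^sub>n]\<close>. As \<open>k[X\<^sub>n]\<close> embeds in \<open>k[X\<^sub>m]\<close> as a summand for \<open>n \<le> m\<close>, depth \<open>2n + 1\<close> of \<open>B \<subseteq> C\<close> and depth \<open>n\<close> of \<open>Q\<close>
  both say that \<open>k[X\<^sub>n\<^sub>+\<^sub>1]\<close> divides a multiple of \<open>k[X\<^sub>n]\<close>. Cutting with \<open>p\<^sub>1 \<bowtie> 1\<close> shows that depth \<open>2n\<close> implies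
  depth \<open>2n - 1\<close>, so the minimum depth is odd.

  A faithful permutation module generates all others because \<open>|G|\<close> is invertible. When the centre is trivial, the tuple
  of all elements of \<open>G\<close> has a regular orbit in \<open>X\<^sub>m\<close>, \<open>m = |G|\<close>, so \<open>Q\<^sup>\<otimes>\<^sup>m\<close> is faithful; hence \<open>Q\<close> has depth \<open>n\<close> exactly
  when \<open>Q\<^sup>\<otimes>\<^sup>n\<close> is faithful.
\<close>

section \<open>Spaces of finitely supported functions\<close>

text \<open>The modules in the definitions are quotients of free spaces on infinite sets of tuples.
  Each is therefore transported along \<open>op_equiv\<close> to coordinates on a finite set, where
  being a summand of \<open>q\<close> copies becomes a factorisation
  \<open>1 = \<Sum>\<^sub>i A\<^sub>i B\<^sub>i\<close> into intertwining matrices; for permutation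
  actions, intertwining means constancy on orbits of pairs. From then on the argument concerns
  \<open>pdiv\<close>, a relation between finite sets with an action, and both depths become the one
  condition \<open>stable_at\<close>. The delicate point in the relative tensor powers is the
  independence of the normal forms. Sliding shows only that they span; independence comes from an
  explicit coefficient \<open>dcoef\<close> that is checked to kill every relation. Depth of
  \<open>Q\<close> is upward closed because tensoring with \<open>Q\<close> preserves divisibility.
  For even depth, the idempotent \<open>p\<^sub>1 \<bowtie> 1\<close> is chosen because
  \<open>1\<close> is fixed by conjugation: the words with first (or last) entry \<open>1\<close>
  then form an invariant copy of the shorter words.\<close>

interpretation fun_space: vector_space "fscale :: 'k::field \<Rightarrow> ('x \<Rightarrow> 'k) \<Rightarrow> 'x \<Rightarrow> 'k"
  by unfold_locales (auto simp: fscale_def algebra_simps fun_eq_iff)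

lemma sum_apply: "(\<Sum>i\<in>I. f i) x = (\<Sum>i\<in>I. f i x)"
  by (induction I rule: infinite_finite_induct) auto

lemma fscale_apply [simp]: "fscale c F x = c * F x"
  by (simp add: fscale_def)

lemma delta_apply: "delta x y = of_bool (y = x)"
  by (simp add: delta_def)

lemma mem_free_on_finite:
  assumes "finite X"
  shows "F \<in> free_on X \<longleftrightarrow> (\<forall>x. x \<notin> X \<longrightarrow> F x = 0)"
  using assms by (auto simp: free_on_def intro: finite_subset)

lemma subspace_free_on: "fun_space.subspace (free_on X)"
proof (rule fun_space.subspaceI)
  fix F H :: "'b \<Rightarrow> 'a" assume FH: "F \<in> free_on X" "H \<in> free_on X"
  have "{x. (F + H) x \<noteq> 0} \<subseteq> {x. F x \<noteq> 0} \<union> {x. H x \<noteq> 0}" by auto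
  with FH show "F + H \<in> free_on X"
    unfolding free_on_def by (auto intro: finite_subset)
next
  fix F :: "'b \<Rightarrow> 'a" and c assume F: "F \<in> free_on X"
  have "{x. fscale c F x \<noteq> 0} \<subseteq> {x. F x \<noteq> 0}" by auto
  with F show "fscale c F \<in> free_on X"
    unfolding free_on_def by (auto intro: finite_subset)
qed (simp add: free_on_def)

lemmas free_on_simps [simp, intro] =
  fun_space.subspace_0 [OF subspace_free_on]
  fun_space.subspace_add [OF subspace_free_on]
  fun_space.subspace_scale [OF subspace_free_on]
  fun_space.subspace_diff [OF subspace_free_on]
  fun_space.subspace_sum [OF subspace_free_on]

lemma delta_in_free_on [simp]: "delta x \<in> free_on X \<longleftrightarrow> x \<in> X"
  by (auto simp: free_on_def delta_apply)

lemma free_on_expand: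
  assumes "finite S" "{x. F x \<noteq> 0} \<subseteq> S"
  shows "F = (\<Sum>x\<in>S. fscale (F x) (delta x))"
proof
  fix y
  have "(\<Sum>x\<in>S. fscale (F x) (delta x)) y = (\<Sum>x\<in>S. if x = y then F x else 0)"
    by (auto simp: sum_apply delta_apply intro!: sum.cong)
  also have "\<dots> = F y" using assms by auto
  finally show "F y = (\<Sum>x\<in>S. fscale (F x) (delta x)) y" by simp
qed

lemma lin_ext_apply:
  assumes "finite S" "{x. F x \<noteq> 0} \<subseteq> S"
  shows "lin_ext h F y = (\<Sum>x\<in>S. F x * h x y)"
proof -
  have "lin_ext h F y = (\<Sum>x | F x \<noteq> 0. F x * h x y)"
    by (simp add: lin_ext_def sum_apply)
  also have "\<dots> = (\<Sum>x\<in>S. F x * h x y)"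
    using assms by (intro sum.mono_neutral_left) auto
  finally show ?thesis .
qed

lemma lin_ext_delta [simp]: "lin_ext h (delta x) = h x"
  by (rule ext) (simp add: lin_ext_apply [of "{x}"] delta_apply)

lemma lin_ext_add:
  assumes "F \<in> free_on X" "H \<in> free_on X"
  shows "lin_ext h (F + H) = lin_ext h F + lin_ext h H"
proof
  fix y
  let ?S = "{x. F x \<noteq> 0} \<union> {x. H x \<noteq> 0}"
  have S: "finite ?S" using assms by (simp add: free_on_def)
  have "lin_ext h (F + H) y = (\<Sum>x\<in>?S. (F + H) x * h x y)" using S by (rule lin_ext_apply) auto
  moreover have "lin_ext h F y = (\<Sum>x\<in>?S. F x * h x y)" using S by (rule lin_ext_apply) auto
  moreover have "lin_ext h H y = (\<Sum>x\<in>?S. H x * h x y)" using S by (rule lin_ext_apply) auto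
  ultimately show "lin_ext h (F + H) y = (lin_ext h F + lin_ext h H) y"
    by (simp add: algebra_simps sum.distrib)
qed

lemma lin_ext_scale:
  assumes "F \<in> free_on X"
  shows "lin_ext h (fscale c F) = fscale c (lin_ext h F)"
proof
  fix y
  have S: "finite {x. F x \<noteq> 0}" using assms by (simp add: free_on_def)
  have "lin_ext h (fscale c F) y = (\<Sum>x | F x \<noteq> 0. fscale c F x * h x y)"
    using S by (rule lin_ext_apply) auto
  then show "lin_ext h (fscale c F) y = fscale c (lin_ext h F) y"
    by (simp add: lin_ext_apply [OF S order_refl] sum_distrib_left mult.assoc)
qed

lemma lin_ext_zero [simp]: "lin_ext h 0 = 0"
  by (simp add: lin_ext_def)

lemma lin_ext_diff:
  assumes "F \<in> free_on X" "H \<in> free_on X"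
  shows "lin_ext h (F - H) = lin_ext h F - lin_ext h H"
proof -
  have "lin_ext h ((F - H) + H) = lin_ext h (F - H) + lin_ext h H"
    using assms by (intro lin_ext_add free_on_simps)
  then show ?thesis by simp
qed

lemma lin_ext_sum:
  assumes "\<And>i. i \<in> I \<Longrightarrow> F i \<in> free_on X"
  shows "lin_ext h (\<Sum>i\<in>I. F i) = (\<Sum>i\<in>I. lin_ext h (F i))"
  using assms
  by (induction I rule: infinite_finite_induct) (auto simp: lin_ext_add [of _ X])

lemma lin_ext_in_free_on:
  assumes "F \<in> free_on X" "\<And>x. x \<in> X \<Longrightarrow> h x \<in> free_on Y"
  shows "lin_ext h F \<in> free_on Y"
  unfolding lin_ext_def using assms by (intro free_on_simps) (auto simp: free_on_def)

text \<open>Linearity is asked only on \<open>free_on X\<close>: \<open>lin_ext\<close> sums over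
  the support, and a sum over an infinite set is 0 by convention, so additivity can fail for
  functions of infinite support.\<close>

definition linear_on :: "'x set \<Rightarrow> 'y set \<Rightarrow> (('x \<Rightarrow> 'k::field) \<Rightarrow> 'y \<Rightarrow> 'k) \<Rightarrow> bool" where
  "linear_on X Y f \<longleftrightarrow> (\<forall>F\<in>free_on X. f F \<in> free_on Y) \<and>
     (\<forall>F\<in>free_on X. \<forall>H\<in>free_on X. f (F + H) = f F + f H) \<and>
     (\<forall>c. \<forall>F\<in>free_on X. f (fscale c F) = fscale c (f F))"

lemma linear_onD:
  assumes "linear_on X Y f" "F \<in> free_on X"
  shows "f F \<in> free_on Y" "H \<in> free_on X \<Longrightarrow> f (F + H) = f F + f H"
    "f (fscale c F) = fscale c (f F)"
  using assms by (auto simp: linear_on_def)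

lemma linear_on_0: "linear_on X Y f \<Longrightarrow> f 0 = 0"
  using linear_onD(3) [of X Y f 0 0] by simp

lemma linear_on_lin_ext:
  assumes "\<And>x. x \<in> X \<Longrightarrow> h x \<in> free_on Y"
  shows "linear_on X Y (lin_ext h)"
  unfolding linear_on_def
  using assms by (auto intro: lin_ext_in_free_on lin_ext_add lin_ext_scale)

lemma linear_on_sum:
  assumes f: "linear_on X Y f" and "\<And>i. i \<in> I \<Longrightarrow> F i \<in> free_on X"
  shows "f (\<Sum>i\<in>I. F i) = (\<Sum>i\<in>I. f (F i))"
  using assms(2)
  by (induction I rule: infinite_finite_induct)
    (auto simp: linear_onD [OF f] linear_on_0 [OF f])

lemma linear_on_expand:
  assumes f: "linear_on X Y f" and F: "F \<in> free_on X"
  shows "f F = (\<Sum>x | F x \<noteq> 0. fscale (F x) (f (delta x)))"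
proof -
  have fin: "finite {x. F x \<noteq> 0}" and sub: "{x. F x \<noteq> 0} \<subseteq> X"
    using F by (auto simp: free_on_def)
  have "f F = f (\<Sum>x | F x \<noteq> 0. fscale (F x) (delta x))"
    by (rule arg_cong [OF free_on_expand [OF fin order_refl]])
  also have "\<dots> = (\<Sum>x | F x \<noteq> 0. f (fscale (F x) (delta x)))"
    using sub by (intro linear_on_sum [OF f]) auto
  also have "\<dots> = (\<Sum>x | F x \<noteq> 0. fscale (F x) (f (delta x)))"
    using sub by (intro sum.cong refl linear_onD(3) [OF f]) auto
  finally show ?thesis .
qed

lemma linear_on_eqI:
  assumes "linear_on X Y f" "linear_on X Y' g" "\<And>x. x \<in> X \<Longrightarrow> f (delta x) = g (delta x)"
    and F: "F \<in> free_on X"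
  shows "f F = g F"
  unfolding linear_on_expand [OF assms(1) F] linear_on_expand [OF assms(2) F]
  using assms(3) F by (intro sum.cong) (auto simp: free_on_def)

lemma linear_on_comp:
  "linear_on X Y f \<Longrightarrow> linear_on Y Z g \<Longrightarrow> linear_on X Z (\<lambda>F. g (f F))"
  by (simp add: linear_on_def)

lemma linear_on_id: "linear_on X X (\<lambda>F. F)"
  by (simp add: linear_on_def)

text \<open>Row convention: \<open>A x\<close> lists the coordinates of the image of
  \<open>delta x\<close>, so applying the map of \<open>A\<close> and then that of \<open>B\<close>
  gives the matrix product \<open>A B\<close> in this order.\<close>

definition lin_map :: "'x set \<Rightarrow> 'y set \<Rightarrow> ('x \<Rightarrow> 'y \<Rightarrow> 'k::field) \<Rightarrow> ('x \<Rightarrow> 'k) \<Rightarrow> 'y \<Rightarrow> 'k" where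
  "lin_map X Y A F = (\<lambda>y. if y \<in> Y then \<Sum>x\<in>X. F x * A x y else 0)"

lemma linear_on_lin_map:
  assumes "finite Y"
  shows "linear_on X Y (lin_map X Y A)"
  using assms
  by (auto simp: linear_on_def lin_map_def mem_free_on_finite fun_eq_iff algebra_simps
      sum.distrib sum_distrib_left)

lemma lin_map_delta:
  assumes "finite X" "x \<in> X"
  shows "lin_map X Y A (delta x) = (\<lambda>y. if y \<in> Y then A x y else 0)"
proof -
  have "(\<Sum>x'\<in>X. delta x x' * A x' y) = A x y" for y
  proof -
    have "(\<Sum>x'\<in>X. delta x x' * A x' y) = (\<Sum>x'\<in>X. if x' = x then A x' y else 0)"
      by (intro sum.cong) (auto simp: delta_apply)
    then show ?thesis using assms by simp
  qed
  then show ?thesis unfolding lin_map_def by presburger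
qed

lemma linear_on_eq_lin_map:
  assumes f: "linear_on X Y f" and fin: "finite X" "finite Y" and F: "F \<in> free_on X"
  shows "f F = lin_map X Y (\<lambda>x. f (delta x)) F"
proof (rule linear_on_eqI [OF f linear_on_lin_map [OF fin(2)] _ F])
  fix x assume x: "x \<in> X"
  then have "f (delta x) \<in> free_on Y" using f by (simp add: linear_onD)
  then show "f (delta x) = lin_map X Y (\<lambda>x. f (delta x)) (delta x)"
    using fin x by (auto simp: lin_map_delta mem_free_on_finite)
qed

section \<open>Isomorphisms of modules with operators\<close>

text \<open>An \<open>opmod\<close> satisfies no axioms by itself, and \<open>opmod_iso\<close> is symmetric only between structures that
  are closed under their operations.\<close>

definition opclosed :: "'o set \<Rightarrow> ('k, 'm, 'o) opmod \<Rightarrow> bool" where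
  "opclosed \<Omega> M \<longleftrightarrow> \<zero>\<^bsub>M\<^esub> \<in> carrier M \<and>
     (\<forall>x\<in>carrier M. \<forall>y\<in>carrier M. x \<oplus>\<^bsub>M\<^esub> y \<in> carrier M) \<and>
     (\<forall>c. \<forall>x\<in>carrier M. c \<odot>\<^bsub>M\<^esub> x \<in> carrier M) \<and>
     (\<forall>\<omega>\<in>\<Omega>. \<forall>x\<in>carrier M. act M \<omega> x \<in> carrier M)"

text \<open>Preservation of zero is demanded separately: without group axioms additivity does not
  yield it, and both summands and annihilators refer to the zero.\<close>

definition op_equiv_by ::
  "'o set \<Rightarrow> ('k, 'm, 'o) opmod \<Rightarrow> ('k, 'n, 'o) opmod \<Rightarrow> ('m \<Rightarrow> 'n) \<Rightarrow> bool" where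
  "op_equiv_by \<Omega> M N f \<longleftrightarrow>
     opclosed \<Omega> M \<and> opclosed \<Omega> N \<and> opmod_iso \<Omega> M N f \<and> f \<zero>\<^bsub>M\<^esub> = \<zero>\<^bsub>N\<^esub>"

definition op_equiv :: "'o set \<Rightarrow> ('k, 'm, 'o) opmod \<Rightarrow> ('k, 'n, 'o) opmod \<Rightarrow> bool" where
  "op_equiv \<Omega> M N \<longleftrightarrow> (\<exists>f. op_equiv_by \<Omega> M N f)"

lemma opclosedD:
  assumes "opclosed \<Omega> M"
  shows "\<zero>\<^bsub>M\<^esub> \<in> carrier M"
    "x \<in> carrier M \<Longrightarrow> y \<in> carrier M \<Longrightarrow> x \<oplus>\<^bsub>M\<^esub> y \<in> carrier M"
    "x \<in> carrier M \<Longrightarrow> c \<odot>\<^bsub>M\<^esub> x \<in> carrier M"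
    "\<omega> \<in> \<Omega> \<Longrightarrow> x \<in> carrier M \<Longrightarrow> act M \<omega> x \<in> carrier M"
  using assms by (auto simp: opclosed_def)

lemma op_equiv_byD:
  assumes "op_equiv_by \<Omega> M N f"
  shows "opclosed \<Omega> M" "opclosed \<Omega> N" "bij_betw f (carrier M) (carrier N)"
    "f \<zero>\<^bsub>M\<^esub> = \<zero>\<^bsub>N\<^esub>"
    "x \<in> carrier M \<Longrightarrow> f x \<in> carrier N"
    "x \<in> carrier M \<Longrightarrow> y \<in> carrier M \<Longrightarrow> f (x \<oplus>\<^bsub>M\<^esub> y) = f x \<oplus>\<^bsub>N\<^esub> f y"
    "x \<in> carrier M \<Longrightarrow> f (c \<odot>\<^bsub>M\<^esub> x) = c \<odot>\<^bsub>N\<^esub> f x"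
    "\<omega> \<in> \<Omega> \<Longrightarrow> x \<in> carrier M \<Longrightarrow> f (act M \<omega> x) = act N \<omega> (f x)"
  using assms by (auto simp: op_equiv_by_def opmod_iso_def bij_betw_apply)

text \<open>An operation in \<open>N\<close> is the image of the same operation on preimages, whose
  result lies in \<open>carrier M\<close> by closure of the source. The target may thus be a bare
  summand, as in the splitting argument below.\<close>

lemma opmod_iso_inv:
  assumes f: "opmod_iso \<Omega> M N f" and cl: "opclosed \<Omega> M"
  shows "opmod_iso \<Omega> N M (inv_into (carrier M) f)"
proof -
  have bij: "bij_betw f (carrier M) (carrier N)"
    and add: "\<And>x y. x \<in> carrier M \<Longrightarrow> y \<in> carrier M \<Longrightarrow> f (x \<oplus>\<^bsub>M\<^esub> y) = f x \<oplus>\<^bsub>N\<^esub> f y"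
    and smult: "\<And>c x. x \<in> carrier M \<Longrightarrow> f (c \<odot>\<^bsub>M\<^esub> x) = c \<odot>\<^bsub>N\<^esub> f x"
    and act: "\<And>\<omega> x. \<omega> \<in> \<Omega> \<Longrightarrow> x \<in> carrier M \<Longrightarrow> f (act M \<omega> x) = act N \<omega> (f x)"
    using f by (auto simp: opmod_iso_def)
  let ?g = "inv_into (carrier M) f"
  have g: "?g y \<in> carrier M" "f (?g y) = y" if "y \<in> carrier N" for y
    using that bij by (auto simp: bij_betw_def inv_into_into f_inv_into_f)
  have gI: "?g y = x" if "x \<in> carrier M" "f x = y" for x y
    using that bij by (auto simp: bij_betw_def)
  show ?thesis
    unfolding opmod_iso_def
  proof (intro conjI ballI allI)
    show "bij_betw ?g (carrier N) (carrier M)" using bij by (rule bij_betw_inv_into)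
  qed (use opclosedD [OF cl] g add smult act in \<open>auto intro!: gI\<close>)
qed

lemma opmod_iso_comp:
  assumes "opmod_iso \<Omega> L M f" "opmod_iso \<Omega> M N g"
  shows "opmod_iso \<Omega> L N (g \<circ> f)"
proof -
  have "f x \<in> carrier M" if "x \<in> carrier L" for x
    using assms(1) that by (auto simp: opmod_iso_def bij_betw_apply)
  then show ?thesis
    using assms bij_betw_trans [of f "carrier L" "carrier M" g "carrier N"]
    by (simp add: opmod_iso_def)
qed

lemma op_equiv_sym:
  assumes "op_equiv \<Omega> M N"
  shows "op_equiv \<Omega> N M"
proof -
  obtain f where f: "op_equiv_by \<Omega> M N f" using assms by (auto simp: op_equiv_def)
  have "inv_into (carrier M) f \<zero>\<^bsub>N\<^esub> = \<zero>\<^bsub>M\<^esub>"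
    using op_equiv_byD [OF f] opclosedD(1) [OF op_equiv_byD(1) [OF f]]
    by (metis bij_betw_inv_into_left)
  then have "op_equiv_by \<Omega> N M (inv_into (carrier M) f)"
    using f opmod_iso_inv by (auto simp: op_equiv_by_def)
  then show ?thesis by (auto simp: op_equiv_def)
qed

lemma op_equiv_trans:
  assumes "op_equiv \<Omega> L M" "op_equiv \<Omega> M N"
  shows "op_equiv \<Omega> L N"
proof -
  obtain f g where "op_equiv_by \<Omega> L M f" "op_equiv_by \<Omega> M N g"
    using assms by (auto simp: op_equiv_def)
  then have "op_equiv_by \<Omega> L N (g \<circ> f)"
    using opmod_iso_comp [of \<Omega> L M f N g] by (auto simp: op_equiv_by_def)
  then show ?thesis by (auto simp: op_equiv_def)
qed

text \<open>The isomorphism \<open>h\<close> carries the summand and its complement along together;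
  its injectivity keeps their intersection trivial.\<close>

lemma iso_to_summand_cong_imp:
  fixes M :: "('k, 'm, 'o) opmod" and M' :: "('k, 'm2, 'o) opmod"
    and N :: "('k, 'n, 'o) opmod" and N' :: "('k, 'n2, 'o) opmod"
  assumes M: "op_equiv \<Omega> M M'" and N: "op_equiv \<Omega> N N'" and MN: "iso_to_summand \<Omega> M N"
  shows "iso_to_summand \<Omega> M' N'"
proof -
  obtain f where f: "op_equiv_by \<Omega> M' M f" using op_equiv_sym [OF M] by (auto simp: op_equiv_def)
  obtain h where h: "op_equiv_by \<Omega> N N' h" using N by (auto simp: op_equiv_def)
  note hD = op_equiv_byD [OF h]
  obtain P P' g where P: "opsubmod \<Omega> P N" and P': "opsubmod \<Omega> P' N" and int: "P \<inter> P' = {\<zero>\<^bsub>N\<^esub>}"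
    and sum: "{x \<oplus>\<^bsub>N\<^esub> y | x y. x \<in> P \<and> y \<in> P'} = carrier N"
    and g: "opmod_iso \<Omega> M (N\<lparr>carrier := P\<rparr>) g"
    using MN by (auto simp: iso_to_summand_def opmod_isomorphic_def)
  have inj: "inj_on h (carrier N)" and surj: "h ` carrier N = carrier N'"
    using hD(3) by (auto simp: bij_betw_def)
  have sub: "opsubmod \<Omega> (h ` R) N'" if R: "opsubmod \<Omega> R N" for R
  proof -
    have "R \<subseteq> carrier N" using R by (simp add: opsubmod_def)
    then have RN: "x \<in> carrier N" if "x \<in> R" for x using that by auto
    show ?thesis
      unfolding opsubmod_def
    proof (intro conjI ballI allI)
      show "h ` R \<subseteq> carrier N'" using RN hD(5) by auto
      show "\<zero>\<^bsub>N'\<^esub> \<in> h ` R" using R unfolding hD(4) [symmetric] opsubmod_def by blast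
    next
      fix x y assume "x \<in> h ` R" "y \<in> h ` R"
      then obtain a b where "a \<in> R" "b \<in> R" "x = h a" "y = h b" by auto
      moreover from this have "x \<oplus>\<^bsub>N'\<^esub> y = h (a \<oplus>\<^bsub>N\<^esub> b)" by (simp add: RN hD(6))
      ultimately show "x \<oplus>\<^bsub>N'\<^esub> y \<in> h ` R" using R by (simp add: opsubmod_def)
    next
      fix c x assume "x \<in> h ` R"
      then obtain a where "a \<in> R" "x = h a" by auto
      moreover from this have "c \<odot>\<^bsub>N'\<^esub> x = h (c \<odot>\<^bsub>N\<^esub> a)" by (simp add: RN hD(7))
      ultimately show "c \<odot>\<^bsub>N'\<^esub> x \<in> h ` R" using R by (simp add: opsubmod_def)
    next
      fix \<omega> x assume "\<omega> \<in> \<Omega>" "x \<in> h ` R"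
      then obtain a where "a \<in> R" "x = h a" by auto
      moreover from this have "act N' \<omega> x = h (act N \<omega> a)" using \<open>\<omega> \<in> \<Omega>\<close> by (simp add: RN hD(8))
      ultimately show "act N' \<omega> x \<in> h ` R" using R \<open>\<omega> \<in> \<Omega>\<close> by (simp add: opsubmod_def)
    qed
  qed
  have PN: "P \<subseteq> carrier N" "P' \<subseteq> carrier N" using P P' by (auto simp: opsubmod_def)
  have "h ` P \<inter> h ` P' = h ` (P \<inter> P')"
    using inj_on_image_Int [OF inj PN] by simp
  then have 1: "h ` P \<inter> h ` P' = {\<zero>\<^bsub>N'\<^esub>}" by (simp add: int hD(4))
  have "{x \<oplus>\<^bsub>N'\<^esub> y | x y. x \<in> h ` P \<and> y \<in> h ` P'} = h ` {x \<oplus>\<^bsub>N\<^esub> y | x y. x \<in> P \<and> y \<in> P'}"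
  proof (intro equalityI subsetI)
    fix z assume "z \<in> {x \<oplus>\<^bsub>N'\<^esub> y | x y. x \<in> h ` P \<and> y \<in> h ` P'}"
    then obtain x y where "x \<in> P" "y \<in> P'" "z = h x \<oplus>\<^bsub>N'\<^esub> h y" by auto
    then have "z = h (x \<oplus>\<^bsub>N\<^esub> y)" using PN by (simp add: hD(6) subsetD)
    then show "z \<in> h ` {x \<oplus>\<^bsub>N\<^esub> y | x y. x \<in> P \<and> y \<in> P'}" using \<open>x \<in> P\<close> \<open>y \<in> P'\<close> by auto
  next
    fix z assume "z \<in> h ` {x \<oplus>\<^bsub>N\<^esub> y | x y. x \<in> P \<and> y \<in> P'}"
    then obtain x y where "x \<in> P" "y \<in> P'" "z = h (x \<oplus>\<^bsub>N\<^esub> y)" by auto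
    then have "z = h x \<oplus>\<^bsub>N'\<^esub> h y" using PN by (simp add: hD(6) subsetD)
    then show "z \<in> {x \<oplus>\<^bsub>N'\<^esub> y | x y. x \<in> h ` P \<and> y \<in> h ` P'}" using \<open>x \<in> P\<close> \<open>y \<in> P'\<close> by auto
  qed
  then have 2: "{x \<oplus>\<^bsub>N'\<^esub> y | x y. x \<in> h ` P \<and> y \<in> h ` P'} = carrier N'" by (simp add: sum surj)
  have "opmod_iso \<Omega> (N\<lparr>carrier := P\<rparr>) (N'\<lparr>carrier := h ` P\<rparr>) h"
    using PN(1) inj_on_imp_bij_betw [OF inj_on_subset [OF inj PN(1)]]
    by (simp add: opmod_iso_def hD(6-8) subset_iff)
  then have "opmod_iso \<Omega> M' (N'\<lparr>carrier := h ` P\<rparr>) (h \<circ> (g \<circ> f))"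
    using f g by (intro opmod_iso_comp) (auto simp: op_equiv_by_def)
  then show ?thesis
    using sub [OF P] sub [OF P'] 1 2 by (auto simp: iso_to_summand_def opmod_isomorphic_def)
qed

lemma iso_to_summand_cong:
  assumes "op_equiv \<Omega> M M'" and "op_equiv \<Omega> N N'"
  shows "iso_to_summand \<Omega> M N \<longleftrightarrow> iso_to_summand \<Omega> M' N'"
  using iso_to_summand_cong_imp [OF assms]
    iso_to_summand_cong_imp [OF assms [THEN op_equiv_sym]] by blast

lemma opclosed_direct_sum:
  assumes "\<And>i. i \<in> I \<Longrightarrow> opclosed \<Omega> (L i)"
  shows "opclosed \<Omega> (direct_sum I L)"
  using opclosedD [OF assms] PiE_mem [of _ I "\<lambda>i. carrier (L i)"]
  unfolding opclosed_def direct_sum_def by auto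

lemma op_equiv_direct_sum:
  assumes "\<And>i. i \<in> I \<Longrightarrow> op_equiv \<Omega> (M i) (N i)"
  shows "op_equiv \<Omega> (direct_sum I M) (direct_sum I N)"
proof -
  obtain f where f: "\<And>i. i \<in> I \<Longrightarrow> op_equiv_by \<Omega> (M i) (N i) (f i)"
    using assms unfolding op_equiv_def by metis
  note fD = op_equiv_byD [OF f]
  let ?h = "\<lambda>u. \<lambda>i\<in>I. f i (u i)"
  note mem = PiE_mem [of _ I "\<lambda>i. carrier (M i)"] PiE_mem [of _ I "\<lambda>i. carrier (N i)"]
    PiE_arb [of _ I "\<lambda>i. carrier (M i)"] PiE_arb [of _ I "\<lambda>i. carrier (N i)"]
  have "bij_betw ?h (\<Pi>\<^sub>E i\<in>I. carrier (M i)) (\<Pi>\<^sub>E i\<in>I. carrier (N i))"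
  proof (rule bij_betwI [where g = "\<lambda>u. \<lambda>i\<in>I. inv_into (carrier (M i)) (f i) (u i)"])
    show "?h \<in> (\<Pi>\<^sub>E i\<in>I. carrier (M i)) \<rightarrow> (\<Pi>\<^sub>E i\<in>I. carrier (N i))"
      using fD(5) by (auto simp: mem)
    show "(\<lambda>u. \<lambda>i\<in>I. inv_into (carrier (M i)) (f i) (u i)) \<in> (\<Pi>\<^sub>E i\<in>I. carrier (N i)) \<rightarrow> (\<Pi>\<^sub>E i\<in>I.
        carrier (M i))"
      using bij_betw_apply [OF bij_betw_inv_into [OF fD(3)]] by (auto simp: mem)
  next
    fix u assume "u \<in> (\<Pi>\<^sub>E i\<in>I. carrier (M i))"
    then show "(\<lambda>i\<in>I. inv_into (carrier (M i)) (f i) ((\<lambda>i\<in>I. f i (u i)) i)) = u"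
      using bij_betw_inv_into_left [OF fD(3)] by (intro ext) (auto simp: mem restrict_def)
  next
    fix u assume "u \<in> (\<Pi>\<^sub>E i\<in>I. carrier (N i))"
    then show "(\<lambda>i\<in>I. f i ((\<lambda>i\<in>I. inv_into (carrier (M i)) (f i) (u i)) i)) = u"
      using bij_betw_inv_into_right [OF fD(3)] by (intro ext) (auto simp: mem restrict_def)
  qed
  then have "opmod_iso \<Omega> (direct_sum I M) (direct_sum I N) ?h"
    unfolding opmod_iso_def direct_sum_def
    by (auto simp: fD(6-8) mem intro!: ext)
  moreover have "?h \<zero>\<^bsub>direct_sum I M\<^esub> = \<zero>\<^bsub>direct_sum I N\<^esub>"
    by (auto simp: direct_sum_def fD(4) intro!: ext)
  ultimately have "op_equiv_by \<Omega> (direct_sum I M) (direct_sum I N) ?h"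
    using opclosed_direct_sum [of I \<Omega> M, OF fD(1)] opclosed_direct_sum [of I \<Omega> N, OF fD(2)]
        by (simp add: op_equiv_by_def)
  then show ?thesis by (auto simp: op_equiv_def)
qed

definition vec_mod :: "'x set \<Rightarrow> ('o \<Rightarrow> ('x \<Rightarrow> 'k::field) \<Rightarrow> 'x \<Rightarrow> 'k) \<Rightarrow> ('k, 'x \<Rightarrow> 'k, 'o) opmod" where
  "vec_mod X T =
     \<lparr>carrier = free_on X, monoid.mult = undefined, one = undefined,
      zero = 0, add = (+), smult = fscale, act = T\<rparr>"

lemma vec_mod_simps [simp]:
  "carrier (vec_mod X T) = free_on X" "zero (vec_mod X T) = 0" "add (vec_mod X T) = (+)"
  "smult (vec_mod X T) = fscale" "act (vec_mod X T) = T"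
  by (simp_all add: vec_mod_def)

lemma opclosed_vec_mod:
  "(\<And>\<omega>. \<omega> \<in> \<Omega> \<Longrightarrow> linear_on X X (T \<omega>)) \<Longrightarrow> opclosed \<Omega> (vec_mod X T)"
  by (auto simp: opclosed_def linear_on_def)

lemma op_equiv_vec_mod:
  assumes T: "\<And>\<omega>. \<omega> \<in> \<Omega> \<Longrightarrow> linear_on X X (T \<omega>)" and U: "\<And>\<omega>. \<omega> \<in> \<Omega> \<Longrightarrow> linear_on Y Y (U \<omega>)"
    and f: "linear_on X Y f" and bij: "bij_betw f (free_on X) (free_on Y)"
    and eq: "\<And>\<omega> F. \<omega> \<in> \<Omega> \<Longrightarrow> F \<in> free_on X \<Longrightarrow> f (T \<omega> F) = U \<omega> (f F)"
  shows "op_equiv \<Omega> (vec_mod X T) (vec_mod Y U)"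
  unfolding op_equiv_def op_equiv_by_def opmod_iso_def
  using linear_onD [OF f] linear_on_0 [OF f] bij eq opclosed_vec_mod [of \<Omega> X T, OF T]
      opclosed_vec_mod [of \<Omega> Y U, OF U]
  by (intro exI [of _ f]) simp

lemma op_equiv_vec_mod_cong:
  assumes T: "\<And>\<omega>. \<omega> \<in> \<Omega> \<Longrightarrow> linear_on X X (T \<omega>)"
    and eq: "\<And>\<omega> F. \<omega> \<in> \<Omega> \<Longrightarrow> F \<in> free_on X \<Longrightarrow> T \<omega> F = U \<omega> F"
  shows "op_equiv \<Omega> (vec_mod X T) (vec_mod X U)"
proof (rule op_equiv_vec_mod [OF T])
  fix \<omega> assume "\<omega> \<in> \<Omega>"
  then show "linear_on X X (U \<omega>)" using T [of \<omega>] eq by (auto simp: linear_on_def)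
next
  show "linear_on X X (\<lambda>F. F)" by (rule linear_on_id)
  show "bij_betw (\<lambda>F. F) (free_on X) (free_on X)" by (simp add: bij_betw_def)
qed (use eq in auto)

text \<open>The basis vector \<open>y\<close> of the \<open>i\<close>-th summand corresponds to \<open>e i y\<close>.\<close>

lemma op_equiv_direct_sum_vec_mod:
  fixes T :: "'i \<Rightarrow> 'o \<Rightarrow> ('y \<Rightarrow> 'k::field) \<Rightarrow> 'y \<Rightarrow> 'k" and Z :: "'z set"
  assumes fin: "finite Z" "\<And>i. i \<in> I \<Longrightarrow> finite (Y i)"
    and e: "bij_betw (\<lambda>(i, y). e i y) (Sigma I Y) Z"
    and T: "\<And>i \<omega>. i \<in> I \<Longrightarrow> \<omega> \<in> \<Omega> \<Longrightarrow> linear_on (Y i) (Y i) (T i \<omega>)"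
    and U: "\<And>\<omega>. \<omega> \<in> \<Omega> \<Longrightarrow> linear_on Z Z (U \<omega>)"
    and eq: "\<And>i y \<omega> F. i \<in> I \<Longrightarrow> y \<in> Y i \<Longrightarrow> \<omega> \<in> \<Omega> \<Longrightarrow> F \<in> free_on Z \<Longrightarrow>
       U \<omega> F (e i y) = T i \<omega> (\<lambda>y. if y \<in> Y i then F (e i y) else 0) y"
  shows "op_equiv \<Omega> (direct_sum I (\<lambda>i. vec_mod (Y i) (T i))) (vec_mod Z U)"
proof (rule op_equiv_sym)
  define f where "f F = (\<lambda>i\<in>I. \<lambda>y. if y \<in> Y i then F (e i y) else 0)" for F :: "'z \<Rightarrow> 'k"
  define d where "d = inv_into (Sigma I Y) (\<lambda>(i, y). e i y)"
  have de: "d (e i y) = (i, y)" if "i \<in> I" "y \<in> Y i" for i y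
    using bij_betw_inv_into_left [OF e, of "(i, y)"] that by (simp add: d_def)
  have dZ: "fst (d z) \<in> I" "snd (d z) \<in> Y (fst (d z))" "e (fst (d z)) (snd (d z)) = z" if "z \<in> Z" for z
    using bij_betw_inv_into_right [OF e that] bij_betw_apply [OF bij_betw_inv_into [OF e] that]
    by (auto simp: d_def split: prod.splits)
  have eZ: "e i y \<in> Z" if "i \<in> I" "y \<in> Y i" for i y
    using bij_betw_apply [OF e, of "(i, y)"] that by simp
  have "bij_betw f (free_on Z) (\<Pi>\<^sub>E i\<in>I. free_on (Y i))"
  proof (rule bij_betwI [where g = "\<lambda>u z. if z \<in> Z then u (fst (d z)) (snd (d z)) else 0"])
    show "f \<in> free_on Z \<rightarrow> (\<Pi>\<^sub>E i\<in>I. free_on (Y i))"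
      using fin by (auto simp: f_def mem_free_on_finite)
    show "(\<lambda>u z. if z \<in> Z then u (fst (d z)) (snd (d z)) else 0) \<in> (\<Pi>\<^sub>E i\<in>I. free_on (Y i)) \<rightarrow> free_on Z"
      using fin by (auto simp: mem_free_on_finite)
  next
    fix F :: "'z \<Rightarrow> 'k" assume "F \<in> free_on Z"
    then show "(\<lambda>z. if z \<in> Z then f F (fst (d z)) (snd (d z)) else 0) = F"
      using fin by (auto simp: f_def mem_free_on_finite dZ)
  next
    fix u :: "'i \<Rightarrow> 'y \<Rightarrow> 'k" assume u: "u \<in> (\<Pi>\<^sub>E i\<in>I. free_on (Y i))"
    show "f (\<lambda>z. if z \<in> Z then u (fst (d z)) (snd (d z)) else 0) = u"
    proof (intro ext)
      fix i y
      have "u i \<in> free_on (Y i)" if "i \<in> I" using u that by auto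
      moreover have "u i = undefined" if "i \<notin> I" using u that by (auto simp: PiE_def extensional_def)
      ultimately show "f (\<lambda>z. if z \<in> Z then u (fst (d z)) (snd (d z)) else 0) i y = u i y"
        using fin by (auto simp: f_def de eZ mem_free_on_finite)
    qed
  qed
  moreover have "f (F + H) = (\<lambda>i\<in>I. f F i + f H i)" "f (fscale c F) = (\<lambda>i\<in>I. fscale c (f F i))"
    "f 0 = (\<lambda>i\<in>I. 0)" for F H c
    by (auto simp: f_def fun_eq_iff restrict_def)
  moreover have "f (U \<omega> F) = (\<lambda>i\<in>I. T i \<omega> (f F i))" if "\<omega> \<in> \<Omega>" "F \<in> free_on Z" for \<omega> F
  proof (intro ext)
    fix i y
    show "f (U \<omega> F) i y = (\<lambda>i\<in>I. T i \<omega> (f F i)) i y"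
    proof (cases "i \<in> I \<and> y \<notin> Y i")
      \<comment> \<open>Off \<open>Y i\<close> both sides are 0, because the operators of the
        \<open>i\<close>-th summand preserve \<open>free_on (Y i)\<close>.\<close>
      case True
      have "f F i \<in> free_on (Y i)" using True fin by (auto simp: f_def mem_free_on_finite)
      then have "T i \<omega> (f F i) \<in> free_on (Y i)" using T True that by (auto simp: linear_on_def)
      then show ?thesis using True fin by (auto simp: mem_free_on_finite f_def)
    qed (use that in \<open>auto simp: f_def eq restrict_def\<close>)
  qed
  moreover have "opclosed \<Omega> (vec_mod Z U)" by (rule opclosed_vec_mod [OF U])
  moreover have "opclosed \<Omega> (direct_sum I (\<lambda>i. vec_mod (Y i) (T i)))"
    by (intro opclosed_direct_sum opclosed_vec_mod T)
  ultimately have "op_equiv_by \<Omega> (vec_mod Z U) (direct_sum I (\<lambda>i. vec_mod (Y i) (T i))) f"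
    unfolding op_equiv_by_def opmod_iso_def direct_sum_def by simp
  then show "op_equiv \<Omega> (vec_mod Z U) (direct_sum I (\<lambda>i. vec_mod (Y i) (T i)))"
    by (auto simp: op_equiv_def)
qed

section \<open>Direct summands and intertwining matrices\<close>

lemma linear_on_diff:
  assumes "linear_on X Y f" "F \<in> free_on X" "H \<in> free_on X"
  shows "f (F - H) = f F - f H"
proof -
  have "f ((F - H) + H) = f (F - H) + f H"
    using assms by (intro linear_onD(2) [OF assms(1)]) auto
  then show ?thesis by simp
qed

text \<open>A direct summand is the same as a split injection. From left to right, \<open>A\<close>
  is the inclusion and \<open>B\<close> the projection along the complement followed by the inverse
  isomorphism; from right to left, the image of \<open>A\<close> and the kernel of \<open>B\<close>
  are complementary.\<close>

lemma iso_to_summand_vec_mod_iff: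
  fixes X :: "'x set" and Z :: "'z set" and T :: "'o \<Rightarrow> ('x \<Rightarrow> 'k::field) \<Rightarrow> 'x \<Rightarrow> 'k"
  assumes fin: "finite X" "finite Z"
    and T: "\<And>\<omega>. \<omega> \<in> \<Omega> \<Longrightarrow> linear_on X X (T \<omega>)"
    and U: "\<And>\<omega>. \<omega> \<in> \<Omega> \<Longrightarrow> linear_on Z Z (U \<omega>)"
  shows "iso_to_summand \<Omega> (vec_mod X T) (vec_mod Z U) \<longleftrightarrow>
    (\<exists>A B. (\<forall>\<omega>\<in>\<Omega>. \<forall>F\<in>free_on X. lin_map X Z A (T \<omega> F) = U \<omega> (lin_map X Z A F)) \<and>
           (\<forall>\<omega>\<in>\<Omega>. \<forall>F\<in>free_on Z. lin_map Z X B (U \<omega> F) = T \<omega> (lin_map Z X B F)) \<and>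
           (\<forall>x\<in>X. \<forall>x'\<in>X. (\<Sum>z\<in>Z. A x z * B z x') = of_bool (x = x')))"
    (is "?L \<longleftrightarrow> ?R")
proof
  assume ?L
  then obtain P P' f where P: "opsubmod \<Omega> P (vec_mod Z U)" and P': "opsubmod \<Omega> P' (vec_mod Z U)"
    and int: "P \<inter> P' = {0}" and sum: "{x + y | x y. x \<in> P \<and> y \<in> P'} = free_on Z"
    and f: "opmod_iso \<Omega> (vec_mod X T) (vec_mod Z U\<lparr>carrier := P\<rparr>) f"
    by (auto simp: iso_to_summand_def opmod_isomorphic_def)
  have PZ: "F \<in> free_on Z" if "F \<in> P \<or> F \<in> P'" for F using P P' that by (auto simp: opsubmod_def)
  have Padd: "F + H \<in> P" if "F \<in> P" "H \<in> P" for F H using P that by (auto simp: opsubmod_def)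
  have P'add: "F + H \<in> P'" if "F \<in> P'" "H \<in> P'" for F H using P' that by (auto simp: opsubmod_def)
  have Psc: "fscale c F \<in> P" if "F \<in> P" for F c using P that by (auto simp: opsubmod_def)
  have P'sc: "fscale c F \<in> P'" if "F \<in> P'" for F c using P' that by (auto simp: opsubmod_def)
  have PU: "U \<omega> F \<in> P" if "\<omega> \<in> \<Omega>" "F \<in> P" for F \<omega> using P that by (auto simp: opsubmod_def)
  have P'U: "U \<omega> F \<in> P'" if "\<omega> \<in> \<Omega>" "F \<in> P'" for F \<omega> using P' that by (auto simp: opsubmod_def)
  have minus: "F - H = F + fscale (-1) H" for F H :: "'z \<Rightarrow> 'k" by (simp add: fun_eq_iff)
  \<comment> \<open>The component in \<open>P\<close> is picked by choice; \<open>pr_eq\<close>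
    shows that it is unique because \<open>P\<close> and \<open>P'\<close> meet only in 0, and
    uniqueness is what makes \<open>pr\<close> linear and equivariant.\<close>
  define pr where "pr F = (SOME v. v \<in> P \<and> F - v \<in> P')" for F
  have pr: "pr F \<in> P \<and> F - pr F \<in> P'" if "F \<in> free_on Z" for F
  proof -
    have "F \<in> {x + y | x y. x \<in> P \<and> y \<in> P'}" using that sum by simp
    then obtain v w where "v \<in> P" "w \<in> P'" "F = v + w" by auto
    then have "v \<in> P \<and> F - v \<in> P'" by simp
    then show ?thesis unfolding pr_def by (rule someI [of "\<lambda>v. v \<in> P \<and> F - v \<in> P'"])
  qed
  have pr_eq: "pr F = v" if "F \<in> free_on Z" "v \<in> P" "F - v \<in> P'" for F v
  proof -
    have "v - pr F \<in> P" unfolding minus using that pr Padd Psc by blast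
    moreover have "(F - pr F) - (F - v) \<in> P'" unfolding minus [of "F - pr F"]
        using that pr P'add P'sc by blast
    ultimately have "v - pr F \<in> P \<inter> P'" by simp
    then show ?thesis using int by simp
  qed
  let ?g = "inv_into (free_on X) f"
  have "opmod_iso \<Omega> (vec_mod Z U\<lparr>carrier := P\<rparr>) (vec_mod X T) ?g"
    using opmod_iso_inv [OF f opclosed_vec_mod [OF T]] by simp
  then have g: "bij_betw ?g P (free_on X)" "\<And>F H. F \<in> P \<Longrightarrow> H \<in> P \<Longrightarrow> ?g (F + H) = ?g F + ?g H"
    "\<And>c F. F \<in> P \<Longrightarrow> ?g (fscale c F) = fscale c (?g F)"
    "\<And>\<omega> F. \<omega> \<in> \<Omega> \<Longrightarrow> F \<in> P \<Longrightarrow> ?g (U \<omega> F) = T \<omega> (?g F)"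
    by (auto simp: opmod_iso_def)
  have fb: "bij_betw f (free_on X) P" and fU: "\<And>\<omega> F. \<omega> \<in> \<Omega> \<Longrightarrow> F \<in> free_on X \<Longrightarrow> f (T \<omega> F) = U \<omega> (f F)"
    using f by (auto simp: opmod_iso_def)
  have fP: "f F \<in> P" if "F \<in> free_on X" for F using bij_betw_apply [OF fb] that .
  have flin: "linear_on X Z f"
    using f fP PZ unfolding linear_on_def opmod_iso_def by auto
  define h where "h F = ?g (pr F)" for F
  have hlin: "linear_on Z X h"
    unfolding linear_on_def
  proof (intro conjI ballI allI)
    fix F :: "'z \<Rightarrow> 'k" assume F: "F \<in> free_on Z"
    then show "h F \<in> free_on X" using pr bij_betw_apply [OF g(1)] by (simp add: h_def)
    fix c
    have "pr (fscale c F) = fscale c (pr F)"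
    proof (rule pr_eq)
      have "fscale c F - fscale c (pr F) = fscale c (F - pr F)" by (simp add: fun_eq_iff algebra_simps)
      then show "fscale c F - fscale c (pr F) \<in> P'" using pr F P'sc by simp
    qed (use F pr Psc in auto)
    then show "h (fscale c F) = fscale c (h F)" using F pr g(3) by (simp add: h_def)
  next
    fix F H :: "'z \<Rightarrow> 'k" assume F: "F \<in> free_on Z" and H: "H \<in> free_on Z"
    have "pr (F + H) = pr F + pr H"
    proof (rule pr_eq)
      have eq: "F + H - (pr F + pr H) = (F - pr F) + (H - pr H)" by simp
      show "F + H - (pr F + pr H) \<in> P'"
        unfolding eq using pr [OF F] pr [OF H] P'add by blast
    qed (use F H pr Padd in auto)
    then show "h (F + H) = h F + h H" using F H pr g(2) by (simp add: h_def)
  qed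
  have hU: "h (U \<omega> F) = T \<omega> (h F)" if "\<omega> \<in> \<Omega>" "F \<in> free_on Z" for \<omega> F
  proof -
    have "pr (U \<omega> F) = U \<omega> (pr F)"
    proof (rule pr_eq)
      show "U \<omega> F \<in> free_on Z" using U that by (auto simp: linear_on_def)
      have "U \<omega> F - U \<omega> (pr F) = U \<omega> (F - pr F)"
        using linear_on_diff [OF U] that pr PZ by simp
      then show "U \<omega> F - U \<omega> (pr F) \<in> P'" using pr that P'U by simp
    qed (use that pr PU in auto)
    then show ?thesis using that pr g(4) by (simp add: h_def)
  qed
  have hf: "h (f F) = F" if "F \<in> free_on X" for F
  proof -
    have "0 \<in> P'" using int by auto
    then have "pr (f F) = f F" using fP [OF that] PZ by (intro pr_eq) auto
    then show ?thesis using bij_betw_inv_into_left [OF fb that] by (simp add: h_def)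
  qed
  let ?A = "\<lambda>x. f (delta x)" and ?B = "\<lambda>z. h (delta z)"
  have A: "lin_map X Z ?A F = f F" if "F \<in> free_on X" for F
    using linear_on_eq_lin_map [OF flin fin that] by simp
  have B: "lin_map Z X ?B F = h F" if "F \<in> free_on Z" for F
    using linear_on_eq_lin_map [OF hlin fin(2,1) that] by simp
  show ?R
  proof (rule exI [of _ ?A], rule exI [of _ ?B], intro conjI ballI)
    fix \<omega> and F :: "'x \<Rightarrow> 'k" assume "\<omega> \<in> \<Omega>" "F \<in> free_on X"
    then show "lin_map X Z ?A (T \<omega> F) = U \<omega> (lin_map X Z ?A F)"
      using linear_onD(1) [OF T] by (simp add: A fU)
  next
    fix \<omega> and F :: "'z \<Rightarrow> 'k" assume "\<omega> \<in> \<Omega>" "F \<in> free_on Z"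
    then show "lin_map Z X ?B (U \<omega> F) = T \<omega> (lin_map Z X ?B F)"
      using linear_onD(1) [OF U] by (simp add: B hU)
  next
    fix x x' assume x: "x \<in> X" "x' \<in> X"
    have "lin_map Z X ?B (f (delta x)) x' = h (f (delta x)) x'"
      using x PZ fP by (subst B) auto
    also have "\<dots> = of_bool (x = x')" using x by (auto simp: hf delta_apply)
    finally show "(\<Sum>z\<in>Z. ?A x z * ?B z x') = of_bool (x = x')" using x by (simp add: lin_map_def)
  qed
next
  assume ?R
  then obtain A B where A: "\<And>\<omega> F. \<omega> \<in> \<Omega> \<Longrightarrow> F \<in> free_on X \<Longrightarrow> lin_map X Z A (T \<omega> F) = U \<omega> (lin_map X Z A F)"
    and B: "\<And>\<omega> F. \<omega> \<in> \<Omega> \<Longrightarrow> F \<in> free_on Z \<Longrightarrow> lin_map Z X B (U \<omega> F) = T \<omega> (lin_map Z X B F)"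
    and AB: "\<And>x x'. x \<in> X \<Longrightarrow> x' \<in> X \<Longrightarrow> (\<Sum>z\<in>Z. A x z * B z x') = of_bool (x = x')"
    by blast
  define f g where "f = lin_map X Z A" and "g = lin_map Z X B"
  have f: "linear_on X Z f" and g: "linear_on Z X g"
    using fin by (auto simp: f_def g_def intro!: linear_on_lin_map)
  have gf: "g (f F) = F" if "F \<in> free_on X" for F
  proof (rule linear_on_eqI [OF linear_on_comp [OF f g] linear_on_id _ that])
    fix x assume x: "x \<in> X"
    have "g (f (delta x)) x' = delta x x'" for x'
    proof (cases "x' \<in> X")
      case True
      have "g (f (delta x)) x' = (\<Sum>z\<in>Z. A x z * B z x')"
        using x fin True by (auto simp: g_def f_def lin_map_delta lin_map_def [of Z X] intro!: sum.cong)
      then show ?thesis using AB x True by (simp add: delta_apply eq_commute)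
    qed (use x in \<open>auto simp: g_def lin_map_def delta_apply\<close>)
    then show "g (f (delta x)) = delta x" by auto
  qed
  let ?P = "f ` free_on X" and ?P' = "{u \<in> free_on Z. g u = 0}"
  have 1: "opsubmod \<Omega> ?P (vec_mod Z U)"
    unfolding opsubmod_def
  proof (intro conjI ballI allI)
    show "\<zero>\<^bsub>vec_mod Z U\<^esub> \<in> ?P" using linear_on_0 [OF f] by (auto intro!: image_eqI [of _ _ 0])
  next
    fix c F assume "F \<in> ?P"
    then obtain F' where "F' \<in> free_on X" "F = f F'" by auto
    then show "c \<odot>\<^bsub>vec_mod Z U\<^esub> F \<in> ?P" by (simp add: linear_onD(3) [OF f, symmetric])
  next
    fix F H assume "F \<in> ?P" "H \<in> ?P"
    then obtain F' H' where "F' \<in> free_on X" "F = f F'" "H' \<in> free_on X" "H = f H'" by auto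
    then show "F \<oplus>\<^bsub>vec_mod Z U\<^esub> H \<in> ?P" by (simp add: linear_onD(2) [OF f, symmetric])
  next
    fix \<omega> F assume "\<omega> \<in> \<Omega>" "F \<in> ?P"
    then obtain F' where "F' \<in> free_on X" "F = f F'" by auto
    then show "act (vec_mod Z U) \<omega> F \<in> ?P"
      using A [OF \<open>\<omega> \<in> \<Omega>\<close>, of F'] linear_onD(1) [OF T [OF \<open>\<omega> \<in> \<Omega>\<close>], of F']
          by (auto simp: f_def dest!: sym [of "lin_map X Z A (T \<omega> F')"])
  qed (use linear_onD(1) [OF f] in auto)
  have 2: "opsubmod \<Omega> ?P' (vec_mod Z U)"
    unfolding opsubmod_def
  proof (intro conjI ballI allI)
    fix \<omega> F assume "\<omega> \<in> \<Omega>" "F \<in> ?P'"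
    then have "U \<omega> F \<in> free_on Z" "g (U \<omega> F) = T \<omega> (g F)"
      using linear_onD(1) [OF U] B by (auto simp: g_def)
    then show "act (vec_mod Z U) \<omega> F \<in> ?P'"
      using \<open>F \<in> ?P'\<close> linear_on_0 [OF T [OF \<open>\<omega> \<in> \<Omega>\<close>]] by simp
  qed (auto simp: linear_onD [OF g] linear_on_0 [OF g])
  have 3: "?P \<inter> ?P' = {0}"
    using linear_on_0 [OF f] gf linear_on_0 [OF g] by (auto intro!: image_eqI [of _ _ 0])
  have "\<exists>v w. F = v + w \<and> v \<in> ?P \<and> w \<in> ?P'" if F: "F \<in> free_on Z" for F
  proof (intro exI conjI)
    show "F = f (g F) + (F - f (g F))" by simp
    have gF: "g F \<in> free_on X" and fgF: "f (g F) \<in> free_on Z"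
      using F linear_onD(1) [OF g] linear_onD(1) [OF f] by auto
    then show "f (g F) \<in> ?P" by simp
    show "F - f (g F) \<in> ?P'" using F fgF gF by (simp add: linear_on_diff [OF g] gf)
  qed
  moreover have "f (F) + H \<in> free_on Z" if "F \<in> free_on X" "H \<in> free_on Z" for F H
    using that linear_onD(1) [OF f] by auto
  ultimately have 4: "{v + w | v w. v \<in> ?P \<and> w \<in> ?P'} = free_on Z" by auto
  have "bij_betw f (free_on X) ?P"
    by (intro bij_betw_imageI inj_on_inverseI [where g = g] gf refl)
  then have "opmod_iso \<Omega> (vec_mod X T) (vec_mod Z U\<lparr>carrier := ?P\<rparr>) f"
    unfolding opmod_iso_def using linear_onD [OF f] A by (auto simp: f_def)
  then have "opmod_isomorphic \<Omega> (vec_mod X T) (vec_mod Z U\<lparr>carrier := ?P\<rparr>)"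
    unfolding opmod_isomorphic_def by auto
  moreover have "{v \<oplus>\<^bsub>vec_mod Z U\<^esub> w | v w. v \<in> ?P \<and> w \<in> ?P'} = carrier (vec_mod Z U)"
    unfolding vec_mod_simps by (rule 4)
  moreover have "?P \<inter> ?P' = {\<zero>\<^bsub>vec_mod Z U\<^esub>}"
    unfolding vec_mod_simps by (rule 3)
  ultimately show ?L
    unfolding iso_to_summand_def using 1 2 by blast
qed

text \<open>The \<open>q\<close> copies are flattened into one space on
  \<open>{..<q} \<times> Y\<close>, on which operators act slice by slice; \<open>A i\<close> and
  \<open>B i\<close> are the blocks of the two matrices of a splitting.\<close>

lemma iso_to_summand_copies_vec_mod_iff:
  fixes X :: "'x set" and Y :: "'y set" and T :: "'o \<Rightarrow> ('x \<Rightarrow> 'k::field) \<Rightarrow> 'x \<Rightarrow> 'k"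
  assumes fin: "finite X" "finite Y"
    and T: "\<And>\<omega>. \<omega> \<in> \<Omega> \<Longrightarrow> linear_on X X (T \<omega>)"
    and U: "\<And>\<omega>. \<omega> \<in> \<Omega> \<Longrightarrow> linear_on Y Y (U \<omega>)"
  shows "iso_to_summand \<Omega> (vec_mod X T) (copies q (vec_mod Y U)) \<longleftrightarrow>
    (\<exists>A B. (\<forall>i<q. \<forall>\<omega>\<in>\<Omega>. \<forall>F\<in>free_on X. lin_map X Y (A i) (T \<omega> F) = U \<omega> (lin_map X Y (A i) F)) \<and>
           (\<forall>i<q. \<forall>\<omega>\<in>\<Omega>. \<forall>F\<in>free_on Y. lin_map Y X (B i) (U \<omega> F) = T \<omega> (lin_map Y X (B i) F)) \<and>
           (\<forall>x\<in>X. \<forall>x'\<in>X. (\<Sum>i<q. \<Sum>y\<in>Y. A i x y * B i y x') = of_bool (x = x')))"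
    (is "?L \<longleftrightarrow> ?R")
proof -
  let ?Z = "{..<q} \<times> Y"
  define slice where "slice F i = (\<lambda>y. if y \<in> Y then F (i, y) else 0)" for F :: "nat \<times> 'y \<Rightarrow> 'k" and i
  define V where "V \<omega> F = (\<lambda>(i, y). if i < q \<and> y \<in> Y then U \<omega> (slice F i) y else 0)"
    for \<omega> and F :: "nat \<times> 'y \<Rightarrow> 'k"
  have slice: "slice F i \<in> free_on Y" for F i
    using fin by (simp add: slice_def mem_free_on_finite)
  have slice_simps: "slice (F + H) i = slice F i + slice H i" "slice (fscale c F) i
      = fscale c (slice F i)"
    for F H c i by (auto simp: slice_def fun_eq_iff)
  have V: "linear_on ?Z ?Z (V \<omega>)" if "\<omega> \<in> \<Omega>" for \<omega>
  proof -
    have "V \<omega> F \<in> free_on ?Z" for F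
      using fin by (auto simp: V_def mem_free_on_finite)
    moreover have "V \<omega> (F + H) = V \<omega> F + V \<omega> H" for F H
      using linear_onD(2) [OF U [OF that] slice slice] by (auto simp: V_def slice_simps fun_eq_iff)
    moreover have "V \<omega> (fscale c F) = fscale c (V \<omega> F)" for c F
      using linear_onD(3) [OF U [OF that] slice] by (auto simp: V_def slice_simps fun_eq_iff)
    ultimately show ?thesis by (simp add: linear_on_def)
  qed
  have sliceV: "slice (V \<omega> F) i = U \<omega> (slice F i)" if "i < q" "\<omega> \<in> \<Omega>" for \<omega> F i
  proof -
    have "U \<omega> (slice F i) \<in> free_on Y" using linear_onD(1) [OF U slice] that by simp
    then show ?thesis
      unfolding slice_def [of "V \<omega> F"] using fin that by (auto simp: V_def mem_free_on_finite)
  qed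
  have V_eqI: "V \<omega> F = H" if "H \<in> free_on ?Z" "\<And>i. i < q \<Longrightarrow> slice H i = U \<omega> (slice F i)" for \<omega> F H
  proof
    fix z show "V \<omega> F z = H z"
    proof (cases "z \<in> ?Z")
      case True
      then show ?thesis using fun_cong [OF that(2) [of "fst z"], of "snd z"]
        by (auto simp: V_def slice_def [of H])
    qed (use that fin in \<open>auto simp: V_def mem_free_on_finite split: prod.splits\<close>)
  qed
  have "op_equiv \<Omega> (copies q (vec_mod Y U)) (vec_mod ?Z V)"
    unfolding copies_def
  proof (rule op_equiv_direct_sum_vec_mod [where e = Pair])
    show "bij_betw (\<lambda>(i, y). (i, y)) (Sigma {..<q} (\<lambda>_. Y)) ({..<q} \<times> Y)"
      by (simp add: case_prod_unfold bij_betw_def)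
  qed (use fin U V in \<open>auto simp: V_def slice_def\<close>)
  moreover have "op_equiv \<Omega> (vec_mod X T) (vec_mod X T)"
    by (rule op_equiv_vec_mod_cong [OF T]) auto
  ultimately have "?L \<longleftrightarrow> iso_to_summand \<Omega> (vec_mod X T) (vec_mod ?Z V)"
    by (intro iso_to_summand_cong)
  also have "\<dots> \<longleftrightarrow>
    (\<exists>A B. (\<forall>\<omega>\<in>\<Omega>. \<forall>F\<in>free_on X. lin_map X ?Z A (T \<omega> F) = V \<omega> (lin_map X ?Z A F)) \<and>
           (\<forall>\<omega>\<in>\<Omega>. \<forall>F\<in>free_on ?Z. lin_map ?Z X B (V \<omega> F) = T \<omega> (lin_map ?Z X B F)) \<and>
           (\<forall>x\<in>X. \<forall>x'\<in>X. (\<Sum>z\<in>?Z. A x z * B z x') = of_bool (x = x')))" (is "_ \<longleftrightarrow> ?R'")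
    using fin T V by (intro iso_to_summand_vec_mod_iff) auto
  also have "\<dots> \<longleftrightarrow> ?R"
  proof
    assume ?R'
    then obtain A B where A: "\<And>\<omega> F. \<omega> \<in> \<Omega> \<Longrightarrow> F \<in> free_on X \<Longrightarrow> lin_map X ?Z A (T \<omega> F)
        = V \<omega> (lin_map X ?Z A F)"
      and B: "\<And>\<omega> F. \<omega> \<in> \<Omega> \<Longrightarrow> F \<in> free_on ?Z \<Longrightarrow> lin_map ?Z X B (V \<omega> F) = T \<omega> (lin_map ?Z X B F)"
      and AB: "\<And>x x'. x \<in> X \<Longrightarrow> x' \<in> X \<Longrightarrow> (\<Sum>z\<in>?Z. A x z * B z x') = of_bool (x = x')"
      by blast
    let ?A = "\<lambda>i x y. A x (i, y)" and ?B = "\<lambda>i y x. B (i, y) x"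
    have sA: "lin_map X Y (?A i) F = slice (lin_map X ?Z A F) i" if "i < q" for i F
      using that by (auto simp: slice_def lin_map_def)
    \<comment> \<open>Places a vector in the \<open>i\<close>-th copy and 0 in the others; the full
      projection applied to it isolates the block \<open>B i\<close>.\<close>
    define emb where "emb i F = (\<lambda>(j, y). if j = i then F y else 0)" for i :: nat and F :: "'y \<Rightarrow> 'k"
    have emb: "emb i F \<in> free_on ?Z" if "i < q" "F \<in> free_on Y" for i F
      using fin that by (auto simp: emb_def mem_free_on_finite)
    have sB: "lin_map Y X (?B i) F = lin_map ?Z X B (emb i F)" if "i < q" for i F
    proof -
      have "(\<Sum>y\<in>Y. F y * B (i, y) x) = (\<Sum>z\<in>?Z. emb i F z * B z x)" for x
      proof -
        have "(\<Sum>z\<in>?Z. emb i F z * B z x) = (\<Sum>j<q. if j = i then \<Sum>y\<in>Y. F y * B (i, y) x else 0)"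
          unfolding sum.cartesian_product' by (intro sum.cong) (auto simp: emb_def)
        then show ?thesis using that by simp
      qed
      then show ?thesis unfolding lin_map_def by presburger
    qed
    have embV: "V \<omega> (emb i F) = emb i (U \<omega> F)" if "i < q" "F \<in> free_on Y" "\<omega> \<in> \<Omega>" for i F \<omega>
    proof (rule V_eqI)
      have UF: "U \<omega> F \<in> free_on Y" using that linear_onD(1) [OF U] by simp
      show "emb i (U \<omega> F) \<in> free_on ?Z" using emb that UF by simp
      have "slice (emb i H) j = (if j = i then H else 0)" if "H \<in> free_on Y" for H j
        using that fin by (auto simp: slice_def emb_def mem_free_on_finite fun_eq_iff)
      then show "slice (emb i (U \<omega> F)) j = U \<omega> (slice (emb i F) j)" for j
        using that UF linear_on_0 [OF U] by simp
    qed
    show ?R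
    proof (intro exI [of _ ?A] exI [of _ ?B] conjI allI impI ballI)
      fix i \<omega> and F :: "'x \<Rightarrow> 'k" assume "i < q" "\<omega> \<in> \<Omega>" "F \<in> free_on X"
      then show "lin_map X Y (?A i) (T \<omega> F) = U \<omega> (lin_map X Y (?A i) F)"
        by (simp add: sA A sliceV)
    next
      fix i \<omega> and F :: "'y \<Rightarrow> 'k" assume "i < q" "\<omega> \<in> \<Omega>" "F \<in> free_on Y"
      then show "lin_map Y X (?B i) (U \<omega> F) = T \<omega> (lin_map Y X (?B i) F)"
        by (simp add: sB B emb embV [symmetric])
    next
      fix x x' assume "x \<in> X" "x' \<in> X"
      then show "(\<Sum>i<q. \<Sum>y\<in>Y. ?A i x y * ?B i y x') = of_bool (x = x')"
        using AB [of x x'] by (simp add: sum.cartesian_product')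
    qed
  next
    assume ?R
    then obtain A B where A: "\<And>i \<omega> F. i < q \<Longrightarrow> \<omega> \<in> \<Omega> \<Longrightarrow> F \<in> free_on X \<Longrightarrow> lin_map X Y (A i) (T \<omega> F)
        = U \<omega> (lin_map X Y (A i) F)"
      and B: "\<And>i \<omega> F. i < q \<Longrightarrow> \<omega> \<in> \<Omega> \<Longrightarrow> F \<in> free_on Y \<Longrightarrow> lin_map Y X (B i) (U \<omega> F)
          = T \<omega> (lin_map Y X (B i) F)"
      and AB: "\<And>x x'. x \<in> X \<Longrightarrow> x' \<in> X \<Longrightarrow> (\<Sum>i<q. \<Sum>y\<in>Y. A i x y * B i y x') = of_bool (x = x')"
      by blast
    let ?A = "\<lambda>x (i, y). A i x y" and ?B = "\<lambda>(i, y) x. B i y x"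
    have sA: "slice (lin_map X ?Z ?A F) i = lin_map X Y (A i) F" if "i < q" for i F
      using that by (auto simp: slice_def lin_map_def)
    have sB: "lin_map ?Z X ?B F = (\<Sum>i<q. lin_map Y X (B i) (slice F i))" for F
      by (rule ext) (auto simp: lin_map_def sum_apply sum.cartesian_product' slice_def)
    have Bin: "lin_map Y X (B i) H \<in> free_on X" for i H
      using fin by (simp add: lin_map_def mem_free_on_finite)
    show ?R'
    proof (intro exI [of _ ?A] exI [of _ ?B] conjI allI impI ballI)
      fix \<omega> and F :: "'x \<Rightarrow> 'k" assume *: "\<omega> \<in> \<Omega>" "F \<in> free_on X"
      show "lin_map X ?Z ?A (T \<omega> F) = V \<omega> (lin_map X ?Z ?A F)"
      proof (rule V_eqI [symmetric])
        show "lin_map X ?Z ?A (T \<omega> F) \<in> free_on ?Z"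
          using fin by (auto simp: lin_map_def mem_free_on_finite)
      qed (use * in \<open>simp add: sA A\<close>)
    next
      fix \<omega> and F :: "nat \<times> 'y \<Rightarrow> 'k" assume *: "\<omega> \<in> \<Omega>" "F \<in> free_on ?Z"
      have "lin_map ?Z X ?B (V \<omega> F) = (\<Sum>i<q. T \<omega> (lin_map Y X (B i) (slice F i)))"
        using * by (simp add: sB sliceV B slice)
      also have "\<dots> = T \<omega> (lin_map ?Z X ?B F)"
        unfolding sB using * Bin by (intro linear_on_sum [OF T, symmetric]) auto
      finally show "lin_map ?Z X ?B (V \<omega> F) = T \<omega> (lin_map ?Z X ?B F)" .
    next
      fix x x' assume "x \<in> X" "x' \<in> X"
      then show "(\<Sum>z\<in>?Z. ?A x z * ?B z x') = of_bool (x = x')"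
        using AB [of x x'] by (simp add: sum.cartesian_product')
    qed
  qed
  finally show ?thesis .
qed

section \<open>Permutation modules\<close>

text \<open>Operators act by pulling back: a right action \<open>x \<mapsto> x s\<close> on basis vectors corresponds to
  \<open>\<rho> s x = x s\<^sup>-\<^sup>1\<close>.\<close>

definition perm_op ::
  "'s set \<Rightarrow> ('s \<Rightarrow> 'x \<Rightarrow> 'x) \<Rightarrow> ('o \<Rightarrow> 's \<Rightarrow> 'k::field) \<Rightarrow> 'x set \<Rightarrow> 'o \<Rightarrow> ('x \<Rightarrow> 'k) \<Rightarrow> 'x \<Rightarrow> 'k" where
  "perm_op S \<rho> w X \<omega> F = (\<lambda>x. if x \<in> X then \<Sum>s\<in>S. w \<omega> s * F (\<rho> s x) else 0)"

lemma linear_on_perm_op: "finite X \<Longrightarrow> linear_on X X (perm_op S \<rho> w X \<omega>)"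
  by (auto simp: linear_on_def perm_op_def mem_free_on_finite fun_eq_iff algebra_simps
      sum.distrib sum_distrib_left)

text \<open>The usual description of intertwiners between permutation modules, as matrices constant
  on orbits of pairs. \<open>S\<close> is a bare index set, so that left and right multiplications
  can later form one family.\<close>

definition inv_mat :: "'s set \<Rightarrow> ('s \<Rightarrow> 'x \<Rightarrow> 'x) \<Rightarrow> 'x set \<Rightarrow> 'x set \<Rightarrow> ('x \<Rightarrow> 'x \<Rightarrow> 'k) \<Rightarrow> bool" where
  "inv_mat S \<rho> X Y A \<longleftrightarrow> (\<forall>s\<in>S. \<forall>x\<in>X. \<forall>y\<in>Y. A (\<rho> s x) (\<rho> s y) = A x y)"

text \<open>Invariance replaces \<open>A x y\<close> by \<open>A (\<rho> s x) (\<rho> s y)\<close>,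
  and as \<open>\<rho> s\<close> permutes the source, the sum over \<open>x\<close> can then be
  reindexed.\<close>

lemma lin_map_perm_op:
  assumes fin: "finite X" and bij: "\<And>s. s \<in> S \<Longrightarrow> bij_betw (\<rho> s) X X"
    and Y: "\<And>s. s \<in> S \<Longrightarrow> \<rho> s \<in> Y \<rightarrow> Y" and A: "inv_mat S \<rho> X Y A"
  shows "lin_map X Y A (perm_op S \<rho> w X \<omega> F) = perm_op S \<rho> w Y \<omega> (lin_map X Y A F)"
proof
  fix y
  show "lin_map X Y A (perm_op S \<rho> w X \<omega> F) y = perm_op S \<rho> w Y \<omega> (lin_map X Y A F) y"
  proof (cases "y \<in> Y")
    case True
    have "lin_map X Y A (perm_op S \<rho> w X \<omega> F) y = (\<Sum>x\<in>X. \<Sum>s\<in>S. w \<omega> s * (F (\<rho> s x) * A x y))"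
      using True by (simp add: lin_map_def perm_op_def sum_distrib_right mult.assoc)
    also have "\<dots> = (\<Sum>s\<in>S. w \<omega> s * (\<Sum>x\<in>X. F (\<rho> s x) * A x y))"
      by (subst sum.swap) (simp add: sum_distrib_left)
    also have "\<dots> = (\<Sum>s\<in>S. w \<omega> s * (\<Sum>x\<in>X. F (\<rho> s x) * A (\<rho> s x) (\<rho> s y)))"
      using A True by (auto simp: inv_mat_def intro!: sum.cong)
    also have "\<dots> = (\<Sum>s\<in>S. w \<omega> s * (\<Sum>x\<in>X. F x * A x (\<rho> s y)))"
    proof (rule sum.cong [OF refl])
      fix s assume "s \<in> S"
      then show "w \<omega> s * (\<Sum>x\<in>X. F (\<rho> s x) * A (\<rho> s x) (\<rho> s y)) = w \<omega> s * (\<Sum>x\<in>X. F x * A x (\<rho> s y))"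
        using sum.reindex_bij_betw [OF bij, of s "\<lambda>x. F x * A x (\<rho> s y)"] by simp
    qed
    also have "\<dots> = perm_op S \<rho> w Y \<omega> (lin_map X Y A F) y"
    proof -
      have "\<rho> s y \<in> Y" if "s \<in> S" for s using True Y [OF that] by auto
      then show ?thesis using True by (simp add: perm_op_def lin_map_def)
    qed
    finally show ?thesis .
  qed (simp add: lin_map_def perm_op_def)
qed

text \<open>The hypothesis on \<open>w\<close> provides for each \<open>s\<close> an operator that
  is exactly the pullback along \<open>\<rho> s\<close>. It sends \<open>delta (\<rho> s x)\<close>
  to \<open>delta x\<close>; comparing coefficients at \<open>y\<close> gives the
  invariance.\<close>

lemma inv_mat_of_intertwining:
  assumes fin: "finite X" "finite S" and bij: "\<And>s. s \<in> S \<Longrightarrow> bij_betw (\<rho> s) X X"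
    and Y: "\<And>s. s \<in> S \<Longrightarrow> \<rho> s \<in> Y \<rightarrow> Y"
    and w: "\<And>s. s \<in> S \<Longrightarrow> \<exists>\<omega>\<in>\<Omega>. \<forall>t\<in>S. w \<omega> t = of_bool (t = s)"
    and A: "\<And>\<omega> F. \<omega> \<in> \<Omega> \<Longrightarrow> F \<in> free_on X \<Longrightarrow>
      lin_map X Y A (perm_op S \<rho> w X \<omega> F) = perm_op S \<rho> w Y \<omega> (lin_map X Y A F)"
  shows "inv_mat S \<rho> X Y A"
  unfolding inv_mat_def
proof (intro ballI)
  fix s x y assume s: "s \<in> S" and x: "x \<in> X" and y: "y \<in> Y"
  obtain \<omega> where \<omega>: "\<omega> \<in> \<Omega>" "\<And>t. t \<in> S \<Longrightarrow> w \<omega> t = of_bool (t = s)" using w [OF s] by auto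
  have op: "perm_op S \<rho> w Z \<omega> F z = F (\<rho> s z)" if "z \<in> Z" for Z F z
  proof -
    have "(\<Sum>t\<in>S. w \<omega> t * F (\<rho> t z)) = (\<Sum>t\<in>S. if t = s then F (\<rho> s z) else 0)"
      by (intro sum.cong) (auto simp: \<omega>(2))
    then show ?thesis using that s fin by (simp add: perm_op_def)
  qed
  have \<rho>x: "\<rho> s x \<in> X" using bij_betw_apply [OF bij [OF s] x] .
  have "perm_op S \<rho> w X \<omega> (delta (\<rho> s x)) = delta x"
  proof
    fix z show "perm_op S \<rho> w X \<omega> (delta (\<rho> s x)) z = delta x z"
    proof (cases "z \<in> X")
      case True
      then have "\<rho> s z = \<rho> s x \<longleftrightarrow> z = x"
        using bij_betw_imp_inj_on [OF bij [OF s]] x by (auto simp: inj_on_def)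
      then show ?thesis using True by (simp add: op delta_apply)
    qed (use x in \<open>auto simp: perm_op_def delta_apply\<close>)
  qed
  then have "lin_map X Y A (delta x) y = perm_op S \<rho> w Y \<omega> (lin_map X Y A (delta (\<rho> s x))) y"
    using A [OF \<omega>(1), of "delta (\<rho> s x)"] \<rho>x by simp
  then show "A (\<rho> s x) (\<rho> s y) = A x y"
    using x y \<rho>x fin Y [OF s] by (auto simp: lin_map_delta op)
qed

text \<open>The permutation module on \<open>X\<close> is a direct summand of \<open>q\<close> copies of the one on \<open>Y\<close>: the matrices
  \<open>A i\<close> and \<open>B i\<close> are the components of the inclusion and of the projection.\<close>

definition pdiv_by ::
  "'k::field itself \<Rightarrow> nat \<Rightarrow> 's set \<Rightarrow> ('s \<Rightarrow> 'x \<Rightarrow> 'x) \<Rightarrow> 'x set \<Rightarrow> 'x set \<Rightarrow> bool" where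
  "pdiv_by _ q S \<rho> X Y \<longleftrightarrow> (\<exists>A B :: nat \<Rightarrow> 'x \<Rightarrow> 'x \<Rightarrow> 'k.
     (\<forall>i<q. inv_mat S \<rho> X Y (A i)) \<and> (\<forall>i<q. inv_mat S \<rho> Y X (B i)) \<and>
     (\<forall>x\<in>X. \<forall>x'\<in>X. (\<Sum>i<q. \<Sum>y\<in>Y. A i x y * B i y x') = of_bool (x = x')))"

definition pdiv ::
  "'k::field itself \<Rightarrow> 's set \<Rightarrow> ('s \<Rightarrow> 'x \<Rightarrow> 'x) \<Rightarrow> 'x set \<Rightarrow> 'x set \<Rightarrow> bool" where
  "pdiv K S \<rho> X Y \<longleftrightarrow> (\<exists>q. pdiv_by K q S \<rho> X Y)"

lemma iso_to_summand_copies_perm_iff: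
  fixes w :: "'o \<Rightarrow> 's \<Rightarrow> 'k::field"
  assumes fin: "finite X" "finite Y" "finite S"
    and X: "\<And>s. s \<in> S \<Longrightarrow> bij_betw (\<rho> s) X X" and Y: "\<And>s. s \<in> S \<Longrightarrow> bij_betw (\<rho> s) Y Y"
    and w: "\<And>s. s \<in> S \<Longrightarrow> \<exists>\<omega>\<in>\<Omega>. \<forall>t\<in>S. w \<omega> t = of_bool (t = s)"
  shows "iso_to_summand \<Omega> (vec_mod X (perm_op S \<rho> w X)) (copies q (vec_mod Y (perm_op S \<rho> w Y)))
    \<longleftrightarrow> pdiv_by TYPE('k) q S \<rho> X Y"
proof -
  have XX: "\<rho> s \<in> X \<rightarrow> X" and YY: "\<rho> s \<in> Y \<rightarrow> Y" if "s \<in> S" for s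
    using bij_betw_imp_funcset X Y that by blast+
  have 1: "(\<forall>\<omega>\<in>\<Omega>. \<forall>F\<in>free_on X. lin_map X Y A (perm_op S \<rho> w X \<omega> F) = perm_op S \<rho> w Y \<omega> (lin_map X Y
      A F))
    \<longleftrightarrow> inv_mat S \<rho> X Y A" for A :: "_ \<Rightarrow> _ \<Rightarrow> 'k"
  proof
    assume "inv_mat S \<rho> X Y A"
    then show "\<forall>\<omega>\<in>\<Omega>. \<forall>F\<in>free_on X. lin_map X Y A (perm_op S \<rho> w X \<omega> F) = perm_op S \<rho> w Y \<omega> (lin_map
        X Y A F)"
      by (simp add: lin_map_perm_op [where S = S and \<rho> = \<rho>, OF fin(1) X YY])
  next
    assume "\<forall>\<omega>\<in>\<Omega>. \<forall>F\<in>free_on X. lin_map X Y A (perm_op S \<rho> w X \<omega> F) = perm_op S \<rho> w Y \<omega> (lin_map X Y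
        A F)"
    then show "inv_mat S \<rho> X Y A"
      by (intro inv_mat_of_intertwining [OF fin(1,3) X YY w]) simp_all
  qed
  have 2: "(\<forall>\<omega>\<in>\<Omega>. \<forall>F\<in>free_on Y. lin_map Y X A (perm_op S \<rho> w Y \<omega> F) = perm_op S \<rho> w X \<omega> (lin_map Y X
      A F))
    \<longleftrightarrow> inv_mat S \<rho> Y X A" for A :: "_ \<Rightarrow> _ \<Rightarrow> 'k"
  proof
    assume "inv_mat S \<rho> Y X A"
    then show "\<forall>\<omega>\<in>\<Omega>. \<forall>F\<in>free_on Y. lin_map Y X A (perm_op S \<rho> w Y \<omega> F) = perm_op S \<rho> w X \<omega> (lin_map
        Y X A F)"
      by (simp add: lin_map_perm_op [where S = S and \<rho> = \<rho>, OF fin(2) Y XX])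
  next
    assume "\<forall>\<omega>\<in>\<Omega>. \<forall>F\<in>free_on Y. lin_map Y X A (perm_op S \<rho> w Y \<omega> F) = perm_op S \<rho> w X \<omega> (lin_map Y X
        A F)"
    then show "inv_mat S \<rho> Y X A"
      by (intro inv_mat_of_intertwining [OF fin(2,3) Y XX w]) simp_all
  qed
  show ?thesis
    unfolding pdiv_by_def
      iso_to_summand_copies_vec_mod_iff [OF fin(1,2) linear_on_perm_op [OF fin(1)] linear_on_perm_op
          [OF fin(2)]]
      1 2 by (rule refl)
qed

text \<open>Frees the copies from numbering: later the index sets consist of pairs or
  triples.\<close>

lemma pdivI:
  fixes A B :: "'i \<Rightarrow> 'x \<Rightarrow> 'x \<Rightarrow> 'k::field"
  assumes J: "finite J" and A: "\<And>i. i \<in> J \<Longrightarrow> inv_mat S \<rho> X Y (A i)"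
    and B: "\<And>i. i \<in> J \<Longrightarrow> inv_mat S \<rho> Y X (B i)"
    and AB: "\<And>x x'. x \<in> X \<Longrightarrow> x' \<in> X \<Longrightarrow> (\<Sum>i\<in>J. \<Sum>y\<in>Y. A i x y * B i y x') = of_bool (x = x')"
  shows "pdiv TYPE('k) S \<rho> X Y"
proof -
  obtain h where h: "bij_betw h {..<card J} J"
    using ex_bij_betw_nat_finite [OF J] by (auto simp: atLeast0LessThan)
  have "pdiv_by TYPE('k) (card J) S \<rho> X Y"
    unfolding pdiv_by_def
  proof (rule exI [of _ "\<lambda>i. A (h i)"], rule exI [of _ "\<lambda>i. B (h i)"], intro conjI allI impI ballI)
    fix x x' assume "x \<in> X" "x' \<in> X"
    then show "(\<Sum>i<card J. \<Sum>y\<in>Y. A (h i) x y * B (h i) y x') = of_bool (x = x')"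
      using AB sum.reindex_bij_betw [OF h, of "\<lambda>i. \<Sum>y\<in>Y. A i x y * B i y x'"] by simp
  qed (use bij_betw_apply [OF h] A B in auto)
  then show ?thesis by (auto simp: pdiv_def)
qed

text \<open>A zero block is added; this supplies the positive number of copies asked for in
  \<open>module_has_depth\<close>.\<close>

lemma pdiv_by_Suc:
  fixes X Y :: "'x set"
  assumes "pdiv_by TYPE('k::field) q S \<rho> X Y"
  shows "pdiv_by TYPE('k) (Suc q) S \<rho> X Y"
proof -
  from assms obtain A B :: "nat \<Rightarrow> 'x \<Rightarrow> 'x \<Rightarrow> 'k"
      where "\<forall>i<q. inv_mat S \<rho> X Y (A i)" "\<forall>i<q. inv_mat S \<rho> Y X (B i)"
     "\<forall>x\<in>X. \<forall>x'\<in>X. (\<Sum>i<q. \<Sum>y\<in>Y. A i x y * B i y x') = of_bool (x = x')"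
    by (auto simp: pdiv_by_def)
  then show ?thesis
    unfolding pdiv_by_def
    by - (rule exI [of _ "A(q := (\<lambda>_ _. 0))"], rule exI [of _ "B(q := (\<lambda>_ _. 0))"],
      auto simp: inv_mat_def)
qed

text \<open>Blocks multiply: the pair \<open>(i, j)\<close> gets \<open>A i C j\<close> and
  \<open>D j B i\<close>. Their invariance rests on \<open>\<rho> s\<close> permuting the middle
  set.\<close>

lemma pdiv_trans:
  fixes X Y Z :: "'x set"
  assumes fin: "finite Y" "finite Z" and XY: "pdiv TYPE('k::field) S \<rho> X Y"
      and YZ: "pdiv TYPE('k) S \<rho> Y Z"
    and Y: "\<And>s. s \<in> S \<Longrightarrow> bij_betw (\<rho> s) Y Y"
  shows "pdiv TYPE('k) S \<rho> X Z"
proof -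
  obtain q and A B :: "nat \<Rightarrow> 'x \<Rightarrow> 'x \<Rightarrow> 'k" where
    "\<forall>i<q. inv_mat S \<rho> X Y (A i)" "\<forall>i<q. inv_mat S \<rho> Y X (B i)"
    "\<forall>x\<in>X. \<forall>x'\<in>X. (\<Sum>i<q. \<Sum>y\<in>Y. A i x y * B i y x') = of_bool (x = x')"
    using XY unfolding pdiv_def pdiv_by_def by blast
  then have A: "\<And>i. i<q \<Longrightarrow> inv_mat S \<rho> X Y (A i)" and B: "\<And>i. i<q \<Longrightarrow> inv_mat S \<rho> Y X (B i)"
    and AB: "\<And>x x'. x\<in>X \<Longrightarrow> x'\<in>X \<Longrightarrow> (\<Sum>i<q. \<Sum>y\<in>Y. A i x y * B i y x') = of_bool (x = x')"
    by auto
  obtain r and C D :: "nat \<Rightarrow> 'x \<Rightarrow> 'x \<Rightarrow> 'k" where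
    "\<forall>i<r. inv_mat S \<rho> Y Z (C i)" "\<forall>i<r. inv_mat S \<rho> Z Y (D i)"
    "\<forall>x\<in>Y. \<forall>x'\<in>Y. (\<Sum>i<r. \<Sum>y\<in>Z. C i x y * D i y x') = of_bool (x = x')"
    using YZ unfolding pdiv_def pdiv_by_def by blast
  then have C: "\<And>i. i<r \<Longrightarrow> inv_mat S \<rho> Y Z (C i)" and D: "\<And>i. i<r \<Longrightarrow> inv_mat S \<rho> Z Y (D i)"
    and CD: "\<And>x x'. x\<in>Y \<Longrightarrow> x'\<in>Y \<Longrightarrow> (\<Sum>i<r. \<Sum>y\<in>Z. C i x y * D i y x') = of_bool (x = x')"
    by auto
  define E where "E i x z = (\<Sum>y\<in>Y. A (fst i) x y * C (snd i) y z)" for i x z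
  define E' where "E' i z x = (\<Sum>y\<in>Y. D (snd i) z y * B (fst i) y x)" for i x z
  show ?thesis
  proof (rule pdivI [where J = "{..<q} \<times> {..<r}" and A = E and B = E'])
    fix i assume i: "i \<in> {..<q} \<times> {..<r}"
    show "inv_mat S \<rho> X Z (E i)"
      unfolding inv_mat_def
    proof (intro ballI)
      fix s x z assume *: "s \<in> S" "x \<in> X" "z \<in> Z"
      have "E i (\<rho> s x) (\<rho> s z) = (\<Sum>y\<in>Y. A (fst i) (\<rho> s x) (\<rho> s y) * C (snd i) (\<rho> s y) (\<rho> s z))"
        unfolding E_def by (rule sum.reindex_bij_betw [OF Y [OF *(1)], symmetric])
      also have "\<dots> = E i x z"
        unfolding E_def using A [of "fst i"] C [of "snd i"] i *
            by (intro sum.cong) (auto simp: inv_mat_def)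
      finally show "E i (\<rho> s x) (\<rho> s z) = E i x z" .
    qed
    show "inv_mat S \<rho> Z X (E' i)"
      unfolding inv_mat_def
    proof (intro ballI)
      fix s x z assume *: "s \<in> S" "z \<in> Z" "x \<in> X"
      have "E' i (\<rho> s z) (\<rho> s x) = (\<Sum>y\<in>Y. D (snd i) (\<rho> s z) (\<rho> s y) * B (fst i) (\<rho> s y) (\<rho> s x))"
        unfolding E'_def by (rule sum.reindex_bij_betw [OF Y [OF *(1)], symmetric])
      also have "\<dots> = E' i z x"
        unfolding E'_def using B [of "fst i"] D [of "snd i"] i *
            by (intro sum.cong) (auto simp: inv_mat_def)
      finally show "E' i (\<rho> s z) (\<rho> s x) = E' i z x" .
    qed
  next
    fix x x' assume x: "x \<in> X" "x' \<in> X"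
    have "(\<Sum>i\<in>{..<q} \<times> {..<r}. \<Sum>z\<in>Z. E i x z * E' i z x')
      = (\<Sum>i<q. \<Sum>j<r. \<Sum>z\<in>Z. \<Sum>y\<in>Y. \<Sum>y'\<in>Y. A i x y * (C j y z * D j z y') * B i y' x')"
      by (simp add: sum.cartesian_product' E_def E'_def sum_product mult.assoc)
    \<comment> \<open>The sums over the two intermediate points are moved outside, so that the inner
      sum over \<open>j\<close> and \<open>z\<close> collapses by \<open>CD\<close>.\<close>
    also have "\<dots> = (\<Sum>i<q. \<Sum>y\<in>Y. \<Sum>y'\<in>Y. \<Sum>j<r. \<Sum>z\<in>Z. A i x y * (C j y z * D j z y') * B i y' x')"
      by (intro sum.cong refl, subst sum.swap, subst (2) sum.swap, subst (3) sum.swap,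
        rule trans [OF sum.swap], intro sum.cong refl,
        subst sum.swap, subst (2) sum.swap, rule refl)
    also have "\<dots> = (\<Sum>i<q. \<Sum>y\<in>Y. \<Sum>y'\<in>Y. A i x y * of_bool (y = y') * B i y' x')"
      by (intro sum.cong refl) (simp add: CD [symmetric] sum_distrib_left sum_distrib_right)
    also have "\<dots> = (\<Sum>i<q. \<Sum>y\<in>Y. A i x y * B i y x')"
    proof (intro sum.cong refl)
      fix i y assume "y \<in> Y"
      have "(\<Sum>y'\<in>Y. A i x y * of_bool (y = y') * B i y' x') = (\<Sum>y'\<in>Y. if y' = y then A i x y * B i y
          x' else 0)"
        by (intro sum.cong) auto
      then show "(\<Sum>y'\<in>Y. A i x y * of_bool (y = y') * B i y' x') = A i x y * B i y x'"
        using \<open>y \<in> Y\<close> fin by simp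
    qed
    finally show "(\<Sum>i\<in>{..<q} \<times> {..<r}. \<Sum>z\<in>Z. E i x z * E' i z x') = of_bool (x = x')"
      using AB x by simp
  qed simp
qed

text \<open>The image of \<open>j\<close> and its complement are both stable, so extension by 0
  along \<open>j\<close> is split by restriction. One copy is enough, and both matrices are the
  incidence matrix of \<open>j\<close>.\<close>

lemma pdiv_inj:
  assumes fin: "finite Y" and j: "inj_on j X" "j ` X \<subseteq> Y" "\<And>s x. s \<in> S \<Longrightarrow> x \<in> X \<Longrightarrow> j (\<rho> s x) = \<rho> s (j x)"
    and Y: "\<And>s. s \<in> S \<Longrightarrow> bij_betw (\<rho> s) Y Y" and X: "\<And>s. s \<in> S \<Longrightarrow> bij_betw (\<rho> s) X X"
  shows "pdiv TYPE('k::field) S \<rho> X Y"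
proof (rule pdivI [where J = "{()}" and A = "\<lambda>_ x y. of_bool (y = j x)" and B = "\<lambda>_ y x. of_bool (y
    = j x)"])
  have "\<rho> s y = \<rho> s (j x) \<longleftrightarrow> y = j x" if "s \<in> S" "x \<in> X" "y \<in> Y" for s x y
    using bij_betw_imp_inj_on [OF Y [OF that(1)]] that j(2) by (auto simp: inj_on_def)
  then show "inv_mat S \<rho> X Y (\<lambda>x y. of_bool (y = j x) :: 'k)" "inv_mat S \<rho> Y X (\<lambda>y x. of_bool (y
      = j x) :: 'k)"
    by (auto simp: inv_mat_def j(3))
next
  fix x x' assume x: "x \<in> X" "x' \<in> X"
  have "(\<Sum>y\<in>Y. of_bool (y = j x) * of_bool (y = j x') :: 'k) = (\<Sum>y\<in>Y. if y = j x then of_bool (j x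
      = j x') else 0)"
    by (intro sum.cong) auto
  also have "\<dots> = of_bool (x = x')" using x j(1,2) fin by (auto simp: inj_on_def)
  finally show "(\<Sum>i\<in>{()}. \<Sum>y\<in>Y. of_bool (y = j x) * of_bool (y = j x') :: 'k) = of_bool (x = x')" by simp
qed simp

text \<open>Each piece keeps its own matrices, extended by 0 to the other pieces. Stability and
  disjointness of the pieces keep the extended matrices invariant.\<close>

lemma pdiv_UN:
  fixes X :: "'i \<Rightarrow> 'b set"
  assumes I: "finite I" and disj: "\<And>i i'. i \<in> I \<Longrightarrow> i' \<in> I \<Longrightarrow> i \<noteq> i' \<Longrightarrow> X i \<inter> X i' = {}"
    and div: "\<And>i. i \<in> I \<Longrightarrow> pdiv TYPE('k::field) S \<rho> (X i) Y"
    and X: "\<And>i s. i \<in> I \<Longrightarrow> s \<in> S \<Longrightarrow> \<rho> s \<in> X i \<rightarrow> X i"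
  shows "pdiv TYPE('k) S \<rho> (\<Union>i\<in>I. X i) Y"
proof -
  \<comment> \<open>Bundles the conditions so that \<open>q\<close>, \<open>A\<close> and
    \<open>B\<close> can be chosen in turn, each for all \<open>i\<close> at once.\<close>
  define ok where "ok i q A B \<longleftrightarrow>
     (\<forall>j<q. inv_mat S \<rho> (X i) Y (A j)) \<and> (\<forall>j<q. inv_mat S \<rho> Y (X i) (B j)) \<and>
     (\<forall>x\<in>X i. \<forall>x'\<in>X i. (\<Sum>j<q. \<Sum>y\<in>Y. A j x y * B j y x') = of_bool (x = x'))"
    for i q and A B :: "nat \<Rightarrow> 'b \<Rightarrow> 'b \<Rightarrow> 'k"
  have 0: "\<forall>i\<in>I. \<exists>q A B. ok i q A B"
    using div by (simp add: pdiv_def pdiv_by_def ok_def)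
  obtain q where 1: "\<forall>i\<in>I. \<exists>A B. ok i (q i) A B" using bchoice [OF 0] by auto
  obtain A where 2: "\<forall>i\<in>I. \<exists>B. ok i (q i) (A i) B" using bchoice [OF 1] by auto
  obtain B where "\<forall>i\<in>I. ok i (q i) (A i) (B i)" using bchoice [OF 2] by auto
  then have
    A: "\<And>i j. i \<in> I \<Longrightarrow> j < q i \<Longrightarrow> inv_mat S \<rho> (X i) Y (A i j)" and
    B: "\<And>i j. i \<in> I \<Longrightarrow> j < q i \<Longrightarrow> inv_mat S \<rho> Y (X i) (B i j)" and
    AB: "\<And>i x x'. i \<in> I \<Longrightarrow> x\<in>X i \<Longrightarrow> x'\<in>X i \<Longrightarrow> (\<Sum>j<q i. \<Sum>y\<in>Y. A i j x y * B i j y x') = of_bool (x = x')"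
    by (simp_all add: ok_def)
  define A' where "A' = (\<lambda>(i, j) x y. if x \<in> X i then A i j x y else 0)"
  define B' where "B' = (\<lambda>(i, j) y x. if x \<in> X i then B i j y x else 0)"
  have mem: "\<rho> s x \<in> X i \<longleftrightarrow> x \<in> X i" if "s \<in> S" "i \<in> I" "i' \<in> I" "x \<in> X i'" for s i i' x
  proof -
    have "\<rho> s x \<in> X i'" using X that by blast
    then show ?thesis using disj [OF that(2,3)] that X by (cases "i = i'") auto
  qed
  show ?thesis
  proof (rule pdivI [where J = "Sigma I (\<lambda>i. {..<q i})" and A = A' and B = B'])
    fix k assume "k \<in> Sigma I (\<lambda>i. {..<q i})"
    then show "inv_mat S \<rho> (\<Union>i\<in>I. X i) Y (A' k)" "inv_mat S \<rho> Y (\<Union>i\<in>I. X i) (B' k)"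
      using A B by (auto simp: inv_mat_def A'_def B'_def mem)
  next
    fix x x' assume x: "x \<in> (\<Union>i\<in>I. X i)" "x' \<in> (\<Union>i\<in>I. X i)"
    then obtain i where i: "i \<in> I" "x \<in> X i" by auto
    have "(\<Sum>k\<in>Sigma I (\<lambda>i. {..<q i}). \<Sum>y\<in>Y. A' k x y * B' k y x')
        = (\<Sum>i'\<in>I. \<Sum>j<q i'. \<Sum>y\<in>Y. A' (i', j) x y * B' (i', j) y x')"
      using I by (simp add: sum.Sigma)
    also have "\<dots> = (\<Sum>i'\<in>I. if i' = i then of_bool (x = x') else 0)"
    proof (rule sum.cong [OF refl])
      fix i' assume i': "i' \<in> I"
      show "(\<Sum>j<q i'. \<Sum>y\<in>Y. A' (i', j) x y * B' (i', j) y x') = (if i' = i then of_bool (x = x') else 0)"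
      proof (cases "i' = i")
        case True
        show ?thesis
        proof (cases "x' \<in> X i")
          case True
          then show ?thesis using \<open>i' = i\<close> i AB [OF i(1,2) True] by (simp add: A'_def B'_def)
        next
          case False
          then show ?thesis using \<open>i' = i\<close> i by (auto simp: A'_def B'_def)
        qed
      next
        case False
        then have "x \<notin> X i'" using disj i i' by auto
        then show ?thesis using False by (simp add: A'_def)
      qed
    qed
    also have "\<dots> = of_bool (x = x')" using I i by simp
    finally show "(\<Sum>k\<in>Sigma I (\<lambda>i. {..<q i}). \<Sum>y\<in>Y. A' k x y * B' k y x') = of_bool (x = x')" .
  qed (use I in auto)
qed

section \<open>Quotients of free spaces by multilinear relations\<close>

lemma fspan_eq: "fspan S = fun_space.span S"
  by (simp add: fspan_def)

lemma eqmod_refl: "F - F \<in> fspan R"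
  by (simp add: fspan_eq fun_space.span_zero)

lemma eqmod_trans: "F - H \<in> fspan R \<Longrightarrow> H - K \<in> fspan R \<Longrightarrow> F - K \<in> fspan R"
  using fun_space.span_add [of "F - H" R "H - K"] by (simp add: fspan_eq)

lemma eqmod_scale: "F - H \<in> fspan R \<Longrightarrow> fscale c F - fscale c H \<in> fspan R"
  using fun_space.span_scale [of "F - H" R c] by (simp add: fspan_eq fun_space.scale_right_diff_distrib)

lemma eqmod_add: "F - H \<in> fspan R \<Longrightarrow> F' - H' \<in> fspan R \<Longrightarrow> (F + F') - (H + H') \<in> fspan R"
  using fun_space.span_add [of "F - H" R "F' - H'"] by (simp add: fspan_eq algebra_simps)

lemma eqmod_sum:
  "(\<And>i. i \<in> I \<Longrightarrow> F i - H i \<in> fspan R) \<Longrightarrow> (\<Sum>i\<in>I. F i) - (\<Sum>i\<in>I. H i) \<in> fspan R"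
  unfolding sum_subtractf [symmetric] fspan_eq by (rule fun_space.span_sum)

lemma eqmod_base: "F - H \<in> R \<Longrightarrow> F - H \<in> fspan R"
  unfolding fspan_eq by (rule fun_space.span_base)

text \<open>\<open>\<phi>\<close> gives coordinates and \<open>b\<close> lifts the basis vectors.
  That \<open>\<phi>\<close> kills \<open>R\<close> bounds the quotient from below and
  \<open>expand\<close> bounds it from above, so \<open>fspan R\<close> is exactly the kernel.
  Operators descend to cosets because \<open>\<phi>\<close> intertwines them with \<open>T\<close>,
  which makes this kernel stable.\<close>

lemma op_equiv_quot_mod:
  fixes X :: "'x set" and Y :: "'y set" and \<phi> :: "'x \<Rightarrow> 'y \<Rightarrow> 'k::field"
  assumes Y: "finite Y" and R: "R \<subseteq> free_on X"
    and \<phi>: "\<And>x. x \<in> X \<Longrightarrow> \<phi> x \<in> free_on Y"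
    and kill: "\<And>r. r \<in> R \<Longrightarrow> lin_ext \<phi> r = 0"
    and b: "\<And>y. y \<in> Y \<Longrightarrow> b y \<in> X" "\<And>y. y \<in> Y \<Longrightarrow> \<phi> (b y) = delta y"
    and expand: "\<And>x. x \<in> X \<Longrightarrow> delta x - (\<Sum>y\<in>Y. fscale (\<phi> x y) (delta (b y))) \<in> fspan R"
    and \<tau>: "\<And>\<omega> x. \<omega> \<in> \<Omega> \<Longrightarrow> x \<in> X \<Longrightarrow> \<tau> \<omega> x \<in> free_on X"
    and T: "\<And>\<omega>. \<omega> \<in> \<Omega> \<Longrightarrow> linear_on Y Y (T \<omega>)"
    and op: "\<And>\<omega> x. \<omega> \<in> \<Omega> \<Longrightarrow> x \<in> X \<Longrightarrow> lin_ext \<phi> (\<tau> \<omega> x) = T \<omega> (\<phi> x)"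
  shows "op_equiv \<Omega> (quot_mod (free_on X) (fspan R) (\<lambda>\<omega>. lin_ext (\<tau> \<omega>))) (vec_mod Y T)"
proof -
  let ?N = "fspan R" and ?\<Phi> = "lin_ext \<phi>"
  let ?M = "quot_mod (free_on X) ?N (\<lambda>\<omega>. lin_ext (\<tau> \<omega>))"
  have \<Phi>: "linear_on X Y ?\<Phi>" by (rule linear_on_lin_ext [OF \<phi>])
  have N0: "0 \<in> ?N" and Nadd: "\<And>F H. F \<in> ?N \<Longrightarrow> H \<in> ?N \<Longrightarrow> F + H \<in> ?N"
    and Nsc: "\<And>c F. F \<in> ?N \<Longrightarrow> fscale c F \<in> ?N"
    by (auto simp: fspan_eq fun_space.span_zero fun_space.span_add fun_space.span_scale)
  have "?N \<subseteq> {F \<in> free_on X. ?\<Phi> F = 0}"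
    unfolding fspan_eq
  proof (rule fun_space.span_minimal)
    show "fun_space.subspace {F \<in> free_on X. ?\<Phi> F = 0}"
      by (rule fun_space.subspaceI) (auto simp: linear_onD [OF \<Phi>])
  qed (use R kill in auto)
  then have NX: "F \<in> free_on X" and N\<Phi>: "?\<Phi> F = 0" if "F \<in> ?N" for F using that by auto
  \<comment> \<open>The defect is linear in \<open>F\<close>, so it is enough to look at basis
    vectors, where \<open>expand\<close> applies.\<close>
  have dec: "F - (\<Sum>y\<in>Y. fscale (?\<Phi> F y) (delta (b y))) \<in> ?N" if F: "F \<in> free_on X" for F
  proof -
    let ?\<Psi> = "\<lambda>F. F - (\<Sum>y\<in>Y. fscale (?\<Phi> F y) (delta (b y)))"
    have "linear_on X X ?\<Psi>"
      unfolding linear_on_def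
      using b by (auto simp: linear_onD [OF \<Phi>] fun_eq_iff sum_apply algebra_simps sum.distrib
          sum_distrib_left
        intro!: free_on_simps)
    from linear_on_expand [OF this F]
    have "?\<Psi> F = (\<Sum>x | F x \<noteq> 0. fscale (F x) (?\<Psi> (delta x)))" .
    moreover have "fscale (F x) (?\<Psi> (delta x)) \<in> ?N" if "F x \<noteq> 0" for x
      using expand [of x] F that Nsc by (auto simp: free_on_def)
    ultimately show ?thesis unfolding fspan_eq by (auto intro: fun_space.span_sum)
  qed
  have ker: "F \<in> ?N" if "F \<in> free_on X" "?\<Phi> F = 0" for F
  proof -
    have "(\<Sum>y\<in>Y. fscale (?\<Phi> F y) (delta (b y))) = 0" by (simp add: that fun_eq_iff sum_apply)
    then show ?thesis using dec [OF that(1)] by simp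
  qed
  have mem: "F' \<in> coset ?N F \<longleftrightarrow> F' - F \<in> ?N" for F F'
    unfolding coset_def by (auto intro!: exI [of _ "F' - F"])
  have coset_eq: "coset ?N F = coset ?N F'" if "F - F' \<in> ?N" for F F'
  proof -
    have "F' - F \<in> ?N" using Nsc [OF that, of "-1"] by (simp add: fun_space.scale_right_diff_distrib)
    then have "H - F \<in> ?N \<longleftrightarrow> H - F' \<in> ?N" for H
      using Nadd [of "H - F" "F - F'"] Nadd [of "H - F'" "F' - F"] that by auto
    then show ?thesis by (auto simp: mem)
  qed
  have self: "F \<in> coset ?N F" for F by (simp add: mem N0)
  \<comment> \<open>The operations of \<open>quot_mod\<close> are unions over representatives; a
    union of equal sets over a nonempty coset is that set.\<close>
  have un: "(\<Union>F'\<in>coset ?N F. f F') = c" if "\<And>F'. F' - F \<in> ?N \<Longrightarrow> f F' = c" for F f and c :: "'z set"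
    using that self [of F] unfolding mem [symmetric] by auto
  define \<theta> where "\<theta> Z = ?\<Phi> (SOME F. F \<in> Z)" for Z
  have \<theta>: "\<theta> (coset ?N F) = ?\<Phi> F" if "F \<in> free_on X" for F
  proof -
    define F' where "F' = (SOME F'. F' \<in> coset ?N F)"
    have "F' \<in> coset ?N F" unfolding F'_def by (rule someI [of "\<lambda>F'. F' \<in> coset ?N F", OF self])
    then have d: "F' - F \<in> ?N" by (simp add: mem)
    have "?\<Phi> (F + (F' - F)) = ?\<Phi> F + ?\<Phi> (F' - F)"
      using that NX [OF d] by (intro linear_onD(2) [OF \<Phi>]) auto
    then show ?thesis using N\<Phi> [OF d] by (simp add: \<theta>_def F'_def)
  qed
  have add: "coset ?N F \<oplus>\<^bsub>?M\<^esub> coset ?N H = coset ?N (F + H)" for F H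
  proof -
    have "coset ?N (F' + H') = coset ?N (F + H)" if "F' - F \<in> ?N" "H' - H \<in> ?N" for F' H'
      using Nadd [OF that] by (intro coset_eq) (simp add: algebra_simps)
    then show ?thesis by (auto simp: quot_mod_def intro!: un)
  qed
  have smult: "c \<odot>\<^bsub>?M\<^esub> coset ?N F = coset ?N (fscale c F)" for F c
    by (auto simp: quot_mod_def intro!: un coset_eq eqmod_scale)
  have \<tau>lin: "linear_on X X (lin_ext (\<tau> \<omega>))" if "\<omega> \<in> \<Omega>" for \<omega>
    using that \<tau> by (intro linear_on_lin_ext)
  have \<Phi>T: "?\<Phi> (lin_ext (\<tau> \<omega>) F) = T \<omega> (?\<Phi> F)" if "\<omega> \<in> \<Omega>" "F \<in> free_on X" for \<omega> F
    using linear_on_eqI [OF linear_on_comp [OF \<tau>lin \<Phi>] linear_on_comp [OF \<Phi> T] _ that(2)] that(1) op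
    by simp
  have act: "act ?M \<omega> (coset ?N F) = coset ?N (lin_ext (\<tau> \<omega>) F)" if "\<omega> \<in> \<Omega>" "F \<in> free_on X" for \<omega> F
  proof -
    have "coset ?N (lin_ext (\<tau> \<omega>) F') = coset ?N (lin_ext (\<tau> \<omega>) F)" if d: "F' - F \<in> ?N" for F'
    proof (rule coset_eq)
      have d': "F' \<in> free_on X" using free_on_simps(2) [OF NX [OF d] \<open>F \<in> free_on X\<close>] by simp
      have "lin_ext (\<tau> \<omega>) F' - lin_ext (\<tau> \<omega>) F = lin_ext (\<tau> \<omega>) (F' - F)"
        using d' \<open>F \<in> free_on X\<close> by (rule lin_ext_diff [symmetric])
      moreover have "lin_ext (\<tau> \<omega>) (F' - F) \<in> ?N"
        using NX [OF d] \<open>\<omega> \<in> \<Omega>\<close> linear_onD(1) [OF \<tau>lin] linear_on_0 [OF T]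
        by (intro ker) (simp_all add: \<Phi>T N\<Phi> [OF d])
      ultimately show "lin_ext (\<tau> \<omega>) F' - lin_ext (\<tau> \<omega>) F \<in> ?N" by simp
    qed
    then show ?thesis by (auto simp: quot_mod_def intro!: un)
  qed
  have carrier: "carrier ?M = coset ?N ` free_on X" and zero: "\<zero>\<^bsub>?M\<^esub> = coset ?N 0"
    by (simp_all add: quot_mod_def)
  have "opclosed \<Omega> ?M"
    unfolding opclosed_def carrier zero
    using linear_onD(1) [OF \<tau>lin] by (auto simp: add smult act)
  moreover have "opclosed \<Omega> (vec_mod Y T)" by (rule opclosed_vec_mod [OF T])
  moreover have "bij_betw \<theta> (coset ?N ` free_on X) (free_on Y)"
    unfolding bij_betw_def
  proof
    show "inj_on \<theta> (coset ?N ` free_on X)"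
    proof (rule inj_onI, clarsimp simp: \<theta>)
      fix F F' assume *: "F \<in> free_on X" "F' \<in> free_on X" "?\<Phi> F = ?\<Phi> F'"
      then have "F - F' \<in> ?N" by (intro ker) (auto simp: linear_on_diff [OF \<Phi>])
      then show "coset ?N F = coset ?N F'" by (rule coset_eq)
    qed
    have "\<exists>F\<in>free_on X. ?\<Phi> F = H" if "H \<in> free_on Y" for H
    proof
      let ?F = "\<Sum>y\<in>Y. fscale (H y) (delta (b y))"
      show "?F \<in> free_on X" using b by (auto intro!: free_on_simps)
      have "?\<Phi> ?F = (\<Sum>y\<in>Y. ?\<Phi> (fscale (H y) (delta (b y))))"
        using b by (intro linear_on_sum [OF \<Phi>]) auto
      also have "\<dots> = (\<Sum>y\<in>Y. fscale (H y) (delta y))"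
        using b by (intro sum.cong refl) (simp add: linear_onD(3) [OF \<Phi>])
      also have "\<dots> = H"
        using that Y by (intro free_on_expand [symmetric]) (auto simp: free_on_def)
      finally show "?\<Phi> ?F = H" .
    qed
    then show "\<theta> ` coset ?N ` free_on X = free_on Y"
      using linear_onD(1) [OF \<Phi>] by (fastforce simp: \<theta> image_iff)
  qed
  moreover have "\<theta> (coset ?N 0) = 0" by (simp add: \<theta>)
  ultimately have "op_equiv_by \<Omega> ?M (vec_mod Y T) \<theta>"
    unfolding op_equiv_by_def opmod_iso_def carrier zero
    using linear_onD(1) [OF \<tau>lin] by (auto simp: add smult act \<theta> \<Phi>T linear_onD(2,3) [OF \<Phi>])
  then show ?thesis by (auto simp: op_equiv_def)
qed

text \<open>Induction on the part of the basis already split off. \<open>R\<close> may exceed the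
  multilinear relations, so that the relative tensor powers are covered too.\<close>

lemma delta_tensor_expand:
  fixes V :: "('k::field, 'i \<Rightarrow> 'k, 'z) module_scheme"
  assumes V: "carrier V = free_on I" "add V = (+)" "smult V = fscale" and I: "finite I"
    and R: "multilinear_rels V n \<subseteq> R"
    and t: "us @ [v] @ ws \<in> tuples V n"
  shows "delta (us @ [v] @ ws) - (\<Sum>i\<in>I. fscale (v i) (delta (us @ [delta i] @ ws))) \<in> fspan R"
proof -
  have t': "us @ [u] @ ws \<in> tuples V n" if "u \<in> free_on I" for u
    using t that by (auto simp: tuples_def V)
  have step: "delta (us @ [\<Sum>j\<in>J. fscale (v j) (delta j)] @ ws) -
      (\<Sum>j\<in>J. fscale (v j) (delta (us @ [delta j] @ ws))) \<in> fspan R" if "J \<subseteq> I" for J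
    using finite_subset [OF that I] that
  proof (induction J)
    case empty
    \<comment> \<open>No relation names a tensor with entry 0 outright; it vanishes through the
      scalar relation with \<open>c = 0\<close>.\<close>
    have "delta (us @ [0 \<odot>\<^bsub>V\<^esub> 0] @ ws) - fscale 0 (delta (us @ [0] @ ws)) \<in> multilinear_rels V n"
      unfolding multilinear_rels_def using t' [of 0] by blast
    then have "delta (us @ [0 \<odot>\<^bsub>V\<^esub> 0] @ ws) - fscale 0 (delta (us @ [0] @ ws)) \<in> fspan R"
      using R by (intro eqmod_base) auto
    then show ?case unfolding V by (simp only: sum.empty fun_space.scale_zero_left)
  next
    case (insert j J)
    let ?u = "\<Sum>j\<in>J. fscale (v j) (delta j)" and ?w = "fscale (v j) (delta j)"
    have u: "?u \<in> free_on I" and w: "?w \<in> free_on I" and j: "delta j \<in> free_on I"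
      using insert.prems by (auto intro!: free_on_simps)
    have "delta (us @ [?w \<oplus>\<^bsub>V\<^esub> ?u] @ ws) - delta (us @ [?w] @ ws) - delta (us @ [?u] @ ws) \<in>
        multilinear_rels V n"
      unfolding multilinear_rels_def using t' [OF u] t' [OF w] by blast
    then have "delta (us @ [?w + ?u] @ ws) - (delta (us @ [?w] @ ws) + delta (us @ [?u] @ ws)) \<in> R"
      using R by (auto simp: V algebra_simps)
    then have 1: "delta (us @ [?w + ?u] @ ws) - (delta (us @ [?w] @ ws) + delta (us @ [?u] @ ws)) \<in>
        fspan R"
      by (rule eqmod_base)
    have "delta (us @ [v j \<odot>\<^bsub>V\<^esub> delta j] @ ws) - fscale (v j) (delta (us @ [delta j] @ ws)) \<in>
        multilinear_rels V n"
      unfolding multilinear_rels_def using t' [OF j] by blast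
    then have 2: "delta (us @ [?w] @ ws) - fscale (v j) (delta (us @ [delta j] @ ws)) \<in> fspan R"
      using R by (intro eqmod_base) (auto simp: V)
    have "delta (us @ [?u] @ ws) - (\<Sum>j\<in>J. fscale (v j) (delta (us @ [delta j] @ ws))) \<in> fspan R"
      using insert.IH insert.prems by blast
    from eqmod_trans [OF 1 eqmod_add [OF 2 this]] show ?case
      unfolding sum.insert [OF insert.hyps] .
  qed
  have "v \<in> free_on I" using t by (simp add: tuples_def V)
  then have "v = (\<Sum>j\<in>I. fscale (v j) (delta j))"
    using I by (intro free_on_expand) (auto simp: free_on_def)
  from this [symmetric] show ?thesis using step [OF order_refl] by simp
qed

text \<open>The head is expanded by linearity and the tail left to \<open>IH\<close>, whose prefix
  must be arbitrary because the basis vector just produced joins it. \<open>b\<close> is any choice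
  of lifts: the word itself for \<open>Q\<close>, a normal form for the double.\<close>

lemma delta_tensor_expand_Cons:
  fixes V :: "('k::field, 'i \<Rightarrow> 'k, 'z) module_scheme"
  assumes V: "carrier V = free_on I" "add V = (+)" "smult V = fscale" and I: "finite I"
    and R: "multilinear_rels V n \<subseteq> R"
    and t: "us @ v # vs \<in> tuples V n"
    and IH: "\<And>us. us @ vs \<in> tuples V n \<Longrightarrow>
      delta (us @ vs) - (\<Sum>y\<in>Y. fscale (c y) (delta (us @ map delta (b y)))) \<in> fspan R"
  shows "delta (us @ v # vs) -
    (\<Sum>i\<in>I. \<Sum>y\<in>Y. fscale (v i * c y) (delta (us @ map delta (i # b y)))) \<in> fspan R"
proof (rule eqmod_trans)
  show "delta (us @ v # vs) - (\<Sum>i\<in>I. fscale (v i) (delta (us @ delta i # vs))) \<in> fspan R"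
    using delta_tensor_expand [OF V I R, of us v vs] t by simp
  show "(\<Sum>i\<in>I. fscale (v i) (delta (us @ delta i # vs))) -
    (\<Sum>i\<in>I. \<Sum>y\<in>Y. fscale (v i * c y) (delta (us @ map delta (i # b y)))) \<in> fspan R"
  proof (rule eqmod_sum)
    fix i assume "i \<in> I"
    then have "(us @ [delta i]) @ vs \<in> tuples V n" using t by (auto simp: tuples_def V)
    from eqmod_scale [OF IH [OF this], of "v i"]
    show "fscale (v i) (delta (us @ delta i # vs)) -
      (\<Sum>y\<in>Y. fscale (v i * c y) (delta (us @ map delta (i # b y)))) \<in> fspan R"
      by (simp add: fun_space.scale_sum_right)
  qed
qed

section \<open>Tensor powers of the adjoint module\<close>

text \<open>The coefficient of \<open>x\<^sub>1 \<otimes> \<dots> \<otimes> x\<^sub>n\<close> in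
  \<open>v\<^sub>1 \<otimes> \<dots> \<otimes> v\<^sub>n\<close>. The value 0 for unequal lengths
  makes multilinearity hold without conditions on lengths.\<close>

fun coef :: "('x \<Rightarrow> 'k::field) list \<Rightarrow> 'x list \<Rightarrow> 'k" where
  "coef [] [] = 1"
| "coef (v # vs) (x # xs) = v x * coef vs xs"
| "coef _ _ = 0"

lemma coef_add:
  "coef (us @ [v + w] @ ws) xs = coef (us @ [v] @ ws) xs + coef (us @ [w] @ ws) xs"
proof (induction us arbitrary: xs)
  case Nil
  then show ?case by (cases xs) (auto simp: algebra_simps)
next
  case (Cons u us)
  then show ?case by (cases xs) (auto simp: algebra_simps)
qed

lemma coef_scale: "coef (us @ [fscale c v] @ ws) xs = c * coef (us @ [v] @ ws) xs"
proof (induction us arbitrary: xs)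
  case Nil
  then show ?case by (cases xs) auto
next
  case (Cons u us)
  then show ?case by (cases xs) auto
qed

lemma coef_map_delta: "coef (map delta xs) ys = delta xs ys"
proof (induction xs arbitrary: ys)
  case Nil
  then show ?case by (cases ys) (auto simp: delta_apply)
next
  case (Cons x xs)
  then show ?case by (cases ys) (auto simp: delta_apply)
qed

lemma free_on_tuples_multilinear:
  assumes V: "carrier V = free_on I" "add V = (+)" "smult V = fscale"
  shows "multilinear_rels V n \<subseteq> free_on (tuples V n)"
proof
  fix r assume "r \<in> multilinear_rels V n"
  then consider us v w ws where "r = delta (us @ [v + w] @ ws) - delta (us @ [v] @ ws) - delta (us @
      [w] @ ws)"
      "us @ [v] @ ws \<in> tuples V n" "us @ [w] @ ws \<in> tuples V n"
    | us c v ws where "r = delta (us @ [fscale c v] @ ws) - fscale c (delta (us @ [v] @ ws))"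
      "us @ [v] @ ws \<in> tuples V n"
    by (auto simp: multilinear_rels_def V)
  then show "r \<in> free_on (tuples V n)"
  proof cases
    case 1
    then show ?thesis by (auto intro!: free_on_simps simp: tuples_def V)
  next
    case 2
    then show ?thesis by (auto intro!: free_on_simps simp: tuples_def V)
  qed
qed

text \<open>One half of the universal property of the tensor power, for arbitrary
  \<open>\<phi>\<close> so that it serves both \<open>coef\<close> and \<open>dcoef\<close>.\<close>

lemma multilinear_rels_kill:
  assumes V: "carrier V = free_on I" "add V = (+)" "smult V = fscale"
    and add: "\<And>us v w ws. us @ [v] @ ws \<in> tuples V n \<Longrightarrow> us @ [w] @ ws \<in> tuples V n \<Longrightarrow>
      \<phi> (us @ [v + w] @ ws) = \<phi> (us @ [v] @ ws) + \<phi> (us @ [w] @ ws)"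
    and scale: "\<And>us c v ws. us @ [v] @ ws \<in> tuples V n \<Longrightarrow>
      \<phi> (us @ [fscale c v] @ ws) = fscale c (\<phi> (us @ [v] @ ws))"
    and r: "r \<in> multilinear_rels V n"
  shows "lin_ext \<phi> r = 0"
proof -
  have eq: "lin_ext \<phi> (delta x - delta y) = \<phi> x - \<phi> y" for x y
    by (subst lin_ext_diff [of _ UNIV]) auto
  from r consider us v w ws where "r = delta (us @ [v + w] @ ws) - delta (us @ [v] @ ws) - delta (us
      @ [w] @ ws)"
      "us @ [v] @ ws \<in> tuples V n" "us @ [w] @ ws \<in> tuples V n"
    | us c v ws where "r = delta (us @ [fscale c v] @ ws) - fscale c (delta (us @ [v] @ ws))"
      "us @ [v] @ ws \<in> tuples V n"
    by (auto simp: multilinear_rels_def V)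
  then show ?thesis
  proof cases
    case 1
    have "lin_ext \<phi> r = \<phi> (us @ [v + w] @ ws) - \<phi> (us @ [v] @ ws) - \<phi> (us @ [w] @ ws)"
      unfolding 1(1) by (subst lin_ext_diff [of _ UNIV]) (auto simp: eq intro!: free_on_simps)
    then show ?thesis using add [OF 1(2,3)] by simp
  next
    case 2
    have "lin_ext \<phi> r = \<phi> (us @ [fscale c v] @ ws) - fscale c (\<phi> (us @ [v] @ ws))"
      unfolding 2(1) by (subst lin_ext_diff [of _ UNIV], simp, simp, subst lin_ext_scale
          [of _ UNIV]) auto
    then show ?thesis using scale [OF 2(2)] by simp
  qed
qed

definition words :: "'a set \<Rightarrow> nat \<Rightarrow> 'a list set" where
  "words I n = {xs. set xs \<subseteq> I \<and> length xs = n}"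

lemma finite_words: "finite I \<Longrightarrow> finite (words I n)"
  by (simp add: words_def finite_lists_length_eq)

lemma words_0: "words I 0 = {[]}"
  by (auto simp: words_def)

lemma words_disjoint: "m \<noteq> n \<Longrightarrow> words I m \<inter> words I n = {}"
  by (auto simp: words_def)

lemma Cons_in_words: "x # xs \<in> words I (Suc n) \<longleftrightarrow> x \<in> I \<and> xs \<in> words I n"
  by (auto simp: words_def)

lemma words_Suc: "words I (Suc n) = (\<lambda>(x, xs). x # xs) ` (I \<times> words I n)"
  by (force simp: words_def length_Suc_conv)

lemma sum_words_Suc: "sum f (words I (Suc n)) = (\<Sum>x\<in>I. \<Sum>xs\<in>words I n. f (x # xs))"
  unfolding words_Suc by (subst sum.reindex) (auto simp: inj_on_def sum.cartesian_product')

lemma delta_coef_expand: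
  fixes V :: "('k::field, 'i \<Rightarrow> 'k, 'z) module_scheme"
  assumes V: "carrier V = free_on I" "add V = (+)" "smult V = fscale" and I: "finite I"
    and t: "us @ vs \<in> tuples V n"
  shows "delta (us @ vs) - (\<Sum>xs\<in>words I (length vs). fscale (coef vs xs) (delta (us @ map delta xs)))
    \<in> fspan (multilinear_rels V n)"
  using t
proof (induction vs arbitrary: us)
  case Nil
  have "(\<Sum>xs\<in>words I (length ([] :: ('i \<Rightarrow> 'k) list)). fscale (coef ([] :: ('i \<Rightarrow> 'k) list) xs) (delta
      (us @ map delta xs))) = delta (us @ [])"
    by (simp add: words_0)
  then show ?case by (simp only: eqmod_refl)
next
  case (Cons v vs)
  show ?case
    using delta_tensor_expand_Cons [OF V I order_refl Cons.prems Cons.IH]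
    by (simp only: length_Cons sum_words_Suc coef.simps)
qed

section \<open>A finite group acting on words by conjugation\<close>

locale finite_group = group G for G :: "('g, 'z) monoid_scheme" (structure) +
  assumes finite_carrier [simp]: "finite (carrier G)"
begin

text \<open>The inverse of the action on \<open>Q\<close>: coefficient functions are pulled back
  along the right action \<open>g \<mapsto> x\<^sup>-\<^sup>1 g x\<close>, so the coefficient at
  \<open>y\<close> is read at \<open>cnjg x y\<close>.\<close>

definition cnjg :: "'g \<Rightarrow> 'g \<Rightarrow> 'g" where
  "cnjg h x = h \<otimes> x \<otimes> inv h"

lemma cnjg_closed [simp]: "h \<in> carrier G \<Longrightarrow> x \<in> carrier G \<Longrightarrow> cnjg h x \<in> carrier G"
  by (simp add: cnjg_def)

lemma cnjg_one [simp]: "x \<in> carrier G \<Longrightarrow> cnjg \<one> x = x"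
  by (simp add: cnjg_def)

lemma cnjg_mult:
  "g \<in> carrier G \<Longrightarrow> h \<in> carrier G \<Longrightarrow> x \<in> carrier G \<Longrightarrow> cnjg (g \<otimes> h) x = cnjg g (cnjg h x)"
  by (simp add: cnjg_def inv_mult_group m_assoc)

lemma cnjg_inv [simp]:
  "h \<in> carrier G \<Longrightarrow> x \<in> carrier G \<Longrightarrow> cnjg h (cnjg (inv h) x) = x"
  "h \<in> carrier G \<Longrightarrow> x \<in> carrier G \<Longrightarrow> cnjg (inv h) (cnjg h x) = x"
  by (simp_all add: cnjg_mult [symmetric])

lemma cnjg_eq_iff: "h \<in> carrier G \<Longrightarrow> x \<in> carrier G \<Longrightarrow> y \<in> carrier G \<Longrightarrow> cnjg h x = y \<longleftrightarrow> x = cnjg (inv h) y"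
  by auto

abbreviation cj :: "'g \<Rightarrow> 'g list \<Rightarrow> 'g list" where
  "cj h \<equiv> map (cnjg h)"

abbreviation X :: "nat \<Rightarrow> 'g list set" where
  "X \<equiv> words (carrier G)"

lemma finite_X [simp]: "finite (X n)"
  by (simp add: finite_words)

lemma cj_closed [simp]: "h \<in> carrier G \<Longrightarrow> xs \<in> X n \<Longrightarrow> cj h xs \<in> X n"
  by (auto simp: words_def)

lemma cj_one [simp]: "xs \<in> X n \<Longrightarrow> cj \<one> xs = xs"
  by (auto simp: words_def intro!: map_idI)

lemma cj_mult:
  "g \<in> carrier G \<Longrightarrow> h \<in> carrier G \<Longrightarrow> xs \<in> X n \<Longrightarrow> cj (g \<otimes> h) xs = cj g (cj h xs)"
  by (auto simp: words_def cnjg_mult)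

lemma cj_inv [simp]:
  "h \<in> carrier G \<Longrightarrow> xs \<in> X n \<Longrightarrow> cj h (cj (inv h) xs) = xs"
  "h \<in> carrier G \<Longrightarrow> xs \<in> X n \<Longrightarrow> cj (inv h) (cj h xs) = xs"
  by (auto simp: words_def intro!: map_idI)

lemma bij_cj: "h \<in> carrier G \<Longrightarrow> bij_betw (cj h) (X n) (X n)"
  by (rule bij_betwI [where g = "cj (inv h)"]) (auto simp del: map_map)

lemma sum_translate:
  assumes "h \<in> carrier G"
  shows "(\<Sum>g\<in>carrier G. f (h \<otimes> g)) = (\<Sum>g\<in>carrier G. f g)"
    and "(\<Sum>g\<in>carrier G. f (g \<otimes> h)) = (\<Sum>g\<in>carrier G. f g)"
proof -
  have "bij_betw (\<lambda>g. h \<otimes> g) (carrier G) (carrier G)"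
    using assms by (intro bij_betwI [where g = "\<lambda>g. inv h \<otimes> g"]) (auto simp: m_assoc [symmetric])
  then show "(\<Sum>g\<in>carrier G. f (h \<otimes> g)) = (\<Sum>g\<in>carrier G. f g)"
    by (rule sum.reindex_bij_betw)
  have "bij_betw (\<lambda>g. g \<otimes> h) (carrier G) (carrier G)"
    using assms by (intro bij_betwI [where g = "\<lambda>g. g \<otimes> inv h"]) (auto simp: m_assoc)
  then show "(\<Sum>g\<in>carrier G. f (g \<otimes> h)) = (\<Sum>g\<in>carrier G. f g)"
    by (rule sum.reindex_bij_betw)
qed

abbreviation ad_op :: "'g list set \<Rightarrow> ('g \<Rightarrow> 'k::field) \<Rightarrow> ('g list \<Rightarrow> 'k) \<Rightarrow> 'g list \<Rightarrow> 'k" where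
  "ad_op \<equiv> perm_op (carrier G) cj (\<lambda>a. a)"

lemma adjoint_mod_simps [simp]:
  "carrier (adjoint_mod G) = free_on (carrier G)" "add (adjoint_mod G) = (+)"
  "smult (adjoint_mod G) = fscale" "zero (adjoint_mod G) = 0"
  by (simp_all add: adjoint_mod_def group_alg_def)

lemma act_adjoint_mod:
  "act (adjoint_mod G) a v = (\<lambda>y. if y \<in> carrier G then \<Sum>x\<in>carrier G. a x * v (cnjg x y) else 0)"
proof
  fix y
  have "act (adjoint_mod G) a v y = (\<Sum>g\<in>carrier G. \<Sum>x\<in>carrier G. v g * a x * of_bool (y
      = inv x \<otimes> g \<otimes> x))"
    by (simp add: adjoint_mod_def sum_apply delta_apply)
  also have "\<dots> = (\<Sum>x\<in>carrier G. \<Sum>g\<in>carrier G. if g = cnjg x y \<and> y \<in> carrier G then a x * v (cnjg x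
      y) else 0)"
  proof (subst sum.swap, intro sum.cong refl)
    fix x g assume xg: "x \<in> carrier G" "g \<in> carrier G"
    then have "y = inv x \<otimes> g \<otimes> x \<longleftrightarrow> y = cnjg (inv x) g" by (simp add: cnjg_def)
    also have "\<dots> \<longleftrightarrow> g = cnjg x y \<and> y \<in> carrier G" using xg by auto
    finally show "v g * a x * of_bool (y = inv x \<otimes> g \<otimes> x) = (if g = cnjg x y \<and> y \<in> carrier G then a
        x * v (cnjg x y) else 0)"
      by auto
  qed
  also have "\<dots> = (if y \<in> carrier G then \<Sum>x\<in>carrier G. a x * v (cnjg x y) else 0)"
    by simp
  finally show "act (adjoint_mod G) a v y = (if y \<in> carrier G then \<Sum>x\<in>carrier G. a x * v (cnjg x y)
      else 0)" .
qed

lemma act_adjoint_delta: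
  "x \<in> carrier G \<Longrightarrow> act (adjoint_mod G) (delta x) v = (\<lambda>y. if y \<in> carrier G then v (cnjg x y) else 0)"
  by (rule ext) (simp add: act_adjoint_mod delta_apply if_distrib [of of_bool] of_bool_def
      if_distrib [of "\<lambda>c. c * _"] cong: if_cong)

lemma coef_act:
  assumes "x \<in> carrier G" "set ys \<subseteq> carrier G"
  shows "coef (map (act (adjoint_mod G) (delta x)) vs) ys = coef vs (cj x ys)"
  using assms(2)
proof (induction vs arbitrary: ys)
  case Nil
  then show ?case by (cases ys) auto
next
  case (Cons v vs)
  then show ?case using assms(1) by (cases ys) (auto simp: act_adjoint_delta)
qed

text \<open>The coordinates of a pure tensor are products of coordinates of its factors, and
  \<open>coef_act\<close> turns the diagonal action into conjugation of the whole word. For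
  \<open>n = 0\<close> the only word is \<open>[]\<close>, which gives the trivial module.\<close>

lemma tensor_pow_equiv:
  "op_equiv (group_alg G) (tensor_pow G (adjoint_mod G) n :: ('k::field, _, _) opmod) (vec_mod (X n)
      (ad_op (X n)))"
  unfolding tensor_pow_def
proof (rule op_equiv_quot_mod [where \<phi> = "\<lambda>vs xs. if xs \<in> X n then coef vs xs else 0" and b
    = "map delta"])
  let ?Q = "adjoint_mod G :: ('k, 'g \<Rightarrow> 'k, 'g \<Rightarrow> 'k) opmod"
  let ?\<phi> = "\<lambda>vs xs. if xs \<in> X n then coef vs xs else (0 :: 'k)"
  note V = adjoint_mod_simps(1-3)
  show "multilinear_rels ?Q n \<subseteq> free_on (tuples ?Q n)"
    by (rule free_on_tuples_multilinear [OF V])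
  show "lin_ext ?\<phi> r = 0" if "r \<in> multilinear_rels ?Q n" for r
    using that by (intro multilinear_rels_kill [OF V]) (auto simp: coef_add coef_scale fun_eq_iff
        simp del: append.simps)
  fix vs assume vs: "vs \<in> tuples ?Q n"
  show "?\<phi> vs \<in> free_on (X n)" by (simp add: mem_free_on_finite)
  have "length vs = n" using vs by (simp add: tuples_def)
  then show "delta vs - (\<Sum>xs\<in>X n. fscale (?\<phi> vs xs) (delta (map delta xs))) \<in> fspan
      (multilinear_rels ?Q n)"
    using delta_coef_expand [OF V finite_carrier, of "[]" vs n] vs by simp
  fix a :: "'g \<Rightarrow> 'k"
  have act: "map (act ?Q (delta x)) vs \<in> tuples ?Q n" if "x \<in> carrier G" for x
    using vs that by (auto simp: tuples_def act_adjoint_delta mem_free_on_finite)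
  then show "(\<Sum>x\<in>carrier G. fscale (a x) (delta (map (act ?Q (delta x)) vs))) \<in> free_on (tuples ?Q n)"
    by (intro free_on_simps) auto
  have "lin_ext ?\<phi> (\<Sum>x\<in>carrier G. fscale (a x) (delta (map (act ?Q (delta x)) vs)))
      = (\<Sum>x\<in>carrier G. fscale (a x) (?\<phi> (map (act ?Q (delta x)) vs)))"
    by (subst lin_ext_sum [of _ _ UNIV]) (auto intro!: free_on_simps sum.cong simp: lin_ext_scale
        [of _ UNIV])
  also have "\<dots> = ad_op (X n) a (?\<phi> vs)"
  proof
    fix xs show "(\<Sum>x\<in>carrier G. fscale (a x) (?\<phi> (map (act ?Q (delta x)) vs))) xs
        = ad_op (X n) a (?\<phi> vs) xs"
    proof (cases "xs \<in> X n")
      case True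
      then have "set xs \<subseteq> carrier G" by (simp add: words_def)
      then show ?thesis using True by (simp add: sum_apply perm_op_def coef_act)
    qed (simp add: sum_apply perm_op_def)
  qed
  finally show "lin_ext ?\<phi> (\<Sum>x\<in>carrier G. fscale (a x) (delta (map (act ?Q (delta x)) vs)))
      = ad_op (X n) a (?\<phi> vs)" .
next
  fix xs assume "xs \<in> X n"
  then show "map delta xs \<in> tuples (adjoint_mod G :: ('k, 'g \<Rightarrow> 'k, 'g \<Rightarrow> 'k) opmod) n"
    "(\<lambda>ys. if ys \<in> X n then coef (map delta xs) ys else 0) = (delta xs :: _ \<Rightarrow> 'k)"
    by (auto simp: words_def tuples_def coef_map_delta fun_eq_iff delta_apply)
qed (auto intro: linear_on_perm_op)

end

section \<open>The depth of the adjoint module\<close>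

declare sum_mult_of_bool_eq [simp del] sum_of_bool_mult_eq [simp del]

lemma op_equiv_copies: "op_equiv \<Omega> M N \<Longrightarrow> op_equiv \<Omega> (copies q M) (copies q N)"
  unfolding copies_def by (rule op_equiv_direct_sum)

lemma Ann_op_equiv_subset:
  assumes "op_equiv (group_alg G) M N"
  shows "Ann G M \<subseteq> Ann G N"
proof
  obtain f where f: "op_equiv_by (group_alg G) M N f" using assms by (auto simp: op_equiv_def)
  note fD = op_equiv_byD [OF f]
  fix a assume a: "a \<in> Ann G M"
  have "act N a w = \<zero>\<^bsub>N\<^esub>" if "w \<in> carrier N" for w
  proof -
    have "w \<in> f ` carrier M" using that bij_betw_imp_surj_on [OF fD(3)] by simp
    then obtain v where v: "w = f v" "v \<in> carrier M" by (rule imageE)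
    have "act N a w = f (act M a v)"
      unfolding v(1) using a v(2) by (intro fD(8) [symmetric]) (simp_all add: Ann_def)
    then show ?thesis using a v by (simp add: Ann_def fD(4))
  qed
  then show "a \<in> Ann G N" using a by (simp add: Ann_def)
qed

lemma Ann_op_equiv: "op_equiv (group_alg G) M N \<Longrightarrow> Ann G M = Ann G N"
  using Ann_op_equiv_subset Ann_op_equiv_subset [OF op_equiv_sym] by blast

context finite_group begin

abbreviation gdiv :: "'k::field itself \<Rightarrow> 'g list set \<Rightarrow> 'g list set \<Rightarrow> bool" where
  "gdiv K \<equiv> pdiv K (carrier G) cj"

abbreviation ginv :: "'g list set \<Rightarrow> 'g list set \<Rightarrow> ('g list \<Rightarrow> 'g list \<Rightarrow> 'k) \<Rightarrow> bool" where
  "ginv \<equiv> inv_mat (carrier G) cj"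

text \<open>\<open>Q\<^sup>\<otimes>\<^sup>(\<^sup>n\<^sup>+\<^sup>1\<^sup>)\<close> is a direct summand of a multiple of \<open>Q\<^sup>\<otimes>\<^sup>n\<close>.\<close>

abbreviation stable_at :: "'k::field itself \<Rightarrow> nat \<Rightarrow> bool" where
  "stable_at K n \<equiv> gdiv K (X (Suc n)) (X n)"

text \<open>The identity is fixed by conjugation, so prefixing it to a word is an equivariant
  injection; in module terms, the trivial module is a summand of \<open>Q\<close>.\<close>

lemma pdiv_X_le: "m \<le> n \<Longrightarrow> gdiv TYPE('k::field) (X m) (X n)"
proof (induction n rule: dec_induct)
  case base
  show ?case by (rule pdiv_inj [where j = "\<lambda>x. x"]) (auto intro: bij_cj)
next
  case (step n)
  have *: "gdiv TYPE('k) (X n) (X (Suc n))"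
    by (rule pdiv_inj [where j = "(#) \<one>"]) (auto simp: Cons_in_words cnjg_def intro: bij_cj)
  show ?case using step.IH * by (rule pdiv_trans [rotated 2]) (auto intro: bij_cj)
qed

text \<open>Tensoring with \<open>Q\<close>: the given matrices act on the tails and the identity
  matrix on the heads.\<close>

lemma stable_at_Suc:
  assumes "stable_at TYPE('k::field) n"
  shows "stable_at TYPE('k) (Suc n)"
proof -
  obtain q and A B :: "nat \<Rightarrow> 'g list \<Rightarrow> 'g list \<Rightarrow> 'k" where A: "\<forall>i<q. ginv (X (Suc n)) (X n) (A i)"
    and B: "\<forall>i<q. ginv (X n) (X (Suc n)) (B i)"
    and AB: "\<forall>x\<in>X (Suc n). \<forall>x'\<in>X (Suc n). (\<Sum>i<q. \<Sum>y\<in>X n. A i x y * B i y x') = of_bool (x = x')"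
    using assms unfolding pdiv_def pdiv_by_def by blast
  have inv: "ginv (X (Suc m)) (X (Suc l)) (\<lambda>x y. of_bool (hd x = hd y) * C (tl x) (tl y))"
    if C: "ginv (X m) (X l) C" for m l and C :: "_ \<Rightarrow> _ \<Rightarrow> 'k"
    unfolding inv_mat_def
  proof (intro ballI)
    fix s x y assume s: "s \<in> carrier G" and "x \<in> X (Suc m)" "y \<in> X (Suc l)"
    then obtain a x' b y' where x: "x = a # x'" "a \<in> carrier G" "x' \<in> X m"
        and y: "y = b # y'" "b \<in> carrier G" "y' \<in> X l"
      by (auto simp: words_Suc)
    have "cnjg s a = cnjg s b \<longleftrightarrow> a = b" using s x y by (simp add: cnjg_eq_iff)
    then show "of_bool (hd (cj s x) = hd (cj s y)) * C (tl (cj s x)) (tl (cj s y)) = of_bool (hd x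
        = hd y) * C (tl x) (tl y)"
      using C s x y by (simp add: inv_mat_def)
  qed
  show ?thesis
  proof (rule pdivI [where J = "{..<q}" and A = "\<lambda>i x y. of_bool (hd x = hd y) * A i (tl x) (tl y)"
        and B = "\<lambda>i x y. of_bool (hd x = hd y) * B i (tl x) (tl y)"])
    fix x x' assume "x \<in> X (Suc (Suc n))" "x' \<in> X (Suc (Suc n))"
    then obtain a u b v where x: "x = a # u" "a \<in> carrier G" "u \<in> X (Suc n)" and x': "x'
        = b # v" "b \<in> carrier G" "v \<in> X (Suc n)"
      unfolding words_Suc [of _ "Suc n"] by auto
    have "(\<Sum>i<q. \<Sum>y\<in>X (Suc n). of_bool (hd x = hd y) * A i (tl x) (tl y) * (of_bool (hd y
        = hd x') * B i (tl y) (tl x')))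
      = (\<Sum>i<q. \<Sum>g\<in>carrier G. if g = a then of_bool (a = b) * (\<Sum>y\<in>X n. A i u y * B i y v) else 0)"
      unfolding sum_words_Suc by (intro sum.cong refl) (auto simp: x x')
    also have "\<dots> = of_bool (a = b) * (\<Sum>i<q. \<Sum>y\<in>X n. A i u y * B i y v)"
      using x by (simp add: sum_distrib_left)
    also have "\<dots> = of_bool (x = x')" using AB x x' by simp
    finally show "(\<Sum>i<q. \<Sum>y\<in>X (Suc n). of_bool (hd x = hd y) * A i (tl x) (tl y) * (of_bool (hd y
        = hd x') * B i (tl y) (tl x')))
      = of_bool (x = x')" .
  qed (use A B inv in auto)
qed

text \<open>Once one step up is absorbed, \<open>stable_at_Suc\<close> absorbs all later ones, and
  transitivity brings every power down to the \<open>n\<close>-th.\<close>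

lemma stable_at_pdiv:
  assumes "stable_at TYPE('k::field) n"
  shows "gdiv TYPE('k) (X m) (X n)"
proof (cases "m \<le> n")
  case True
  then show ?thesis by (rule pdiv_X_le)
next
  case False
  then have "n \<le> m" by simp
  then have "gdiv TYPE('k) (X m) (X n) \<and> stable_at TYPE('k) m"
  proof (induction m rule: dec_induct)
    case base
    show ?case using assms pdiv_X_le [of n n] by simp
  next
    case (step m)
    then have "gdiv TYPE('k) (X (Suc m)) (X m)" "gdiv TYPE('k) (X m) (X n)"
      by simp_all
    then have "gdiv TYPE('k) (X (Suc m)) (X n)"
      by (rule pdiv_trans [rotated 2]) (simp_all add: bij_cj)
    then show ?case using step.IH by (simp add: stable_at_Suc)
  qed
  then show ?thesis ..
qed

text \<open>The basis of \<open>T\<^sub>n\<close>: the disjoint union of the bases of the summands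
  can be a plain union, as words of different lengths differ.\<close>

definition XU :: "nat \<Rightarrow> 'g list set" where
  "XU n = (\<Union>i\<in>{1..n}. X i)"

lemma finite_XU [simp]: "finite (XU n)"
  by (simp add: XU_def)

lemma bij_cj_XU: "h \<in> carrier G \<Longrightarrow> bij_betw (cj h) (XU n) (XU n)"
  by (rule bij_betwI [where g = "cj (inv h)"]) (auto simp: XU_def simp del: map_map)

lemma T_mod_equiv:
  "op_equiv (group_alg G) (T_mod G (adjoint_mod G) n :: ('k::field, _, _) opmod) (vec_mod (XU n)
      (ad_op (XU n)))"
  unfolding T_mod_def
proof (rule op_equiv_trans)
  show "op_equiv (group_alg G) (direct_sum {1..n} (tensor_pow G (adjoint_mod G))) (direct_sum {1..n}
      (\<lambda>i. vec_mod (X i) (ad_op (X i) :: _ \<Rightarrow> (_ \<Rightarrow> 'k) \<Rightarrow> _)))"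
    by (rule op_equiv_direct_sum [OF tensor_pow_equiv])
  show "op_equiv (group_alg G) (direct_sum {1..n} (\<lambda>i. vec_mod (X i) (ad_op (X i) :: _ \<Rightarrow> (_ \<Rightarrow> 'k) \<Rightarrow>
      _))) (vec_mod (XU n) (ad_op (XU n)))"
  proof (rule op_equiv_direct_sum_vec_mod [where e = "\<lambda>i y. y"])
    have "inj_on (\<lambda>(i, y). y) (Sigma {1..n} X)" by (auto simp: inj_on_def words_def)
    moreover have "(\<lambda>(i, y). y) ` Sigma {1..n} X = XU n" by (force simp: XU_def)
    ultimately show "bij_betw (\<lambda>(i, y). y) (Sigma {1..n} X) (XU n)" by (simp add: bij_betw_def)
    show "ad_op (XU n) \<omega> F y = ad_op (X i) \<omega> (\<lambda>y. if y \<in> X i then F y else 0) y"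
      if "i \<in> {1..n}" "y \<in> X i" for i y \<omega> and F :: "_ \<Rightarrow> 'k"
    proof -
      have "y \<in> XU n" using that by (auto simp: XU_def)
      then show ?thesis using that by (simp add: perm_op_def)
    qed
  qed (auto intro: linear_on_perm_op)
qed

lemma group_alg_weights:
  "s \<in> carrier G \<Longrightarrow> \<exists>\<omega>\<in>group_alg G. \<forall>t\<in>carrier G. \<omega> t = (of_bool (t = s) :: 'k::field)"
  by (rule bexI [of _ "delta s"]) (auto simp: delta_apply group_alg_def)

text \<open>For \<open>n \<ge> 1\<close> the \<open>n\<close>-th power is a summand of
  \<open>T\<^sub>n\<close>, and all lower powers are summands of it, so the two divide multiples of
  each other. Under stability \<open>stable_at_pdiv\<close> covers the additional power as
  well.\<close>

lemma pdiv_XU_iff: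
  assumes "n \<ge> 1"
  shows "gdiv TYPE('k::field) (XU (Suc n)) (XU n) \<longleftrightarrow> stable_at TYPE('k) n"
proof
  have sub: "gdiv TYPE('k) (X m) (XU l)" if "1 \<le> m" "m \<le> l" for m l
  proof -
    have "X m \<subseteq> XU l" using that by (auto simp: XU_def)
    then show ?thesis by (intro pdiv_inj [where j = "\<lambda>x. x"]) (auto intro: bij_cj bij_cj_XU)
  qed
  have un: "gdiv TYPE('k) (XU l) Y" if "\<And>i. 1 \<le> i \<Longrightarrow> i \<le> l \<Longrightarrow> gdiv TYPE('k) (X i) Y" for Y l
    unfolding XU_def using that by (intro pdiv_UN) (auto simp: words_disjoint)
  {
    assume *: "gdiv TYPE('k) (XU (Suc n)) (XU n)"
    have "gdiv TYPE('k) (X (Suc n)) (XU (Suc n))" by (rule sub) auto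
    from this * have 1: "gdiv TYPE('k) (X (Suc n)) (XU n)"
      by (rule pdiv_trans [rotated 2]) (simp_all add: bij_cj_XU)
    have "gdiv TYPE('k) (XU n) (X n)"
      by (rule un) (rule pdiv_X_le)
    with 1 show "stable_at TYPE('k) n"
      by (rule pdiv_trans [rotated 2]) (simp_all add: bij_cj_XU)
  next
    assume st: "stable_at TYPE('k) n"
    show "gdiv TYPE('k) (XU (Suc n)) (XU n)"
    proof (rule un)
      fix i
      have "gdiv TYPE('k) (X n) (XU n)" using assms by (intro sub) auto
      with stable_at_pdiv [OF st, of i] show "gdiv TYPE('k) (X i) (XU n)"
        by (rule pdiv_trans [rotated 2]) (simp_all add: bij_cj)
    qed
  }
qed

text \<open>\<open>X 0\<close> is a single fixed point, so an invariant matrix from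
  \<open>X 1\<close> to it is constant on conjugacy classes; if such matrices separate all elements,
  every class is a singleton. Conversely, under a trivial action one copy for each element will
  do.\<close>

lemma stable_at_0_iff: "stable_at TYPE('k::field) 0 \<longleftrightarrow> (\<forall>h\<in>carrier G. \<forall>x\<in>carrier G. cnjg h x = x)"
proof
  assume "stable_at TYPE('k) 0"
  then obtain q and A B :: "nat \<Rightarrow> 'g list \<Rightarrow> 'g list \<Rightarrow> 'k" where A: "\<forall>i<q. ginv (X (Suc 0)) (X 0) (A i)"
    and AB: "\<forall>x\<in>X (Suc 0). \<forall>x'\<in>X (Suc 0). (\<Sum>i<q. \<Sum>y\<in>X 0. A i x y * B i y x') = of_bool (x = x')"
    unfolding pdiv_def pdiv_by_def by blast
  show "\<forall>h\<in>carrier G. \<forall>x\<in>carrier G. cnjg h x = x"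
  proof (intro ballI)
    fix h x assume h: "h \<in> carrier G" and x: "x \<in> carrier G"
    have m: "[x] \<in> X (Suc 0)" "[cnjg h x] \<in> X (Suc 0)" using h x by (auto simp: words_def)
    have "A i (cj h [x]) (cj h []) = A i [x] []" if "i < q" for i
      using A [rule_format, OF that] h m unfolding inv_mat_def words_0 by blast
    then have "(\<Sum>i<q. \<Sum>y\<in>X 0. A i [cnjg h x] y * B i y [x]) = (\<Sum>i<q. \<Sum>y\<in>X 0. A i [x] y * B i y [x])"
      by (auto simp: words_0 intro!: sum.cong)
    then have "of_bool ([cnjg h x] = [x]) = (1 :: 'k)" using AB m by simp
    then show "cnjg h x = x" by (simp split: if_splits add: of_bool_def)
  qed
next
  assume *: "\<forall>h\<in>carrier G. \<forall>x\<in>carrier G. cnjg h x = x"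
  then have cj: "cj h x = x" if "h \<in> carrier G" "x \<in> X (Suc 0)" for h x
    using that by (auto simp: words_def intro!: map_idI)
  show "stable_at TYPE('k) 0"
  proof (rule pdivI [where J = "X (Suc 0)" and A = "\<lambda>z x y. of_bool (x = z)" and B
      = "\<lambda>z y x. of_bool (x = z)"])
    fix x x' assume x: "x \<in> X (Suc 0)"
    have "(\<Sum>i\<in>X (Suc 0). \<Sum>y\<in>X 0. of_bool (x = i) * of_bool (x' = i) :: 'k) = (\<Sum>i\<in>X (Suc 0). if i
        = x then of_bool (x' = x) else 0)"
      by (intro sum.cong) (auto simp: words_0)
    then show "(\<Sum>i\<in>X (Suc 0). \<Sum>y\<in>X 0. of_bool (x = i) * of_bool (x' = i) :: 'k) = of_bool (x = x')"
      using x by (auto simp: eq_commute)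
  qed (auto simp: inv_mat_def cj)
qed

text \<open>Depth 0 is defined by an isomorphism and not by a summand, so it is compared with
  \<open>stable_at\<close> through the common condition that \<open>G\<close> is abelian.\<close>

lemma module_has_depth_0_iff:
  "module_has_depth G (adjoint_mod G :: ('k::field, _, _) opmod) 0 \<longleftrightarrow>
    (\<forall>h\<in>carrier G. \<forall>x\<in>carrier G. cnjg h x = x)"
proof
  let ?Q = "adjoint_mod G :: ('k, 'g \<Rightarrow> 'k, 'g \<Rightarrow> 'k) opmod"
  assume "module_has_depth G ?Q 0"
  then obtain q f where "opmod_iso (group_alg G) ?Q (copies q (triv_mod G)) f"
    by (auto simp: module_has_depth_def opmod_isomorphic_def)
  then have bij: "bij_betw f (free_on (carrier G)) (\<Pi>\<^sub>E i\<in>{..<q}. UNIV)"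
    and act: "\<And>a v. a \<in> group_alg G \<Longrightarrow> v \<in> free_on (carrier G) \<Longrightarrow>
      f (act ?Q a v) = (\<lambda>i\<in>{..<q}. f v i * (\<Sum>x\<in>carrier G. a x))"
    by (auto simp: opmod_iso_def copies_def direct_sum_def triv_mod_def)
  show "\<forall>h\<in>carrier G. \<forall>x\<in>carrier G. cnjg h x = x"
  proof (intro ballI)
    fix h x assume h: "h \<in> carrier G" and x: "x \<in> carrier G"
    have d: "(delta h :: _ \<Rightarrow> 'k) \<in> group_alg G" "(delta x :: _ \<Rightarrow> 'k) \<in> free_on (carrier G)"
      using h x by (auto simp: group_alg_def)
    \<comment> \<open>The coefficients of a group element sum to 1, so it acts as the identity on
      copies of the trivial module.\<close>
    have "(\<Sum>y\<in>carrier G. delta h y :: 'k) = 1" using h by (simp add: delta_apply of_bool_def)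
    then have "f (act ?Q (delta h) (delta x)) = (\<lambda>i\<in>{..<q}. f (delta x) i)"
      using act [OF d] by simp
    also have "\<dots> = f (delta x)"
      using bij_betw_apply [OF bij d(2)] by (auto simp: PiE_def extensional_restrict)
    finally have "f (act ?Q (delta h) (delta x)) = f (delta x)" .
    moreover have "act ?Q (delta h) (delta x) \<in> free_on (carrier G)"
      using h by (simp add: act_adjoint_delta mem_free_on_finite)
    ultimately have "act ?Q (delta h) (delta x) = delta x"
      using bij_betw_imp_inj_on [OF bij] d(2) by (auto simp: inj_on_def)
    from fun_cong [OF this, of x] have "of_bool (cnjg h x = x) = (1 :: 'k)"
      using h x by (simp add: act_adjoint_delta delta_apply)
    then show "cnjg h x = x" by (simp split: if_splits add: of_bool_def)
  qed
next
  let ?Q = "adjoint_mod G :: ('k, 'g \<Rightarrow> 'k, 'g \<Rightarrow> 'k) opmod"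
  assume *: "\<forall>h\<in>carrier G. \<forall>x\<in>carrier G. cnjg h x = x"
  let ?q = "card (carrier G)"
  obtain b where b: "bij_betw b {..<?q} (carrier G)"
    using ex_bij_betw_nat_finite [OF finite_carrier] by (auto simp: atLeast0LessThan)
  let ?c = "inv_into {..<?q} b"
  have bG: "b i \<in> carrier G" if "i < ?q" for i using bij_betw_apply [OF b] that by simp
  have cq: "?c x < ?q" "b (?c x) = x" if "x \<in> carrier G" for x
    using bij_betw_apply [OF bij_betw_inv_into [OF b]] bij_betw_inv_into_right [OF b] that by auto
  have cb: "?c (b i) = i" if "i < ?q" for i using bij_betw_inv_into_left [OF b] that by simp
  let ?f = "\<lambda>v :: 'g \<Rightarrow> 'k. \<lambda>i\<in>{..<?q}. v (b i)"
  have "bij_betw ?f (free_on (carrier G)) (\<Pi>\<^sub>E i\<in>{..<?q}. UNIV)"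
  proof (rule bij_betwI [where g = "\<lambda>u x. if x \<in> carrier G then u (?c x) else 0"])
    fix u :: "nat \<Rightarrow> 'k" assume "u \<in> (\<Pi>\<^sub>E i\<in>{..<?q}. UNIV)"
    then show "?f (\<lambda>x. if x \<in> carrier G then u (?c x) else 0) = u"
      by (intro ext) (auto simp: bG cb PiE_def extensional_def restrict_def)
  qed (auto simp: mem_free_on_finite cq fun_eq_iff)
  moreover have "act ?Q a v (b i) = v (b i) * (\<Sum>x\<in>carrier G. a x)" if "i < ?q" for a v i
    using * that bG by (simp add: act_adjoint_mod sum_distrib_left mult.commute)
  ultimately have "opmod_iso (group_alg G) ?Q (copies ?q (triv_mod G)) ?f"
    by (auto simp: opmod_iso_def copies_def direct_sum_def triv_mod_def intro!: ext)
  then show "module_has_depth G ?Q 0"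
    by (auto simp: module_has_depth_def opmod_isomorphic_def)
qed

lemma module_has_depth_iff:
  "module_has_depth G (adjoint_mod G :: ('k::field, _, _) opmod) n \<longleftrightarrow> stable_at TYPE('k) n"
proof (cases "n = 0")
  case True
  show ?thesis unfolding True module_has_depth_0_iff stable_at_0_iff by (rule refl)
next
  case False
  let ?V = "\<lambda>n. vec_mod (XU n) (ad_op (XU n)) :: ('k, _, _) opmod"
  have "module_has_depth G (adjoint_mod G :: ('k, _, _) opmod) n \<longleftrightarrow>
      (\<exists>q>0. iso_to_summand (group_alg G) (?V (Suc n)) (copies q (?V n)))"
    using False
        by (simp add: module_has_depth_def iso_to_summand_cong
        [OF T_mod_equiv op_equiv_copies [OF T_mod_equiv]])
  also have "\<dots> \<longleftrightarrow> (\<exists>q>0. pdiv_by TYPE('k) q (carrier G) cj (XU (Suc n)) (XU n))"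
    by (subst iso_to_summand_copies_perm_iff) (rule group_alg_weights, assumption | simp add: bij_cj_XU)+
  also have "\<dots> \<longleftrightarrow> gdiv TYPE('k) (XU (Suc n)) (XU n)"
    unfolding pdiv_def using pdiv_by_Suc by (metis zero_less_Suc)
  also have "\<dots> \<longleftrightarrow> stable_at TYPE('k) n" using False by (intro pdiv_XU_iff) simp
  finally show ?thesis .
qed

section \<open>Annihilators and faithful tensor powers\<close>

definition annih :: "nat \<Rightarrow> ('g \<Rightarrow> 'k::field) set" where
  "annih n = {a \<in> free_on (carrier G).
     \<forall>xs\<in>X n. \<forall>ys\<in>X n. (\<Sum>s\<in>carrier G. a s * of_bool (cj s ys = xs)) = 0}"

text \<open>Testing on the basis vectors \<open>delta xs\<close> turns annihilation into the
  vanishing of all entries of the matrix by which \<open>a\<close> acts.\<close>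

lemma Ann_tensor_pow:
  "Ann G (tensor_pow G (adjoint_mod G) n :: ('k::field, _, _) opmod) = annih n"
proof -
  have "(\<forall>F\<in>free_on (X n). ad_op (X n) a F = 0) \<longleftrightarrow>
      (\<forall>xs\<in>X n. \<forall>ys\<in>X n. (\<Sum>s\<in>carrier G. a s * of_bool (cj s ys = xs)) = 0)" (is "?L
          \<longleftrightarrow> ?R") for a :: "'g \<Rightarrow> 'k"
  proof
    assume ?L
    show ?R
    proof (intro ballI)
      fix xs ys assume "xs \<in> X n" "ys \<in> X n"
      then have "ad_op (X n) a (delta xs) ys = 0" using \<open>?L\<close> by simp
      then show "(\<Sum>s\<in>carrier G. a s * of_bool (cj s ys = xs)) = 0"
        using \<open>ys \<in> X n\<close> by (simp add: perm_op_def delta_apply)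
    qed
  next
    assume ?R
    show ?L
    proof
      fix F :: "'g list \<Rightarrow> 'k" assume "F \<in> free_on (X n)"
      show "ad_op (X n) a F = 0"
      proof (rule linear_on_eqI [OF linear_on_perm_op _ _ \<open>F \<in> free_on (X n)\<close>])
        show "linear_on (X n) (X n) (\<lambda>_. 0)" by (simp add: linear_on_def)
        fix xs assume "xs \<in> X n"
        then show "ad_op (X n) a (delta xs) = 0"
          using \<open>?R\<close> by (auto simp: perm_op_def delta_apply fun_eq_iff)
      qed simp
    qed
  qed
  then show ?thesis
    unfolding Ann_op_equiv [OF tensor_pow_equiv] by (simp add: Ann_def annih_def group_alg_def)
qed

lemma zero_in_annih: "0 \<in> annih n"
  by (simp add: annih_def)

text \<open>For \<open>s \<in> G\<close> the entries \<open>[s y = x]\<close> form the permutation matrix of \<open>s\<close>; faithfulness makes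
  these matrices linearly independent, so some functional singles out the identity.\<close>

lemma faithful_dual_functional:
  assumes "annih n = {0 :: 'g \<Rightarrow> 'k::field}"
  obtains l :: "'g list \<Rightarrow> 'g list \<Rightarrow> 'k::field" where
    "\<And>h. h \<in> carrier G \<Longrightarrow> (\<Sum>xs\<in>X n. \<Sum>ys\<in>X n. l xs ys * of_bool (cj h ys = xs)) = of_bool (h = \<one>)"
proof -
  \<comment> \<open>The permutation matrix of \<open>h\<close>, read as a vector indexed by pairs of
    words.\<close>
  define R where "R h = (\<lambda>(xs, ys). of_bool (xs \<in> X n \<and> ys \<in> X n \<and> cj h ys = xs) :: 'k)" for h
  have zero: "a h = 0" if "(\<Sum>s\<in>carrier G. fscale (a s) (R s)) = 0" "h \<in> carrier G" for a h
  proof -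
    define a' where "a' x = (if x \<in> carrier G then a x else 0)" for x
    have "(\<Sum>s\<in>carrier G. a' s * of_bool (cj s ys = xs)) = 0" if "xs \<in> X n" "ys \<in> X n" for xs ys
      using that fun_cong [OF \<open>_ = 0\<close>, of "(xs, ys)"] by (simp add: sum_apply R_def a'_def)
    then have "a' \<in> annih n" by (auto simp: annih_def a'_def mem_free_on_finite)
    then have "a' = 0" using assms by simp
    then show ?thesis using that(2) by (auto simp: a'_def fun_eq_iff split: if_splits)
  qed
  \<comment> \<open>Linear independence speaks of the set of these vectors, so distinct group
    elements must first be seen to give distinct vectors.\<close>
  have inj: "inj_on R (carrier G)"
  proof (rule inj_onI, rule ccontr)
    fix s t assume st: "s \<in> carrier G" "t \<in> carrier G" "R s = R t" "s \<noteq> t"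
    let ?a = "\<lambda>x. of_bool (x = s) - of_bool (x = t) :: 'k"
    have "(\<Sum>x\<in>carrier G. fscale (?a x) (R x)) p = 0" for p
    proof -
      have "(\<Sum>x\<in>carrier G. fscale (?a x) (R x)) p
          = (\<Sum>x\<in>carrier G. if x = s then R s p else 0) - (\<Sum>x\<in>carrier G. if x = t then R t p else 0)"
        unfolding sum_apply sum_subtractf [symmetric] by (intro sum.cong) auto
      then show ?thesis using st by simp
    qed
    then have "?a s = 0" using st by (intro zero) auto
    then show False using st by simp
  qed
  interpret kk: vector_space "(*) :: 'k \<Rightarrow> 'k \<Rightarrow> 'k"
    by unfold_locales (auto simp: algebra_simps)
  interpret vp: vector_space_pair "fscale :: 'k \<Rightarrow> ('g list \<times> 'g list \<Rightarrow> 'k) \<Rightarrow> _" "(*) :: 'k \<Rightarrow> 'k \<Rightarrow> 'k" ..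
  have "\<not> fun_space.dependent (R ` carrier G)"
  proof
    assume "fun_space.dependent (R ` carrier G)"
    then obtain u v where "v \<in> R ` carrier G" "u v \<noteq> 0" "(\<Sum>v\<in>R ` carrier G. fscale (u v) v) = 0"
      by (auto simp: fun_space.dependent_finite)
    moreover from this have "(\<Sum>s\<in>carrier G. fscale (u (R s)) (R s)) = 0"
      by (simp add: sum.reindex [OF inj])
    ultimately show False using zero [of "\<lambda>s. u (R s)"] by auto
  qed
  \<comment> \<open>The functional is 1 on the matrix of the identity and 0 on the others; its
    values at the unit vectors are the coefficients \<open>l\<close>.\<close>
  from vp.linear_independent_extend [OF this, of "\<lambda>v. of_bool (v = R \<one>)"]
  obtain f where f: "Vector_Spaces.linear fscale (*) f" "\<And>v. v \<in> R ` carrier G \<Longrightarrow> f v = of_bool (v = R \<one>)"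
    by blast
  interpret f: Vector_Spaces.linear fscale "(*)" f by (rule f(1))
  show thesis
  proof (rule that [of "\<lambda>xs ys. f (delta (xs, ys))"])
    fix h assume h: "h \<in> carrier G"
    have "R h = (\<Sum>p\<in>X n \<times> X n. fscale (R h p) (delta p))"
      by (rule free_on_expand) (auto simp: R_def)
    then have "f (R h) = (\<Sum>p\<in>X n \<times> X n. R h p * f (delta p))"
      using f.sum [of "\<lambda>p. fscale (R h p) (delta p)" "X n \<times> X n"] by (simp add: f.scale)
    also have "\<dots> = (\<Sum>xs\<in>X n. \<Sum>ys\<in>X n. f (delta (xs, ys)) * of_bool (cj h ys = xs))"
      unfolding sum.cartesian_product' by (intro sum.cong refl) (simp add: R_def mult.commute)
    finally show "(\<Sum>xs\<in>X n. \<Sum>ys\<in>X n. f (delta (xs, ys)) * of_bool (cj h ys = xs)) = of_bool (h = \<one>)"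
      using f(2) [of "R h"] h inj_on_eq_iff [OF inj h one_closed] by simp
  qed
qed

text \<open>Every permutation module is a summand of a multiple of a faithful one: the orbit sums
  \<open>E\<close>, weighted by the functional that singles out the identity, compose to \<open>|G|\<close> times the identity.\<close>

lemma faithful_imp_stable:
  assumes faithful: "annih n = {0 :: 'g \<Rightarrow> 'k::field}" and char: "\<not> CHAR('k) dvd card (carrier G)"
  shows "stable_at TYPE('k) n"
proof -
  let ?c = "of_nat (card (carrier G)) :: 'k"
  have c: "?c \<noteq> 0" using char by (simp add: of_nat_eq_0_iff_char_dvd)
  obtain l :: "'g list \<Rightarrow> 'g list \<Rightarrow> 'k" where
    l: "\<And>h. h \<in> carrier G \<Longrightarrow> (\<Sum>xs\<in>X n. \<Sum>ys\<in>X n. l xs ys * of_bool (cj h ys = xs)) = of_bool (h = \<one>)"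
    using faithful_dual_functional [OF faithful] by blast
  \<comment> \<open>Counts, in \<open>k\<close>, the \<open>h\<close> that carry
    \<open>(z0, x0)\<close> to \<open>(z, x)\<close>. As an orbit sum it is an invariant matrix in
    \<open>z\<close> and \<open>x\<close>.\<close>
  define E :: "'g list \<Rightarrow> 'g list \<Rightarrow> 'g list \<Rightarrow> 'g list \<Rightarrow> 'k"
    where "E z0 x0 z x = (\<Sum>h\<in>carrier G. of_bool (z = cj h z0 \<and> x = cj h x0))" for z0 x0 z x
  have E_inv: "E z0 x0 (cj s z) (cj s x) = E z0 x0 z x"
    if "s \<in> carrier G" "z \<in> X a" "x \<in> X b" "z0 \<in> X a" "x0 \<in> X b" for s z x z0 x0 a b
  proof -
    have "E z0 x0 (cj s z) (cj s x) = (\<Sum>h\<in>carrier G. of_bool (cj s z = cj (s \<otimes> h) z0 \<and> cj s x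
        = cj (s \<otimes> h) x0))"
      unfolding E_def by (rule sum_translate(1) [OF that(1), symmetric])
    also have "\<dots> = E z0 x0 z x"
      unfolding E_def
    proof (intro sum.cong refl)
      fix h assume h: "h \<in> carrier G"
      have "cj s z = cj s (cj h z0) \<longleftrightarrow> z = cj h z0" "cj s x = cj s (cj h x0) \<longleftrightarrow> x = cj h x0"
        using that h bij_betw_imp_inj_on [OF bij_cj [OF that(1)]] cj_closed
            by (metis (no_types, lifting) inj_on_eq_iff)+
      then show "of_bool (cj s z = cj (s \<otimes> h) z0 \<and> cj s x = cj (s \<otimes> h) x0) = (of_bool (z = cj h z0 \<and>
          x = cj h x0) :: 'k)"
        using that h by (simp add: cj_mult del: map_map)
    qed
    finally show ?thesis .
  qed
  show ?thesis
  \<comment> \<open>The index records base points: \<open>z0\<close> is shared by both orbit sums,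
    \<open>l x0 x1\<close> weights their base points in \<open>X n\<close>, and the factor
    \<open>1/|G|\<close> cancels the final count over \<open>h\<close>.\<close>
  proof (rule pdivI [where J = "X (Suc n) \<times> X n \<times> X n"
        and A = "\<lambda>(z0, x0, x1) z x. l x0 x1 / ?c * E z0 x0 z x" and B = "\<lambda>(z0, x0, x1) x z. E z0 x1
            z x"])
    fix z z' assume z: "z \<in> X (Suc n)" "z' \<in> X (Suc n)"
    \<comment> \<open>Composing two orbit sums through \<open>x\<close> counts pairs
      \<open>(h, h')\<close> with \<open>h x0 = h' x1\<close>, and this condition is an entry of the
      permutation matrix of \<open>inv h \<otimes> h'\<close>.\<close>
    have EE: "(\<Sum>x\<in>X n. E z0 x0 z x * E z0 x1 z' x)
        = (\<Sum>h\<in>carrier G. \<Sum>h'\<in>carrier G. of_bool (z = cj h z0 \<and> z' = cj h' z0) * of_bool (cj (inv h \<otimes>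
            h') x1 = x0))"
      if x: "x0 \<in> X n" "x1 \<in> X n" for z0 x0 x1
    proof -
      have "(\<Sum>x\<in>X n. E z0 x0 z x * E z0 x1 z' x) = (\<Sum>h\<in>carrier G. \<Sum>h'\<in>carrier G. \<Sum>x\<in>X n.
          of_bool (z = cj h z0 \<and> x = cj h x0) * of_bool (z' = cj h' z0 \<and> x = cj h' x1))"
        unfolding E_def sum_product by (subst sum.swap, intro sum.cong refl, rule sum.swap)
      also have "\<dots> = (\<Sum>h\<in>carrier G. \<Sum>h'\<in>carrier G. of_bool (z = cj h z0 \<and> z'
          = cj h' z0) * of_bool (cj (inv h \<otimes> h') x1 = x0))"
      proof (intro sum.cong refl)
        fix h h' assume h: "h \<in> carrier G" "h' \<in> carrier G"
        have iff: "cj (inv h \<otimes> h') x1 = x0 \<longleftrightarrow> cj h x0 = cj h' x1"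
          using h x by (metis cj_closed cj_inv cj_mult inv_closed)
        have "(\<Sum>x\<in>X n. of_bool (z = cj h z0 \<and> x = cj h x0) * of_bool (z' = cj h' z0 \<and> x
            = cj h' x1) :: 'k)
          = (\<Sum>x\<in>X n. if x = cj h x0 then of_bool (z = cj h z0 \<and> z' = cj h' z0) * of_bool (cj h x0
              = cj h' x1) else 0)"
          by (intro sum.cong) auto
        then show "(\<Sum>x\<in>X n. of_bool (z = cj h z0 \<and> x = cj h x0) * of_bool (z' = cj h' z0 \<and> x
            = cj h' x1) :: 'k)
          = of_bool (z = cj h z0 \<and> z' = cj h' z0) * of_bool (cj (inv h \<otimes> h') x1 = x0)"
          unfolding iff using h x by simp
      qed
      finally show ?thesis .
    qed
    have "(\<Sum>i\<in>X (Suc n) \<times> X n \<times> X n. \<Sum>x\<in>X n.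
        (case i of (z0, x0, x1) \<Rightarrow> \<lambda>z x. l x0 x1 / ?c * E z0 x0 z x) z x * (case i of (z0, x0, x1) \<Rightarrow>
            \<lambda>x z. E z0 x1 z x) x z')
      = (\<Sum>z0\<in>X (Suc n). \<Sum>x0\<in>X n. \<Sum>x1\<in>X n. l x0 x1 / ?c * (\<Sum>x\<in>X n. E z0 x0 z x * E z0 x1 z' x))"
      by (simp add: sum.cartesian_product' sum_distrib_left mult.assoc)
    also have "\<dots> = (\<Sum>z0\<in>X (Suc n). \<Sum>x0\<in>X n. \<Sum>x1\<in>X n. \<Sum>h\<in>carrier G. \<Sum>h'\<in>carrier G.
        of_bool (z = cj h z0 \<and> z' = cj h' z0) / ?c * (l x0 x1 * of_bool (cj (inv h \<otimes> h') x1 = x0)))"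
    proof (intro sum.cong refl)
      fix z0 x0 x1 assume x: "x0 \<in> X n" "x1 \<in> X n"
      show "l x0 x1 / ?c * (\<Sum>x\<in>X n. E z0 x0 z x * E z0 x1 z' x) = (\<Sum>h\<in>carrier G. \<Sum>h'\<in>carrier G.
        of_bool (z = cj h z0 \<and> z' = cj h' z0) / ?c * (l x0 x1 * of_bool (cj (inv h \<otimes> h') x1 = x0)))"
        unfolding EE [OF x] sum_distrib_left by (intro sum.cong refl) (simp add: mult_ac)
    qed
    also have "\<dots> = (\<Sum>z0\<in>X (Suc n). \<Sum>h\<in>carrier G. \<Sum>h'\<in>carrier G. \<Sum>x0\<in>X n. \<Sum>x1\<in>X n.
        of_bool (z = cj h z0 \<and> z' = cj h' z0) / ?c * (l x0 x1 * of_bool (cj (inv h \<otimes> h') x1 = x0)))"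
      by (simp only: sum.swap [of _ "carrier G" "X n"])
    \<comment> \<open>Summed against \<open>l\<close> over \<open>x0\<close> and \<open>x1\<close>,
      the permutation matrix of \<open>inv h \<otimes> h'\<close> contributes 1 if
      \<open>h = h'\<close> and 0 otherwise.\<close>
    also have "\<dots> = (\<Sum>z0\<in>X (Suc n). \<Sum>h\<in>carrier G. \<Sum>h'\<in>carrier G.
        of_bool (z = cj h z0 \<and> z' = cj h' z0) / ?c * of_bool (inv h \<otimes> h' = \<one>))"
      by (intro sum.cong refl) (simp only: sum_distrib_left [symmetric] l inv_closed m_closed)
    also have "\<dots> = (\<Sum>z0\<in>X (Suc n). \<Sum>h\<in>carrier G. of_bool (z = cj h z0 \<and> z' = cj h z0) / ?c)"
    proof (intro sum.cong refl)
      fix z0 h assume h: "h \<in> carrier G"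
      have "inv h \<otimes> h' = \<one> \<longleftrightarrow> h' = h" if "h' \<in> carrier G" for h'
        using h that by (metis inv_closed inv_equality inv_inv l_inv)
      then have "(\<Sum>h'\<in>carrier G. of_bool (z = cj h z0 \<and> z' = cj h' z0) / ?c * of_bool (inv h \<otimes> h' = \<one>))
        = (\<Sum>h'\<in>carrier G. if h' = h then of_bool (z = cj h z0 \<and> z' = cj h z0) / ?c else 0)"
        by (intro sum.cong) auto
      then show "(\<Sum>h'\<in>carrier G. of_bool (z = cj h z0 \<and> z' = cj h' z0) / ?c * of_bool (inv h \<otimes> h' = \<one>))
        = of_bool (z = cj h z0 \<and> z' = cj h z0) / ?c" using h by simp
    qed
    also have "\<dots> = (\<Sum>h\<in>carrier G. \<Sum>z0\<in>X (Suc n). of_bool (z = cj h z0 \<and> z' = cj h z0) / ?c)"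
      by (rule sum.swap)
    \<comment> \<open>For each \<open>h\<close> exactly one \<open>z0\<close> is carried to
      \<open>z\<close>; what remains are \<open>|G|\<close> equal terms with denominator
      \<open>|G|\<close>.\<close>
    also have "\<dots> = (\<Sum>h\<in>carrier G. of_bool (z = z') / ?c)"
    proof (intro sum.cong refl)
      fix h assume h: "h \<in> carrier G"
      have "z = cj h z0 \<longleftrightarrow> z0 = cj (inv h) z" if "z0 \<in> X (Suc n)" for z0
        using h that z by (metis cj_inv)
      then have "(\<Sum>z0\<in>X (Suc n). of_bool (z = cj h z0 \<and> z' = cj h z0) / ?c) = (\<Sum>z0\<in>X (Suc n). if z0
          = cj (inv h) z then of_bool (z = z') / ?c else 0)"
        using h z by (intro sum.cong) (auto simp del: map_map)
      then show "(\<Sum>z0\<in>X (Suc n). of_bool (z = cj h z0 \<and> z' = cj h z0) / ?c) = of_bool (z = z') / ?c"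
        using h z by simp
    qed
    also have "\<dots> = of_bool (z = z')" using c by simp
    finally show "(\<Sum>i\<in>X (Suc n) \<times> X n \<times> X n. \<Sum>x\<in>X n.
        (case i of (z0, x0, x1) \<Rightarrow> \<lambda>z x. l x0 x1 / ?c * E z0 x0 z x) z x * (case i of (z0, x0, x1) \<Rightarrow>
            \<lambda>x z. E z0 x1 z x) x z')
      = of_bool (z = z')" .
  qed (auto simp: inv_mat_def E_inv)
qed

text \<open>Annihilators pass to summands of multiples. In matrices, invariance of
  \<open>A i\<close> moves the action of \<open>a\<close> from \<open>X m\<close> to
  \<open>X n\<close>, where it is 0, and \<open>AB\<close> recovers the action on
  \<open>X m\<close>.\<close>

lemma annih_mono_pdiv:
  assumes "gdiv TYPE('k::field) (X m) (X n)"
  shows "annih n \<subseteq> (annih m :: ('g \<Rightarrow> 'k) set)"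
proof
  fix a :: "'g \<Rightarrow> 'k" assume a: "a \<in> annih n"
  obtain q and A B :: "nat \<Rightarrow> 'g list \<Rightarrow> 'g list \<Rightarrow> 'k" where A: "\<forall>i<q. ginv (X m) (X n) (A i)"
    and AB: "\<forall>x\<in>X m. \<forall>x'\<in>X m. (\<Sum>i<q. \<Sum>y\<in>X n. A i x y * B i y x') = of_bool (x = x')"
    using assms unfolding pdiv_def pdiv_by_def by blast
  have 0: "(\<Sum>s\<in>carrier G. a s * A i (cj s x) y) = 0" if i: "i < q" and x: "x \<in> X m"
      and y: "y \<in> X n" for i x y
  proof -
    have "(\<Sum>s\<in>carrier G. a s * A i (cj s x) y) = (\<Sum>s\<in>carrier G. \<Sum>y'\<in>X n. A i x y' * (a s * of_bool
        (cj s y' = y)))"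
    proof (intro sum.cong refl)
      fix s assume s: "s \<in> carrier G"
      have "cj s y' = y \<longleftrightarrow> y' = cj (inv s) y" if "y' \<in> X n" for y' using s that y by (metis cj_inv)
      then have "(\<Sum>y'\<in>X n. A i x y' * (a s * of_bool (cj s y' = y))) = (\<Sum>y'\<in>X n. if y'
          = cj (inv s) y then A i x (cj (inv s) y) * a s else 0)"
        by (intro sum.cong) auto
      also have "\<dots> = A i x (cj (inv s) y) * a s" using s y by simp
      also have "A i x (cj (inv s) y) = A i (cj s x) (cj s (cj (inv s) y))"
        using A [rule_format, OF i] s x cj_closed [OF inv_closed [OF s] y] unfolding inv_mat_def by metis
      finally show "a s * A i (cj s x) y = (\<Sum>y'\<in>X n. A i x y' * (a s * of_bool (cj s y' = y)))"
        using s y by (simp add: mult.commute del: map_map)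
    qed
    also have "\<dots> = (\<Sum>y'\<in>X n. A i x y' * (\<Sum>s\<in>carrier G. a s * of_bool (cj s y' = y)))"
      by (subst sum.swap) (simp add: sum_distrib_left)
    also have "\<dots> = 0" using a y by (simp add: annih_def)
    finally show ?thesis .
  qed
  have "(\<Sum>s\<in>carrier G. a s * of_bool (cj s ys = xs)) = 0" if "xs \<in> X m" "ys \<in> X m" for xs ys
  proof -
    have "(\<Sum>s\<in>carrier G. a s * of_bool (cj s ys = xs)) = (\<Sum>s\<in>carrier G. a s * (\<Sum>i<q. \<Sum>y\<in>X n. A i (cj
        s ys) y * B i y xs))"
      using AB that by (intro sum.cong refl) simp
    also have "\<dots> = (\<Sum>i<q. \<Sum>y\<in>X n. (\<Sum>s\<in>carrier G. a s * A i (cj s ys) y) * B i y xs)"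
      unfolding sum_distrib_left sum_distrib_right mult.assoc
      by (subst sum.swap, intro sum.cong refl, rule sum.swap)
    also have "\<dots> = 0" using 0 that by simp
    finally show ?thesis .
  qed
  then show "a \<in> annih m" using a by (simp add: annih_def)
qed

text \<open>The stabiliser of the tuple of all elements of \<open>G\<close> is the centre.\<close>

lemma annih_card_eq_0:
  assumes "group_center G = {\<one>}"
  shows "annih (card (carrier G)) = {0 :: 'g \<Rightarrow> 'k::field}"
proof -
  let ?n = "card (carrier G)"
  obtain zs where zs: "set zs = carrier G" "distinct zs"
    using finite_distinct_list [OF finite_carrier] by blast
  have zsX: "zs \<in> X ?n" using zs distinct_card [of zs] by (simp add: words_def)
  have eq: "s = h" if "s \<in> carrier G" "h \<in> carrier G" "cj s zs = cj h zs" for s h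
  proof -
    have "cnjg s g = cnjg h g" if "g \<in> carrier G" for g using \<open>cj s zs = cj h zs\<close> that zs by auto
    then have c: "cnjg (inv h \<otimes> s) g = g" if "g \<in> carrier G" for g
      using that \<open>s \<in> carrier G\<close> \<open>h \<in> carrier G\<close> by (simp add: cnjg_mult)
    have "g \<otimes> (inv h \<otimes> s) = (inv h \<otimes> s) \<otimes> g" if g: "g \<in> carrier G" for g
    proof -
      let ?z = "inv h \<otimes> s"
      have z: "?z \<in> carrier G" using that \<open>s \<in> carrier G\<close> \<open>h \<in> carrier G\<close> by simp
      have "?z \<otimes> g \<otimes> inv ?z \<otimes> ?z = g \<otimes> ?z" using c [OF g] by (simp add: cnjg_def)
      then show ?thesis using g z by (simp add: m_assoc)
    qed
    then have "inv h \<otimes> s \<in> group_center G" using that by (simp add: group_center_def)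
    then have "inv h \<otimes> s = \<one>" using assms by simp
    then show ?thesis using that by (metis inv_closed inv_equality inv_inv l_inv)
  qed
  have "a = 0" if a: "a \<in> annih ?n" for a :: "'g \<Rightarrow> 'k"
  proof
    fix h show "a h = 0 h"
    proof (cases "h \<in> carrier G")
      case True
      \<comment> \<open>The entry of the matrix of \<open>a\<close> at \<open>(cj h zs, zs)\<close>
        is \<open>a h\<close>, since only \<open>s = h\<close> carries \<open>zs\<close>
        there.\<close>
      have "(\<Sum>s\<in>carrier G. a s * of_bool (cj s zs = cj h zs)) = 0"
        using a zsX cj_closed [OF True zsX] unfolding annih_def by blast
      moreover have "(\<Sum>s\<in>carrier G. a s * of_bool (cj s zs = cj h zs)) = (\<Sum>s\<in>carrier G. if s
          = h then a h else 0)"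
        using eq True by (intro sum.cong) auto
      ultimately show ?thesis using True by simp
    next
      case False
      then show ?thesis using a by (simp add: annih_def mem_free_on_finite)
    qed
  qed
  then show ?thesis using zero_in_annih by blast
qed

text \<open>Stability at \<open>n\<close> makes the power with exponent \<open>|G|\<close>, which is
  faithful, a summand of a multiple of the \<open>n\<close>-th, so that one is faithful too.\<close>

lemma stable_iff_faithful:
  assumes "group_center G = {\<one>}" and "\<not> CHAR('k::field) dvd card (carrier G)"
  shows "stable_at TYPE('k) n \<longleftrightarrow> annih n = {0 :: 'g \<Rightarrow> 'k}"
proof
  assume "stable_at TYPE('k) n"
  then have "annih n \<subseteq> (annih (card (carrier G)) :: ('g \<Rightarrow> 'k) set)"
    by (rule annih_mono_pdiv [OF stable_at_pdiv])
  then show "annih n = {0 :: 'g \<Rightarrow> 'k}"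
    using zero_in_annih [where 'a = 'k, of n] by (auto simp: annih_card_eq_0 [OF assms(1)])
qed (rule faithful_imp_stable [OF _ assms(2)])

section \<open>The algebra structure of the double\<close>

lemma double_simps [simp]:
  "carrier (double G) = free_on (carrier G \<times> carrier G)" "add (double G) = (+)"
  "smult (double G) = fscale" "zero (double G) = 0"
  by (simp_all add: double_def)

text \<open>\<open>p\<^sub>x \<bowtie> h\<close> times \<open>p\<^sub>y \<bowtie> l\<close> survives
  only for \<open>x = h y h\<^sup>-\<^sup>1\<close>, so at \<open>(x, g)\<close> the one free
  parameter is \<open>h\<close>: it forces \<open>y = h\<^sup>-\<^sup>1 x h\<close> and
  \<open>l = h\<^sup>-\<^sup>1 g\<close>.\<close>

lemma mult_double:
  fixes u v :: "'g \<times> 'g \<Rightarrow> 'k::field"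
  shows "u \<otimes>\<^bsub>double G\<^esub> v = (\<lambda>(x, g). if x \<in> carrier G \<and> g \<in> carrier G
    then \<Sum>h\<in>carrier G. u (x, h) * v (cnjg (inv h) x, inv h \<otimes> g) else 0)"
proof
  fix p :: "'g \<times> 'g"
  obtain x0 g0 where p: "p = (x0, g0)" by (cases p)
  have "(u \<otimes>\<^bsub>double G\<^esub> v) p = (\<Sum>x\<in>carrier G. \<Sum>g\<in>carrier G. \<Sum>y\<in>carrier G. \<Sum>h\<in>carrier G.
      u (x, g) * v (y, h) * (double_basis_mult G (x, g) (y, h) p :: 'k))"
    by (simp add: double_def sum_apply sum.cartesian_product')
  also have "\<dots> = (\<Sum>x\<in>carrier G. \<Sum>g\<in>carrier G. if x = x0 \<and> g0 \<in> carrier G then u (x, g) * v (cnjg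
      (inv g) x, inv g \<otimes> g0) else 0)"
  proof (intro sum.cong refl)
    fix x g assume xg: "x \<in> carrier G" "g \<in> carrier G"
    have "(\<Sum>h\<in>carrier G. u (x, g) * v (y, h) * (double_basis_mult G (x, g) (y, h) p :: 'k))
      = (\<Sum>h\<in>carrier G. if h = inv g \<otimes> g0 then (if y = cnjg (inv g) x \<and> x = x0 \<and> g0 \<in> carrier G then
          u (x, g) * v (y, h) else 0) else 0)"
      if y: "y \<in> carrier G" for y
    proof (intro sum.cong refl)
      fix h assume h: "h \<in> carrier G"
      have "x = g \<otimes> y \<otimes> inv g \<longleftrightarrow> y = cnjg (inv g) x"
        using cnjg_eq_iff [OF xg(2) y xg(1)] by (auto simp: cnjg_def)
      moreover have "g0 = g \<otimes> h \<longleftrightarrow> h = inv g \<otimes> g0 \<and> g0 \<in> carrier G"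
        using xg h by (auto simp: m_assoc [symmetric])
      ultimately show "u (x, g) * v (y, h) * (double_basis_mult G (x, g) (y, h) p :: 'k) =
        (if h = inv g \<otimes> g0 then (if y = cnjg (inv g) x \<and> x = x0 \<and> g0 \<in> carrier G then u (x, g) * v
            (y, h) else 0) else 0)"
        by (auto simp: double_basis_mult_def p delta_apply)
    qed
    then have "(\<Sum>y\<in>carrier G. \<Sum>h\<in>carrier G. u (x, g) * v (y, h) * (double_basis_mult G (x, g) (y, h)
        p :: 'k))
      = (\<Sum>y\<in>carrier G. if y = cnjg (inv g) x then (if x = x0 \<and> g0 \<in> carrier G then u (x, g) * v
          (cnjg (inv g) x, inv g \<otimes> g0) else 0) else 0)"
      using xg by (intro sum.cong refl) auto
    also have "\<dots> = (if x = x0 \<and> g0 \<in> carrier G then u (x, g) * v (cnjg (inv g) x, inv g \<otimes> g0) else 0)"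
      using xg by simp
    finally show "(\<Sum>y\<in>carrier G. \<Sum>h\<in>carrier G. u (x, g) * v (y, h) * (double_basis_mult G (x, g) (y,
        h) p :: 'k))
      = (if x = x0 \<and> g0 \<in> carrier G then u (x, g) * v (cnjg (inv g) x, inv g \<otimes> g0) else 0)" .
  qed
  also have "\<dots> = (\<Sum>x\<in>carrier G. if x = x0 then (\<Sum>g\<in>carrier G. if g0 \<in> carrier G then u (x0, g) * v
      (cnjg (inv g) x0, inv g \<otimes> g0) else 0) else 0)"
    by (intro sum.cong refl) auto
  also have "\<dots> = (case p of (x, g) \<Rightarrow> if x \<in> carrier G \<and> g \<in> carrier G
      then \<Sum>h\<in>carrier G. u (x, h) * v (cnjg (inv h) x, inv h \<otimes> g) else 0)"
    by (simp add: p)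
  finally show "(u \<otimes>\<^bsub>double G\<^esub> v) p = (case p of (x, g) \<Rightarrow> if x \<in> carrier G \<and> g \<in> carrier G
      then \<Sum>h\<in>carrier G. u (x, h) * v (cnjg (inv h) x, inv h \<otimes> g) else 0)" .
qed

lemma mult_double_closed [simp]: "u \<otimes>\<^bsub>double G\<^esub> v \<in> free_on (carrier G \<times> carrier G)"
  by (simp add: mult_double mem_free_on_finite)

lemma mult_double_apply:
  "x \<in> carrier G \<Longrightarrow> g \<in> carrier G \<Longrightarrow>
    (u \<otimes>\<^bsub>double G\<^esub> v) (x, g) = (\<Sum>h\<in>carrier G. u (x, h) * v (cnjg (inv h) x, inv h \<otimes> g))"
  by (simp add: mult_double)

text \<open>As \<open>1 = \<Sum>\<^sub>x p\<^sub>x\<close>, the first coordinate carries no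
  information in \<open>1 \<bowtie> kG\<close>; the value at \<open>\<one>\<close> serves as the
  group algebra coefficient.\<close>

lemma mem_group_alg_in_double_iff:
  "u \<in> group_alg_in_double G \<longleftrightarrow>
    u \<in> free_on (carrier G \<times> carrier G) \<and> (\<forall>x\<in>carrier G. \<forall>g\<in>carrier G. u (x, g) = u (\<one>, g))"
proof -
  have emb: "(\<Sum>x\<in>carrier G. \<Sum>g\<in>carrier G. fscale (a g) (delta (x, g))) =
      (\<lambda>(x, g). if x \<in> carrier G \<and> g \<in> carrier G then a g else 0)" for a :: "'g \<Rightarrow> 'k::field"
  proof
    fix p :: "'g \<times> 'g"
    obtain x0 g0 where p: "p = (x0, g0)" by (cases p)
    have "(\<Sum>x\<in>carrier G. \<Sum>g\<in>carrier G. fscale (a g) (delta (x, g))) p =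
      (\<Sum>x\<in>carrier G. \<Sum>g\<in>carrier G. if x = x0 then if g = g0 then a g else 0 else 0)"
      unfolding sum_apply p by (intro sum.cong refl) (auto simp: delta_apply)
    also have "\<dots> = (\<Sum>x\<in>carrier G. if x = x0 then \<Sum>g\<in>carrier G. if g = g0 then a g else 0 else 0)"
      by (intro sum.cong refl) auto
    finally show "(\<Sum>x\<in>carrier G. \<Sum>g\<in>carrier G. fscale (a g) (delta (x, g))) p =
      (case p of (x, g) \<Rightarrow> if x \<in> carrier G \<and> g \<in> carrier G then a g else 0)"
      by (simp add: p)
  qed
  show ?thesis
  proof
    assume "u \<in> group_alg_in_double G"
    then show "u \<in> free_on (carrier G \<times> carrier G) \<and> (\<forall>x\<in>carrier G. \<forall>g\<in>carrier G. u (x, g) = u (\<one>, g))"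
      unfolding group_alg_in_double_def emb by (auto simp: mem_free_on_finite)
  next
    assume u: "u \<in> free_on (carrier G \<times> carrier G) \<and> (\<forall>x\<in>carrier G. \<forall>g\<in>carrier G. u (x, g) = u (\<one>, g))"
    show "u \<in> group_alg_in_double G"
      unfolding group_alg_in_double_def emb
    proof (rule image_eqI)
      show "u = (\<lambda>(x, g). if x \<in> carrier G \<and> g \<in> carrier G then u (\<one>, g) else 0)"
      proof
        fix p :: "'g \<times> 'g"
        obtain x g where p: "p = (x, g)" by (cases p)
        have "u (x, g) = (if x \<in> carrier G \<and> g \<in> carrier G then u (\<one>, g) else 0)"
        proof (cases "x \<in> carrier G \<and> g \<in> carrier G")
          case True
          then have "u (x, g) = u (\<one>, g)" using u by blast
          then show ?thesis unfolding if_P [OF True] .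
        next
          case False
          then have "u (x, g) = 0" using conjunct1 [OF u] by (simp add: mem_free_on_finite)
          then show ?thesis unfolding if_not_P [OF False] .
        qed
        then show "u p = (case p of (x, g) \<Rightarrow> if x \<in> carrier G \<and> g \<in> carrier G then u (\<one>, g) else 0)"
          unfolding p prod.case .
      qed
      show "(\<lambda>g. u (\<one>, g)) \<in> group_alg G"
        using conjunct1 [OF u] by (simp add: group_alg_def mem_free_on_finite)
    qed
  qed
qed

abbreviation KG :: "('g \<times> 'g \<Rightarrow> 'k::field) set" where
  "KG \<equiv> group_alg_in_double G"

text \<open>The element \<open>1 \<bowtie> h\<close>.\<close>

definition emb :: "'g \<Rightarrow> 'g \<times> 'g \<Rightarrow> 'k::field" where
  "emb h = (\<lambda>(x, g). of_bool (x \<in> carrier G \<and> g = h))"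

lemma emb_in_KG: "h \<in> carrier G \<Longrightarrow> emb h \<in> KG"
  by (auto simp: mem_group_alg_in_double_iff emb_def mem_free_on_finite)

lemma KG_D:
  assumes "c \<in> KG"
  shows "c \<in> free_on (carrier G \<times> carrier G)"
    "x \<in> carrier G \<Longrightarrow> g \<in> carrier G \<Longrightarrow> c (x, g) = c (\<one>, g)"
  using assms unfolding mem_group_alg_in_double_iff by blast+

section \<open>Coordinates on the relative tensor powers\<close>

text \<open>Moving group elements to the right across the tensor signs turns every basis tensor into one
  of the form \<open>p(x\<^sub>1) \<otimes> \<dots> \<otimes> p(x\<^sub>n) \<bowtie> g\<close>. Its coefficient in \<open>v\<^sub>1 \<otimes> \<dots> \<otimes> v\<^sub>n\<close> is
  \<open>dcoef [v\<^sub>1, \<dots>, v\<^sub>n] ([x\<^sub>1, \<dots>, x\<^sub>n], g)\<close>.\<close>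

primrec dcoef :: "('g \<times> 'g \<Rightarrow> 'k::field) list \<Rightarrow> 'g list \<times> 'g \<Rightarrow> 'k" where
  "dcoef [] z = of_bool (z = ([], \<one>))"
| "dcoef (v # vs) z = (case fst z of [] \<Rightarrow> 0
     | x # xs \<Rightarrow> \<Sum>g\<in>carrier G. v (x, g) * dcoef vs (cj (inv g) xs, inv g \<otimes> snd z))"

lemma dcoef_Nil: "vs \<noteq> [] \<Longrightarrow> dcoef vs ([], k) = 0"
  by (cases vs) auto

text \<open>A prefix \<open>us\<close> acts linearly on \<open>dcoef\<close> of the tail. It
  evaluates the tail at shorter, conjugated words, so the hypothesis has to range over all
  words.\<close>

lemma dcoef_combine:
  assumes "\<And>n xs k. xs \<in> X n \<Longrightarrow> k \<in> carrier G \<Longrightarrow>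
      dcoef vs (xs, k) = c * dcoef vs1 (xs, k) + d * dcoef vs2 (xs, k)"
    and "xs \<in> X n" "k \<in> carrier G"
  shows "dcoef (us @ vs) (xs, k) = c * dcoef (us @ vs1) (xs, k) + d * dcoef (us @ vs2) (xs, k)"
  using assms(2,3)
proof (induction us arbitrary: xs k n)
  case Nil
  then show ?case using assms(1) by simp
next
  case (Cons u us)
  show ?case
  proof (cases xs)
    case (Cons x ys)
    then have ys: "ys \<in> X (length ys)" using \<open>xs \<in> X n\<close> by (auto simp: words_def)
    have "dcoef (us @ vs) (cj (inv g) ys, inv g \<otimes> k) = c * dcoef (us @ vs1) (cj (inv g) ys, inv g \<otimes> k)
        + d * dcoef (us @ vs2) (cj (inv g) ys, inv g \<otimes> k)" if "g \<in> carrier G" for g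
      using Cons.prems that by (intro Cons.IH [OF cj_closed [OF _ ys]]) auto
    then show ?thesis
      using Cons by (simp add: algebra_simps sum.distrib sum_distrib_left)
  qed simp
qed

text \<open>The group part \<open>h\<close> of \<open>c\<close> moves the whole word and the group
  element, while the \<open>p\<close>-part of \<open>c\<close> only tests the first entry.
  Reindexing by \<open>g \<mapsto> h \<otimes> g\<close> matches the two sums.\<close>

lemma dcoef_mult_left:
  assumes "xs \<in> X n" "xs \<noteq> []" "k \<in> carrier G"
  shows "dcoef ((c \<otimes>\<^bsub>double G\<^esub> w) # ws) (xs, k) =
    (\<Sum>h\<in>carrier G. c (hd xs, h) * dcoef (w # ws) (cj (inv h) xs, inv h \<otimes> k))"
proof -
  obtain x ys where xs: "xs = x # ys" using assms(2) by (cases xs) auto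
  then have x: "x \<in> carrier G" and ys: "ys \<in> X (length ys)" using assms(1) by (auto simp: words_def)
  let ?D = "\<lambda>g. dcoef ws (cj (inv g) ys, inv g \<otimes> k)"
  have "dcoef ((c \<otimes>\<^bsub>double G\<^esub> w) # ws) (xs, k)
      = (\<Sum>g\<in>carrier G. \<Sum>h\<in>carrier G. c (x, h) * (w (cnjg (inv h) x, inv h \<otimes> g) * ?D g))"
    by (simp add: xs mult_double_apply x sum_distrib_right mult.assoc)
  also have "\<dots> = (\<Sum>h\<in>carrier G. c (x, h) * (\<Sum>g\<in>carrier G. w (cnjg (inv h) x, inv h \<otimes> g) * ?D g))"
    by (subst sum.swap) (simp add: sum_distrib_left)
  also have "\<dots> = (\<Sum>h\<in>carrier G. c (x, h) * dcoef (w # ws) (cj (inv h) xs, inv h \<otimes> k))"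
  proof (intro sum.cong refl)
    fix h assume h: "h \<in> carrier G"
    have "(\<Sum>g\<in>carrier G. w (cnjg (inv h) x, inv h \<otimes> g) * ?D g)
        = (\<Sum>g\<in>carrier G. w (cnjg (inv h) x, inv h \<otimes> (h \<otimes> g)) * ?D (h \<otimes> g))"
      by (rule sum_translate(1) [OF h, symmetric])
    also have "\<dots> = dcoef (w # ws) (cj (inv h) xs, inv h \<otimes> k)"
      using h ys assms(3)
      by (auto simp: xs m_assoc [symmetric] inv_mult_group cj_mult simp del: map_map intro!: sum.cong)
    finally show "c (x, h) * (\<Sum>g\<in>carrier G. w (cnjg (inv h) x, inv h \<otimes> g) * ?D g)
      = c (x, h) * dcoef (w # ws) (cj (inv h) xs, inv h \<otimes> k)" by simp
  qed
  finally show ?thesis by (simp add: xs)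
qed

text \<open>The coefficients of \<open>b\<close> ignore the first coordinate and so are not affected
  by conjugation; both sides then sum over the same ways of splitting a group element between
  \<open>v\<close> and \<open>b\<close>.\<close>

lemma dcoef_balanced:
  assumes b: "b \<in> KG" and xs: "xs \<in> X n" and k: "k \<in> carrier G"
  shows "dcoef ((v \<otimes>\<^bsub>double G\<^esub> b) # w # ws) (xs, k) = dcoef (v # (b \<otimes>\<^bsub>double G\<^esub> w) # ws) (xs, k)"
proof (cases xs)
  case (Cons x ys)
  then have x: "x \<in> carrier G" and ys: "ys \<in> X (length ys)" using xs by (auto simp: words_def)
  show ?thesis
  proof (cases ys)
    case Nil
    then show ?thesis using Cons by simp
  next
    case (Cons y zs)
    let ?D = "\<lambda>g. dcoef (w # ws) (cj (inv g) ys, inv g \<otimes> k)"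
    have "dcoef ((v \<otimes>\<^bsub>double G\<^esub> b) # w # ws) (xs, k)
        = (\<Sum>g\<in>carrier G. (\<Sum>h\<in>carrier G. v (x, h) * b (\<one>, inv h \<otimes> g)) * ?D g)"
    proof -
      have "(v \<otimes>\<^bsub>double G\<^esub> b) (x, g) = (\<Sum>h\<in>carrier G. v (x, h) * b (\<one>, inv h \<otimes> g))" if "g \<in> carrier
          G" for g
        using that x KG_D(2) [OF b, of "cnjg (inv _) x"] by (simp add: mult_double_apply)
      then show ?thesis by (simp add: \<open>xs = x # ys\<close> del: dcoef.simps(2) add: dcoef.simps(2)
          [of "v \<otimes>\<^bsub>double G\<^esub> b"])
    qed
    also have "\<dots> = (\<Sum>h\<in>carrier G. v (x, h) * (\<Sum>g\<in>carrier G. b (\<one>, inv h \<otimes> g) * ?D g))"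
      unfolding sum_distrib_right by (subst sum.swap) (simp add: sum_distrib_left mult.assoc del:
          dcoef.simps)
    also have "\<dots> = (\<Sum>h\<in>carrier G. v (x, h) * dcoef ((b \<otimes>\<^bsub>double G\<^esub> w) # ws) (cj (inv h) ys, inv h \<otimes> k))"
    proof (intro sum.cong refl)
      fix h assume h: "h \<in> carrier G"
      have cys: "cj (inv h) ys \<in> X (length ys)" "cj (inv h) ys \<noteq> []"
        using cj_closed [OF inv_closed [OF h] ys] Cons by simp_all
      have hd: "hd (cj (inv h) ys) \<in> carrier G"
        using cys(1) hd_in_set [OF cys(2)] unfolding words_def by blast
      have "(\<Sum>g\<in>carrier G. b (\<one>, inv h \<otimes> g) * ?D g) = (\<Sum>g\<in>carrier G. b (\<one>, inv h \<otimes> (h \<otimes> g)) * ?D (h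
          \<otimes> g))"
        by (rule sum_translate(1) [OF h, symmetric])
      also have "\<dots> = (\<Sum>g\<in>carrier G. b (hd (cj (inv h) ys), g) * dcoef (w # ws) (cj (inv g) (cj (inv
          h) ys), inv g \<otimes> (inv h \<otimes> k)))"
        using h ys k KG_D(2) [OF b hd]
        by (intro sum.cong refl) (simp add: m_assoc [symmetric] inv_mult_group cj_mult del: map_map
            dcoef.simps)
      also have "\<dots> = dcoef ((b \<otimes>\<^bsub>double G\<^esub> w) # ws) (cj (inv h) ys, inv h \<otimes> k)"
        using h k by (intro dcoef_mult_left [symmetric, OF cys]) auto
      finally show "v (x, h) * (\<Sum>g\<in>carrier G. b (\<one>, inv h \<otimes> g) * ?D g)
        = v (x, h) * dcoef ((b \<otimes>\<^bsub>double G\<^esub> w) # ws) (cj (inv h) ys, inv h \<otimes> k)" by simp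
    qed
    also have "\<dots> = dcoef (v # (b \<otimes>\<^bsub>double G\<^esub> w) # ws) (xs, k)"
      by (simp add: \<open>xs = x # ys\<close> del: dcoef.simps(2) add: dcoef.simps(2) [of v])
    finally show ?thesis .
  qed
qed simp

lemma dcoef_single:
  "g \<in> carrier G \<Longrightarrow> dcoef [v] (x # xs, g) = of_bool (xs = []) * v (x, g)"
proof -
  assume g: "g \<in> carrier G"
  have "dcoef [v] (x # xs, g) = (\<Sum>h\<in>carrier G. if h = g then of_bool (xs = []) * v (x, g) else 0)"
    unfolding dcoef.simps fst_conv snd_conv list.case
  proof (intro sum.cong refl)
    fix h assume h: "h \<in> carrier G"
    have "inv h \<otimes> g = \<one> \<longleftrightarrow> h = g"
      using g h by (metis inv_closed inv_equality inv_inv l_inv)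
    then show "v (x, h) * of_bool ((cj (inv h) xs, inv h \<otimes> g) = ([], \<one>)) = (if h
        = g then of_bool (xs = []) * v (x, g) else 0)"
      by auto
  qed
  then show ?thesis using g by simp
qed

text \<open>Only the last factor meets \<open>c\<close>, so the induction runs over the earlier
  ones; the shift \<open>g \<mapsto> h \<otimes> g\<close> absorbs the conjugation coming from the
  head.\<close>

lemma dcoef_mult_right:
  assumes "xs \<in> X n" "xs \<noteq> []" "k \<in> carrier G"
  shows "dcoef (us @ [v \<otimes>\<^bsub>double G\<^esub> c]) (xs, k) =
    (\<Sum>g\<in>carrier G. dcoef (us @ [v]) (xs, g) * c (cnjg (inv g) (last xs), inv g \<otimes> k))"
  using assms
proof (induction us arbitrary: xs n k)
  case Nil
  then obtain x ys where xs: "xs = x # ys" by (cases xs) auto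
  then have x: "x \<in> carrier G" using Nil by (auto simp: words_def)
  have "(\<Sum>g\<in>carrier G. dcoef [v] (xs, g) * c (cnjg (inv g) (last xs), inv g \<otimes> k))
      = (\<Sum>g\<in>carrier G. of_bool (ys = []) * (v (x, g) * c (cnjg (inv g) x, inv g \<otimes> k)))"
    by (intro sum.cong refl) (auto simp: xs dcoef_single simp del: dcoef.simps)
  also have "\<dots> = dcoef [v \<otimes>\<^bsub>double G\<^esub> c] (xs, k)"
    using x Nil.prems by (simp add: xs dcoef_single mult_double_apply sum_distrib_left del: dcoef.simps)
  finally show ?case by simp
next
  case (Cons u us)
  then obtain x ys where xs: "xs = x # ys" by (cases xs) auto
  then have x: "x \<in> carrier G" and ys: "ys \<in> X (length ys)" using Cons.prems by (auto simp: words_def)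
  show ?case
  proof (cases "ys = []")
    case True
    then show ?thesis by (simp add: xs dcoef_Nil)
  next
    case False
    have lst: "last (cj h ys) = cnjg h (last ys)" for h using False by (simp add: last_map)
    have lG: "last ys \<in> carrier G" using ys False last_in_set by (auto simp: words_def)
    have "dcoef ((u # us) @ [v \<otimes>\<^bsub>double G\<^esub> c]) (xs, k)
      = (\<Sum>h\<in>carrier G. u (x, h) * dcoef (us @ [v \<otimes>\<^bsub>double G\<^esub> c]) (cj (inv h) ys, inv h \<otimes> k))"
      by (simp add: xs)
    also have "\<dots> = (\<Sum>h\<in>carrier G. \<Sum>g\<in>carrier G. u (x, h) * dcoef (us @ [v]) (cj (inv h) ys, inv h \<otimes>
        g) * c (cnjg (inv g) (last ys), inv g \<otimes> k))"
    proof (intro sum.cong refl)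
      fix h assume h: "h \<in> carrier G"
      have "dcoef (us @ [v \<otimes>\<^bsub>double G\<^esub> c]) (cj (inv h) ys, inv h \<otimes> k) =
        (\<Sum>g\<in>carrier G. dcoef (us @ [v]) (cj (inv h) ys, g) * c (cnjg (inv g) (last (cj (inv h) ys)),
            inv g \<otimes> (inv h \<otimes> k)))"
        using h ys False Cons.prems by (intro Cons.IH [of _ "length ys"]) auto
      also have "\<dots> = (\<Sum>g\<in>carrier G. dcoef (us @ [v]) (cj (inv h) ys, inv h \<otimes> (h \<otimes> g)) * c (cnjg (inv
          (h \<otimes> g)) (last ys), inv (h \<otimes> g) \<otimes> k))"
        using h lG Cons.prems by (intro sum.cong refl) (simp add: lst cnjg_mult inv_mult_group
            m_assoc [symmetric])
      also have "\<dots> = (\<Sum>g\<in>carrier G. dcoef (us @ [v]) (cj (inv h) ys, inv h \<otimes> g) * c (cnjg (inv g)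
          (last ys), inv g \<otimes> k))"
        by (rule sum_translate(1) [OF h])
      finally show "u (x, h) * dcoef (us @ [v \<otimes>\<^bsub>double G\<^esub> c]) (cj (inv h) ys, inv h \<otimes> k) =
        (\<Sum>g\<in>carrier G. u (x, h) * dcoef (us @ [v]) (cj (inv h) ys, inv h \<otimes> g) * c (cnjg (inv g)
            (last ys), inv g \<otimes> k))"
        by (simp add: sum_distrib_left mult.assoc)
    qed
    also have "\<dots> = (\<Sum>g\<in>carrier G. dcoef ((u # us) @ [v]) (xs, g) * c (cnjg (inv g) (last xs), inv g
        \<otimes> k))"
      using False by (subst sum.swap) (simp add: xs sum_distrib_right)
    finally show ?thesis .
  qed
qed

text \<open>Indices of the normal form: group part \<open>\<one>\<close> in every entry but the
  last, which carries \<open>k\<close>. On the empty word \<open>k\<close> is lost, so only positive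
  lengths are meaningful.\<close>

fun sec :: "'g list \<Rightarrow> 'g \<Rightarrow> ('g \<times> 'g) list" where
  "sec [] k = []"
| "sec [x] k = [(x, k)]"
| "sec (x # y # xs) k = (x, \<one>) # sec (y # xs) k"

lemma length_sec [simp]: "length (sec xs k) = length xs"
  by (induction xs k rule: sec.induct) auto

lemma set_sec: "set xs \<subseteq> carrier G \<Longrightarrow> k \<in> carrier G \<Longrightarrow> set (sec xs k) \<subseteq> carrier G \<times> carrier G"
  by (induction xs k rule: sec.induct) auto

text \<open>Together with the vanishing of \<open>dcoef\<close> on the relations, this gives the
  linear independence of the normal forms in the quotient.\<close>

lemma dcoef_sec:
  fixes k :: 'g
  assumes "xs \<in> X n" "xs \<noteq> []" "g \<in> carrier G" "ys \<in> X m" "k \<in> carrier G"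
  shows "dcoef (map delta (sec xs g)) (ys, k) = (of_bool (ys = xs \<and> k = g) :: 'k::field)"
  using assms
proof (induction xs g arbitrary: n m ys rule: sec.induct)
  case (2 x g)
  then show ?case
    by (cases ys) (auto simp: dcoef_single delta_apply simp del: dcoef.simps, simp)
next
  case (3 x y xs g)
  show ?case
  proof (cases ys)
    case (Cons z zs)
    then have zs: "zs \<in> X (length zs)" using 3 by (auto simp: words_def)
    have "(dcoef (map delta (sec (x # y # xs) g)) (ys, k) :: 'k)
      = (\<Sum>h\<in>carrier G. if h = \<one> then of_bool (z = x) * dcoef (map delta (sec (y # xs) g)) (zs, k)
          else 0)"
      unfolding sec.simps list.map dcoef.simps fst_conv snd_conv Cons list.case
      using zs "3.prems" by (intro sum.cong refl) (auto simp: delta_apply)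
    also have "\<dots> = of_bool (z = x) * of_bool (zs = y # xs \<and> k = g)"
    proof -
      have IH: "dcoef (map delta (sec (y # xs) g)) (zs, k) = (of_bool (zs = y # xs \<and> k = g) :: 'k)"
        using zs "3.prems" by (intro "3.IH" [of "Suc (length xs)" zs "length zs"]) (auto simp: words_def)
      show ?thesis unfolding IH by simp
    qed
    finally show ?thesis using Cons by auto
  qed simp
qed simp

abbreviation Y :: "nat \<Rightarrow> ('g list \<times> 'g) set" where
  "Y n \<equiv> X n \<times> carrier G"

abbreviation rels :: "nat \<Rightarrow> (('g \<times> 'g \<Rightarrow> 'k::field) list \<Rightarrow> 'k) set" where
  "rels n \<equiv> multilinear_rels (double G) n \<union> balanced_rels KG (double G) n"

text \<open>\<open>p\<^sub>x \<bowtie> g = (p\<^sub>x \<bowtie> 1)(1 \<bowtie> g)\<close> and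
  \<open>(1 \<bowtie> g)(p\<^sub>y \<bowtie> k) = p(gyg\<^sup>-\<^sup>1) \<bowtie> gk\<close>, so a
  single balancing relation moves \<open>g\<close> across.\<close>

lemma delta_slide:
  fixes us ws :: "('g \<times> 'g \<Rightarrow> 'k::field) list"
  assumes g: "x \<in> carrier G" "g \<in> carrier G" "y \<in> carrier G" "k \<in> carrier G"
    and t: "us @ [delta (x, g), delta (y, k)] @ ws \<in> tuples (double G :: ('k, _) module) n"
  shows "delta (us @ [delta (x, g), delta (y, k)] @ ws)
    - delta (us @ [delta (x, \<one>), delta (cnjg g y, g \<otimes> k)] @ ws) \<in> fspan (rels n)"
proof -
  have eq: "z = inv h \<otimes> l \<longleftrightarrow> l = h \<otimes> z" if "h \<in> carrier G" "l \<in> carrier G" "z \<in> carrier G" for h l z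
    using that by (auto simp: m_assoc [symmetric])
  have 1: "delta (x, \<one>) \<otimes>\<^bsub>double G\<^esub> emb g = (delta (x, g) :: _ \<Rightarrow> 'k)"
  proof
    fix p :: "'g \<times> 'g"
    obtain x0 g0 where p: "p = (x0, g0)" by (cases p)
    have "(\<Sum>h\<in>carrier G. delta (x, \<one>) (x0, h) * emb g (cnjg (inv h) x0, inv h \<otimes> g0) :: 'k)
      = (\<Sum>h\<in>carrier G. if h = \<one> then of_bool (x0 = x \<and> g0 = g) else 0)"
      if "x0 \<in> carrier G" "g0 \<in> carrier G"
      using that by (intro sum.cong refl) (auto simp: delta_apply emb_def)
    then show "(delta (x, \<one>) \<otimes>\<^bsub>double G\<^esub> emb g) p = (delta (x, g) p :: 'k)"
      using g by (auto simp: mult_double p delta_apply)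
  qed
  have 2: "emb g \<otimes>\<^bsub>double G\<^esub> delta (y, k) = (delta (cnjg g y, g \<otimes> k) :: _ \<Rightarrow> 'k)"
  proof
    fix p :: "'g \<times> 'g"
    obtain x0 g0 where p: "p = (x0, g0)" by (cases p)
    have "(\<Sum>h\<in>carrier G. emb g (x0, h) * delta (y, k) (cnjg (inv h) x0, inv h \<otimes> g0) :: 'k)
      = (\<Sum>h\<in>carrier G. if h = g then of_bool (x0 = cnjg g y \<and> g0 = g \<otimes> k) else 0)"
      if "x0 \<in> carrier G" "g0 \<in> carrier G"
      using that g eq [of g g0 k] by (intro sum.cong refl) (auto simp: delta_apply emb_def)
    then show "(emb g \<otimes>\<^bsub>double G\<^esub> delta (y, k)) p = (delta (cnjg g y, g \<otimes> k) p :: 'k)"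
      using g by (auto simp: mult_double p delta_apply)
  qed
  have t': "us @ [delta (x, \<one>), delta (y, k)] @ ws \<in> tuples (double G :: ('k, _) module) n"
    using t g by (auto simp: tuples_def)
  have "delta (us @ [delta (x, \<one>) \<otimes>\<^bsub>double G\<^esub> emb g, delta (y, k)] @ ws)
      - delta (us @ [delta (x, \<one>), emb g \<otimes>\<^bsub>double G\<^esub> delta (y, k)] @ ws)
      \<in> (balanced_rels KG (double G) n :: (('g \<times> 'g \<Rightarrow> 'k) list \<Rightarrow> 'k) set)"
    unfolding balanced_rels_def using t' emb_in_KG [OF g(2)] by blast
  then show ?thesis unfolding 1 2 by (intro eqmod_base) simp
qed

text \<open>All entries of a normal form but the last have group part \<open>1\<close>, so
  \<open>g\<close> passes along unchanged, conjugating each entry, and multiplies into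
  \<open>k\<close> at the end.\<close>

lemma delta_slide_sec:
  fixes us :: "('g \<times> 'g \<Rightarrow> 'k::field) list"
  assumes "x \<in> carrier G" "g \<in> carrier G" "k \<in> carrier G" "set ys \<subseteq> carrier G" "ys \<noteq> []"
    and "us @ map delta ((x, g) # sec ys k) \<in> tuples (double G :: ('k, _) module) n"
  shows "delta (us @ map delta ((x, g) # sec ys k))
    - delta (us @ map delta (sec (x # cj g ys) (g \<otimes> k))) \<in> fspan (rels n)"
  using assms
proof (induction ys k arbitrary: us x rule: sec.induct)
  case (2 y k)
  from 2 show ?case
    using delta_slide [of x g y k us "[]" n]
        by (simp only: sec.simps list.map append_Nil append_Nil2 list.set_intros insert_subset
        list.set append.simps simp_thms)
next
  case (3 y z ys k)
  let ?ws = "map delta (sec (z # ys) k) :: ('g \<times> 'g \<Rightarrow> 'k) list"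
  have t: "us @ [delta (x, g), delta (y, \<one>)] @ ?ws \<in> tuples (double G :: ('k, _) module) n"
    using "3.prems" by simp
  have 1: "delta (us @ [delta (x, g), delta (y, \<one>)] @ ?ws) - delta (us @
      [delta (x, \<one>), delta (cnjg g y, g)] @ ?ws) \<in> fspan (rels n)"
    using delta_slide [OF _ _ _ _ t] "3.prems" by simp
  have "(us @ [delta (x, \<one>)]) @ map delta ((cnjg g y, g) # sec (z # ys) k) \<in> tuples (double G ::
      ('k, _) module) n"
    using t "3.prems" by (auto simp: tuples_def)
  then have "delta ((us @ [delta (x, \<one>)]) @ map delta ((cnjg g y, g) # sec (z # ys) k)) -
     delta ((us @ [delta (x, \<one>)]) @ map delta (sec (cnjg g y # cj g (z # ys)) (g \<otimes> k))) \<in> fspan (rels n)"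
    using "3.prems" by (intro "3.IH") auto
  with 1 have "delta (us @ [delta (x, g), delta (y, \<one>)] @ ?ws) -
     delta ((us @ [delta (x, \<one>)]) @ map delta (sec (cnjg g y # cj g (z # ys)) (g \<otimes> k))) \<in> fspan (rels n)"
    by (intro eqmod_trans [OF 1]) (simp only: append_assoc append_Cons append_Nil sec.simps list.map)
  then show ?case by (simp only: append_assoc append_Cons append_Nil sec.simps list.map)
qed simp

lemma bij_Y_left:
  "g \<in> carrier G \<Longrightarrow> bij_betw (\<lambda>(xs, k). (cj g xs, g \<otimes> k)) (Y n) (Y n)"
  by (rule bij_betwI [where g = "\<lambda>(xs, k). (cj (inv g) xs, inv g \<otimes> k)"])
    (auto simp: m_assoc [symmetric] simp del: map_map)

text \<open>Each head \<open>p\<^sub>x \<bowtie> g\<close> is slid through the normal form of the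
  tail.\<close>

lemma delta_dcoef_expand:
  fixes us vs :: "('g \<times> 'g \<Rightarrow> 'k::field) list"
  assumes "us @ vs \<in> tuples (double G :: ('k, _) module) n" "vs \<noteq> []"
  shows "delta (us @ vs) - (\<Sum>z\<in>Y (length vs). fscale (dcoef vs z) (delta (us @ map delta (sec (fst
      z) (snd z)))))
    \<in> fspan (rels n)"
  using assms
proof (induction vs arbitrary: us)
  case (Cons v vs)
  let ?I = "carrier G \<times> carrier G"
  note V = double_simps(1-3)
  have I: "finite ?I" by simp
  show ?case
  proof (cases "vs = []")
    case True
    have "delta (us @ [v] @ []) - (\<Sum>i\<in>?I. fscale (v i) (delta (us @ [delta i] @ []))) \<in> fspan (rels n)"
      using Cons.prems True by (intro delta_tensor_expand [OF V I]) auto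
    moreover have "(\<Sum>z\<in>Y (Suc 0). fscale (dcoef [v] z) (delta (us @ map delta (sec (fst z) (snd z)))))
      = (\<Sum>i\<in>?I. fscale (v i) (delta (us @ [delta i])))"
      unfolding sum.cartesian_product' [of _ "words _ _"] sum_words_Suc sum.cartesian_product'
          [of _ "carrier G"]
      by (intro sum.cong refl) (simp add: words_0 dcoef_single del: dcoef.simps)
    ultimately show ?thesis by (simp only: True append_Nil2 length_Cons list.size(3))
  next
    case False
    let ?m = "length vs"
    let ?f = "\<lambda>xs k. delta (us @ map delta (sec xs k)) :: ('g \<times> 'g \<Rightarrow> 'k) list \<Rightarrow> 'k"
    have "delta (us @ v # vs) - (\<Sum>i\<in>?I. \<Sum>z\<in>Y ?m. fscale (v i * dcoef vs z) (delta (us @ map delta (i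
        # sec (fst z) (snd z))))) \<in> fspan (rels n)"
      by (rule delta_tensor_expand_Cons [OF V I _ Cons.prems(1)]) (auto intro: Cons.IH [OF _ False])
    moreover have "(\<Sum>i\<in>?I. \<Sum>z\<in>Y ?m. fscale (v i * dcoef vs z) (delta (us @ map delta (i # sec (fst
        z) (snd z)))))
      - (\<Sum>i\<in>?I. \<Sum>z\<in>Y ?m. fscale (v i * dcoef vs z) (?f (fst i # cj (snd i) (fst z)) (snd i \<otimes> snd
          z))) \<in> fspan (rels n)"
    proof (intro eqmod_sum eqmod_scale)
      fix i z assume i: "i \<in> ?I" and z: "z \<in> Y ?m"
      have "set (sec (fst z) (snd z)) \<subseteq> ?I" using z by (intro set_sec) (auto simp: words_def)
      then have t: "us @ map delta ((fst i, snd i) # sec (fst z) (snd z)) \<in> tuples (double G :: ('k,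
          _) module) n"
        using Cons.prems(1) i z by (auto simp: tuples_def words_def)
      have nz: "fst z \<noteq> []" using z False by (auto simp: words_def)
      show "delta (us @ map delta (i # sec (fst z) (snd z))) - ?f (fst i # cj (snd i) (fst z)) (snd
          i \<otimes> snd z) \<in> fspan (rels n)"
        using delta_slide_sec [OF _ _ _ _ nz t] i z by (auto simp: words_def)
    qed
    moreover have "(\<Sum>i\<in>?I. \<Sum>z\<in>Y ?m. fscale (v i * dcoef vs z) (?f (fst i # cj (snd i) (fst z)) (snd
        i \<otimes> snd z)))
      = (\<Sum>z\<in>Y (Suc ?m). fscale (dcoef (v # vs) z) (?f (fst z) (snd z)))"
    proof -
      have "(\<Sum>i\<in>?I. \<Sum>z\<in>Y ?m. fscale (v i * dcoef vs z) (?f (fst i # cj (snd i) (fst z)) (snd i \<otimes> snd z)))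
        = (\<Sum>x\<in>carrier G. \<Sum>g\<in>carrier G. \<Sum>z\<in>Y ?m. fscale (v (x, g) * dcoef vs z) (?f (x # cj g (fst
            z)) (g \<otimes> snd z)))"
        by (simp only: sum.cartesian_product' [of _ "carrier G" "carrier G"] fst_conv snd_conv)
      also have "\<dots> = (\<Sum>x\<in>carrier G. \<Sum>g\<in>carrier G. \<Sum>z\<in>Y ?m. fscale (v (x, g) * dcoef vs (cj (inv g)
          (fst z), inv g \<otimes> snd z)) (?f (x # fst z) (snd z)))"
      proof (rule sum.cong [OF refl], rule sum.cong [OF refl])
        fix x g assume g: "g \<in> carrier G"
        let ?h = "\<lambda>z. fscale (v (x, g) * dcoef vs (cj (inv g) (fst z), inv g \<otimes> snd z)) (?f (x # fst
            z) (snd z))"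
        \<comment> \<open>Translating the index of the tail by \<open>g\<close> turns the slid
          normal form into a plain one and brings \<open>inv g\<close> into the coefficient, as in
          the recursion of \<open>dcoef\<close>.\<close>
        have "(\<Sum>z\<in>Y ?m. ?h z) = (\<Sum>z\<in>Y ?m. ?h (case z of (xs, k) \<Rightarrow> (cj g xs, g \<otimes> k)))"
          by (rule sum.reindex_bij_betw [OF bij_Y_left [OF g], symmetric])
        also have "\<dots> = (\<Sum>z\<in>Y ?m. fscale (v (x, g) * dcoef vs z) (?f (x # cj g (fst z)) (g \<otimes> snd z)))"
        proof (rule sum.cong [OF refl])
          fix z assume "z \<in> Y ?m"
          then obtain xs k where z: "z = (xs, k)" "xs \<in> X ?m" "k \<in> carrier G" by auto
          have "inv g \<otimes> (g \<otimes> k) = k" using z g by (simp add: m_assoc [symmetric])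
          then show "?h (case z of (xs, k) \<Rightarrow> (cj g xs, g \<otimes> k)) = fscale (v (x, g) * dcoef vs z) (?f
              (x # cj g (fst z)) (g \<otimes> snd z))"
            using z(2) g unfolding z(1) prod.case fst_conv snd_conv by (simp only: cj_inv)
        qed
        finally show "(\<Sum>z\<in>Y ?m. fscale (v (x, g) * dcoef vs z) (?f (x # cj g (fst z)) (g \<otimes> snd z)))
            = (\<Sum>z\<in>Y ?m. ?h z)" by (rule sym)
      qed
      also have "\<dots> = (\<Sum>x\<in>carrier G. \<Sum>z\<in>Y ?m. fscale (dcoef (v # vs) (x # fst z, snd z)) (?f (x # fst
          z) (snd z)))"
        by (rule sum.cong [OF refl], subst sum.swap, rule sum.cong [OF refl]) (simp add:
            fun_space.scale_sum_left)
      also have "\<dots> = (\<Sum>z\<in>Y (Suc ?m). fscale (dcoef (v # vs) z) (?f (fst z) (snd z)))"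
        by (simp only: sum.cartesian_product' [of _ "words _ _"] sum_words_Suc fst_conv snd_conv)
      finally show ?thesis .
    qed
    ultimately show ?thesis using eqmod_trans by (metis (no_types, lifting) length_Cons)
  qed
qed simp

end

section \<open>Tensor powers of the double as bimodules\<close>

lemma op_equiv_mono: "op_equiv \<Omega> M N \<Longrightarrow> \<Omega>' \<subseteq> \<Omega> \<Longrightarrow> op_equiv \<Omega>' M N"
  unfolding op_equiv_def op_equiv_by_def opclosed_def opmod_iso_def
  by (elim exE conjE, rule exI, intro conjI; (assumption | blast))

lemma Inf_enat_eq_Least:
  assumes "P n" "\<And>m. P m \<Longrightarrow> n \<le> m"
  shows "Inf {enat m | m. P m} = enat n"
  using assms by (intro antisym Inf_lower Inf_greatest) auto

context finite_group begin

lemma hd_last_closed: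
  assumes "xs \<in> X n" "xs \<noteq> []"
  shows "hd xs \<in> carrier G" "last xs \<in> carrier G"
  using assms hd_in_set [OF assms(2)] last_in_set [OF assms(2)] by (auto simp: words_def)

text \<open>Left and right multiplication by arbitrary elements of \<open>D(G)\<close> in normal
  form coordinates, read off from \<open>dcoef_mult_left\<close> and
  \<open>dcoef_mult_right\<close>. The entries \<open>hd\<close> and \<open>last\<close> make sense
  for \<open>n \<ge> 1\<close>.\<close>

definition dop ::
  "nat \<Rightarrow> ('g \<times> 'g \<Rightarrow> 'k::field) + ('g \<times> 'g \<Rightarrow> 'k) \<Rightarrow> ('g list \<times> 'g \<Rightarrow> 'k) \<Rightarrow> 'g list \<times> 'g \<Rightarrow> 'k" where
  "dop n \<omega> F = (\<lambda>(xs, k). if xs \<in> X n \<and> k \<in> carrier G then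
     (case \<omega> of
        Inl c \<Rightarrow> \<Sum>h\<in>carrier G. c (hd xs, h) * F (cj (inv h) xs, inv h \<otimes> k)
      | Inr c \<Rightarrow> \<Sum>g\<in>carrier G. F (xs, g) * c (cnjg (inv g) (last xs), inv g \<otimes> k))
     else 0)"

lemma finite_Y [simp]: "finite (Y n)"
  by simp

lemma linear_on_dop: "linear_on (Y n) (Y n) (dop n \<omega>)"
  unfolding linear_on_def
proof (intro conjI ballI allI)
  fix F H :: "'g list \<times> 'g \<Rightarrow> 'a"
  show "dop n \<omega> F \<in> free_on (Y n)" by (auto simp: dop_def mem_free_on_finite)
  show "dop n \<omega> (F + H) = dop n \<omega> F + dop n \<omega> H"
    by (cases \<omega>) (auto simp: dop_def fun_eq_iff algebra_simps sum.distrib)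
  show "dop n \<omega> (fscale c F) = fscale c (dop n \<omega> F)" for c
    by (cases \<omega>) (auto simp: dop_def fun_eq_iff sum_distrib_left mult_ac)
qed

lemma balanced_rels_subset:
  "balanced_rels (KG :: ('g \<times> 'g \<Rightarrow> 'k::field) set) (double G) n \<subseteq> free_on (tuples (double G) n)"
proof
  fix r assume "r \<in> balanced_rels (KG :: ('g \<times> 'g \<Rightarrow> 'k) set) (double G) n"
  then obtain us v b w ws where r: "r = delta (us @ [v \<otimes>\<^bsub>double G\<^esub> b, w] @ ws) - delta (us @
      [v, b \<otimes>\<^bsub>double G\<^esub> w] @ ws)"
    and t: "us @ [v, w] @ ws \<in> tuples (double G :: ('k, _) module) n"
    unfolding balanced_rels_def by blast
  have "us @ [v \<otimes>\<^bsub>double G\<^esub> b, w] @ ws \<in> tuples (double G :: ('k, _) module) n"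
    "us @ [v, b \<otimes>\<^bsub>double G\<^esub> w] @ ws \<in> tuples (double G :: ('k, _) module) n"
    using t by (auto simp: tuples_def)
  then show "r \<in> free_on (tuples (double G) n)"
    unfolding r by (intro free_on_simps) (simp_all only: delta_in_free_on)
qed

text \<open>With all of \<open>D(G)\<close> acting on both sides, one isomorphism serves every
  choice of operators in odd and even depth.\<close>

lemma rel_tensor_pow_equiv:
  assumes n: "n \<ge> 1"
  shows "op_equiv (carrier (double G) <+> carrier (double G))
    (rel_tensor_pow KG (double G) n :: ('k::field, _, _) opmod) (vec_mod (Y n) (dop n))"
  unfolding rel_tensor_pow_def
proof (rule op_equiv_quot_mod [where \<phi> = "\<lambda>vs z. if z \<in> Y n then dcoef vs z else 0"
      and b = "\<lambda>z. map delta (sec (fst z) (snd z))"])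
  let ?D = "double G :: ('k, 'g \<times> 'g \<Rightarrow> 'k) module"
  let ?\<phi> = "\<lambda>vs z. if z \<in> Y n then dcoef vs z else (0 :: 'k)"
  note V = double_simps(1-3)
  show "rels n \<subseteq> free_on (tuples ?D n)"
    using free_on_tuples_multilinear [OF V] balanced_rels_subset by auto
  show "?\<phi> vs \<in> free_on (Y n)" for vs by (auto simp: mem_free_on_finite)
  \<comment> \<open>Additivity, homogeneity and balancedness are the cases \<open>(1, 1)\<close>,
    \<open>(c, 0)\<close> and \<open>(1, 0)\<close> of \<open>(c, d)\<close>.\<close>
  have comb: "?\<phi> (us @ vs) = fscale c (?\<phi> (us @ vs1)) + fscale d (?\<phi> (us @ vs2))"
    if "\<And>m xs k. xs \<in> X m \<Longrightarrow> k \<in> carrier G \<Longrightarrow> dcoef vs (xs, k) = c * dcoef vs1 (xs, k) + d * dcoef vs2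
        (xs, k)"
    for us vs vs1 vs2 c d
    using dcoef_combine [of vs c vs1 d vs2, OF that] by (auto simp: fun_eq_iff)
  show "lin_ext ?\<phi> r = 0" if "r \<in> rels n" for r
    using that
  proof
    assume r: "r \<in> multilinear_rels ?D n"
    show ?thesis
    proof (rule multilinear_rels_kill [OF V _ _ r])
      fix us v w ws
      have "?\<phi> (us @ ([v + w] @ ws)) = fscale 1 (?\<phi> (us @ [v] @ ws)) + fscale 1 (?\<phi> (us @ [w] @ ws))"
        by (rule comb) (auto simp: algebra_simps sum.distrib split: list.split)
      then show "?\<phi> (us @ [v + w] @ ws) = ?\<phi> (us @ [v] @ ws) + ?\<phi> (us @ [w] @ ws)"
        by (simp only: fun_space.scale_one)
    next
      fix us c v ws
      have "?\<phi> (us @ ([fscale c v] @ ws)) = fscale c (?\<phi> (us @ [v] @ ws)) + fscale 0 (?\<phi> (us @ [v] @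
          ws))"
        by (rule comb) (auto simp: sum_distrib_left mult.assoc split: list.split)
      then show "?\<phi> (us @ [fscale c v] @ ws) = fscale c (?\<phi> (us @ [v] @ ws))"
        by (simp only: fun_space.scale_zero_left add_0_right)
    qed
  next
    assume "r \<in> balanced_rels KG ?D n"
    then obtain us v b w ws where r: "r = delta (us @ [v \<otimes>\<^bsub>?D\<^esub> b, w] @ ws) - delta (us @
        [v, b \<otimes>\<^bsub>?D\<^esub> w] @ ws)"
      and b: "b \<in> KG"
      unfolding balanced_rels_def by blast
    have "?\<phi> (us @ ([v \<otimes>\<^bsub>?D\<^esub> b, w] @ ws)) = fscale 1 (?\<phi> (us @ [v, b \<otimes>\<^bsub>?D\<^esub> w] @ ws)) + fscale 0 (?\<phi>
        (us @ [v, b \<otimes>\<^bsub>?D\<^esub> w] @ ws))"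
      by (rule comb) (simp add: dcoef_balanced [OF b] del: dcoef.simps)
    then have "?\<phi> (us @ [v \<otimes>\<^bsub>?D\<^esub> b, w] @ ws) = ?\<phi> (us @ [v, b \<otimes>\<^bsub>?D\<^esub> w] @ ws)"
      by (simp only: fun_space.scale_zero_left add_0_right fun_space.scale_one)
    moreover have "lin_ext ?\<phi> r = ?\<phi> (us @ [v \<otimes>\<^bsub>?D\<^esub> b, w] @ ws) - ?\<phi> (us @ [v, b \<otimes>\<^bsub>?D\<^esub> w] @ ws)"
      unfolding r by (subst lin_ext_diff [of _ UNIV]) (simp_all only: delta_in_free_on UNIV_I
          lin_ext_delta)
    ultimately show ?thesis by (simp only: diff_self)
  qed
  show "map delta (sec (fst z) (snd z)) \<in> tuples ?D n" if "z \<in> Y n" for z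
    using that set_sec [of "fst z" "snd z"] by (auto simp: tuples_def words_def)
  show "?\<phi> (map delta (sec (fst z) (snd z))) = delta z" if "z \<in> Y n" for z
  proof
    fix y
    have "fst z \<noteq> []" using that n by (auto simp: words_def)
    then show "?\<phi> (map delta (sec (fst z) (snd z))) y = delta z y"
      using that by (cases y, cases z) (auto simp: dcoef_sec delta_apply)
  qed
  fix vs assume vs: "vs \<in> tuples ?D n"
  then have len: "length vs = n" and ne: "vs \<noteq> []" using n by (auto simp: tuples_def)
  have eq: "(\<Sum>z\<in>Y n. fscale (?\<phi> vs z) (delta (map delta (sec (fst z) (snd z)))))
      = (\<Sum>z\<in>Y n. fscale (dcoef vs z) (delta ([] @ map delta (sec (fst z) (snd z)))) :: _ \<Rightarrow> 'k)"
    by (intro sum.cong refl) (simp only: if_True append_Nil)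
  have t: "[] @ vs \<in> tuples ?D n" using vs by simp
  show "delta vs - (\<Sum>z\<in>Y n. fscale (?\<phi> vs z) (delta (map delta (sec (fst z) (snd z))))) \<in> fspan (rels n)"
    unfolding eq using delta_dcoef_expand [OF t ne] unfolding len append_Nil .
  fix \<omega> :: "('g \<times> 'g \<Rightarrow> 'k) + ('g \<times> 'g \<Rightarrow> 'k)"
  assume \<omega>: "\<omega> \<in> carrier ?D <+> carrier ?D"
  let ?vs' = "case \<omega> of Inl b \<Rightarrow> (b \<otimes>\<^bsub>?D\<^esub> hd vs) # tl vs | Inr c \<Rightarrow> butlast vs @ [last vs \<otimes>\<^bsub>?D\<^esub> c]"
  have "?vs' \<in> tuples ?D n"
    using vs ne by (cases \<omega>) (auto simp: tuples_def dest: in_set_butlastD list.set_sel(2))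
  then show "delta ?vs' \<in> free_on (tuples ?D n)" by (simp only: delta_in_free_on)
  have "?\<phi> ?vs' = dop n \<omega> (?\<phi> vs)"
  proof
    fix z :: "'g list \<times> 'g"
    obtain xs k where z: "z = (xs, k)" by (cases z)
    show "?\<phi> ?vs' z = dop n \<omega> (?\<phi> vs) z"
    proof (cases "z \<in> Y n")
      case True
      then have xs: "xs \<in> X n" "xs \<noteq> []" and k: "k \<in> carrier G" using n by (auto simp: z words_def)
      show ?thesis
      proof (cases \<omega>)
        case (Inl c)
        have "dcoef ((c \<otimes>\<^bsub>?D\<^esub> hd vs) # tl vs) (xs, k) =
            (\<Sum>h\<in>carrier G. c (hd xs, h) * dcoef (hd vs # tl vs) (cj (inv h) xs, inv h \<otimes> k))"
          by (rule dcoef_mult_left [OF xs k])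
        also have "\<dots> = (\<Sum>h\<in>carrier G. c (hd xs, h) * ?\<phi> vs (cj (inv h) xs, inv h \<otimes> k))"
          using xs k ne by (intro sum.cong refl) simp
        finally show ?thesis using Inl xs k by (simp add: dop_def z del: dcoef.simps)
      next
        case (Inr c)
        have "dcoef (butlast vs @ [last vs \<otimes>\<^bsub>?D\<^esub> c]) (xs, k) =
            (\<Sum>g\<in>carrier G. dcoef (butlast vs @ [last vs]) (xs, g) * c (cnjg (inv g) (last xs), inv g
                \<otimes> k))"
          by (rule dcoef_mult_right [OF xs k])
        then show ?thesis using Inr xs k ne by (simp add: dop_def z)
      qed
    next
      case False
      then show ?thesis by (auto simp: dop_def z)
    qed
  qed
  then show "lin_ext ?\<phi> (delta ?vs') = dop n \<omega> (?\<phi> vs)" by (simp only: lin_ext_delta)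
qed (auto intro: linear_on_dop)

section \<open>Restriction of the operators to \<open>kG\<close> on both sides\<close>

text \<open>\<open>Inl h\<close> and \<open>Inr h\<close> stand for left and right multiplication by \<open>h\<close>.\<close>

abbreviation bi :: "('g + 'g) set" where
  "bi \<equiv> carrier G <+> carrier G"

definition rho :: "'g + 'g \<Rightarrow> 'g list \<times> 'g \<Rightarrow> 'g list \<times> 'g" where
  "rho s z = (case s of Inl h \<Rightarrow> (cj (inv h) (fst z), inv h \<otimes> snd z) | Inr h \<Rightarrow> (fst z, snd z \<otimes> inv h))"

text \<open>An element of \<open>1 \<bowtie> kG\<close> is determined by its values at
  \<open>(\<one>, h)\<close>; the zero cases keep left operators away from right multiplications and
  conversely.\<close>

definition wt :: "('g \<times> 'g \<Rightarrow> 'k::field) + ('g \<times> 'g \<Rightarrow> 'k) \<Rightarrow> 'g + 'g \<Rightarrow> 'k" where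
  "wt \<omega> s = (case \<omega> of
      Inl c \<Rightarrow> (case s of Inl h \<Rightarrow> c (\<one>, h) | Inr h \<Rightarrow> 0)
    | Inr c \<Rightarrow> (case s of Inl h \<Rightarrow> 0 | Inr h \<Rightarrow> c (\<one>, h)))"

lemma rho_simps [simp]:
  "rho (Inl h) (xs, k) = (cj (inv h) xs, inv h \<otimes> k)" "rho (Inr h) (xs, k) = (xs, k \<otimes> inv h)"
  by (simp_all add: rho_def)

abbreviation bdiv :: "'k::field itself \<Rightarrow> ('g list \<times> 'g) set \<Rightarrow> ('g list \<times> 'g) set \<Rightarrow> bool" where
  "bdiv K \<equiv> pdiv K bi rho"

abbreviation binv :: "('g list \<times> 'g) set \<Rightarrow> ('g list \<times> 'g) set \<Rightarrow> ('g list \<times> 'g \<Rightarrow> 'g list \<times> 'g \<Rightarrow> 'k) \<Rightarrow>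
    bool" where
  "binv \<equiv> inv_mat bi rho"

lemma bij_rho:
  assumes "s \<in> bi"
  shows "bij_betw (rho s) (Y n) (Y n)"
  using assms
proof (elim PlusE)
  fix h assume h: "h \<in> carrier G" "s = Inl h"
  show ?thesis
    using h bij_Y_left [of "inv h" n] by (auto simp: rho_def case_prod_unfold cong: bij_betw_cong)
next
  fix h assume h: "h \<in> carrier G" "s = Inr h"
  then show ?thesis
    by (intro bij_betwI [where g = "rho (Inr (inv h))"]) (auto simp: m_assoc)
qed

abbreviation bi_op :: "('g list \<times> 'g) set \<Rightarrow> ('g \<times> 'g \<Rightarrow> 'k::field) + ('g \<times> 'g \<Rightarrow> 'k) \<Rightarrow>
    ('g list \<times> 'g \<Rightarrow> 'k) \<Rightarrow> 'g list \<times> 'g \<Rightarrow> 'k" where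
  "bi_op \<equiv> perm_op bi rho wt"

lemma finite_bi [simp]: "finite bi"
  by simp

lemma bi_op_apply:
  "bi_op Z (Inl c) F z = (if z \<in> Z then \<Sum>h\<in>carrier G. c (\<one>, h) * F (cj (inv h) (fst z), inv h \<otimes> snd
      z) else 0)"
  "bi_op Z (Inr c) F z = (if z \<in> Z then \<Sum>h\<in>carrier G. c (\<one>, h) * F (fst z, snd z \<otimes> inv h) else 0)"
  by (simp_all add: perm_op_def sum.Plus wt_def rho_def)

text \<open>The substitution \<open>g = k h\<^sup>-\<^sup>1\<close> passes between the pullback form
  and the convolution form of right multiplication.\<close>

lemma sum_mult_inv:
  assumes "k \<in> carrier G"
  shows "(\<Sum>h\<in>carrier G. f (k \<otimes> inv h) h) = (\<Sum>g\<in>carrier G. f g (inv g \<otimes> k))"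
proof -
  have "bij_betw (\<lambda>h. k \<otimes> inv h) (carrier G) (carrier G)"
    using assms by (intro bij_betwI [where g = "\<lambda>g. inv g \<otimes> k"])
      (auto simp: m_assoc [symmetric] inv_mult_group, simp_all add: m_assoc)
  from sum.reindex_bij_betw [OF this, of "\<lambda>g. f g (inv g \<otimes> k)"]
  have "(\<Sum>g\<in>carrier G. f g (inv g \<otimes> k)) = (\<Sum>h\<in>carrier G. f (k \<otimes> inv h) (inv (k \<otimes> inv h) \<otimes> k))" by simp
  also have "\<dots> = (\<Sum>h\<in>carrier G. f (k \<otimes> inv h) h)"
    using assms by (intro sum.cong refl) (simp add: inv_mult_group m_assoc)
  finally show ?thesis by simp
qed

text \<open>For elements of \<open>1 \<bowtie> kG\<close> the entries \<open>hd xs\<close> and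
  \<open>last xs\<close> drop out of the coefficients, which leaves a permutation action.\<close>

lemma dop_eq_bi_op:
  assumes n: "n \<ge> 1" and \<omega>: "\<omega> \<in> KG <+> KG"
  shows "dop n \<omega> F = bi_op (Y n) \<omega> F"
proof
  fix z :: "'g list \<times> 'g"
  obtain xs k where z: "z = (xs, k)" by (cases z)
  show "dop n \<omega> F z = bi_op (Y n) \<omega> F z"
  proof (cases "z \<in> Y n")
    case True
    then have xs: "xs \<in> X n" "xs \<noteq> []" and k: "k \<in> carrier G" using n by (auto simp: z words_def)
    note cl = hd_last_closed [OF xs]
    from \<omega> show ?thesis
    proof (elim PlusE)
      fix c assume c: "c \<in> KG" "\<omega> = Inl c"
      then show ?thesis
        using KG_D(2) [OF c(1) cl(1)] True by (simp add: dop_def bi_op_apply z)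
    next
      fix c assume c: "c \<in> KG" "\<omega> = Inr c"
      have "dop n \<omega> F z = (\<Sum>g\<in>carrier G. F (xs, g) * c (\<one>, inv g \<otimes> k))"
      proof -
        have "c (cnjg (inv g) (last xs), inv g \<otimes> k) = c (\<one>, inv g \<otimes> k)" if "g \<in> carrier G" for g
          using that k cl(2) by (intro KG_D(2) [OF c(1)]) auto
        then show ?thesis using c True by (simp add: dop_def z)
      qed
      also have "\<dots> = (\<Sum>h\<in>carrier G. F (xs, k \<otimes> inv h) * c (\<one>, h))"
        by (rule sum_mult_inv [OF k, symmetric])
      finally show ?thesis using c True by (simp add: bi_op_apply z mult.commute)
    qed
  qed (auto simp: dop_def z perm_op_def)
qed

lemma emb_apply: "x \<in> carrier G \<Longrightarrow> emb h (x, g) = of_bool (g = h)"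
  by (simp add: emb_def)

lemma KG_weights: "s \<in> bi \<Longrightarrow> \<exists>\<omega>\<in>KG <+> KG. \<forall>t\<in>bi. wt \<omega> t = (of_bool (t = s) :: 'k::field)"
proof (elim PlusE)
  fix h assume h: "h \<in> carrier G" "s = Inl h"
  show ?thesis
    by (rule bexI [of _ "Inl (emb h)"]) (use h in \<open>auto simp: wt_def emb_apply emb_in_KG\<close>)
next
  fix h assume h: "h \<in> carrier G" "s = Inr h"
  show ?thesis
    by (rule bexI [of _ "Inr (emb h)"]) (use h in \<open>auto simp: wt_def emb_apply emb_in_KG\<close>)
qed

lemma KG_subset: "KG \<subseteq> carrier (double G)"
  using KG_D(1) by auto

lemma rel_tensor_pow_equiv_bi:
  assumes "n \<ge> 1"
  shows "op_equiv (KG <+> KG) (rel_tensor_pow KG (double G) n :: ('k::field, _, _) opmod) (vec_mod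
      (Y n) (bi_op (Y n)))"
proof (rule op_equiv_trans)
  show "op_equiv (KG <+> KG) (rel_tensor_pow KG (double G) n :: ('k, _, _) opmod) (vec_mod (Y n)
      (dop n))"
    by (rule op_equiv_mono [OF rel_tensor_pow_equiv [OF assms]]) (use KG_subset in auto)
  show "op_equiv (KG <+> KG) (vec_mod (Y n) (dop n)) (vec_mod (Y n) (bi_op (Y n)) :: ('k, _, _) opmod)"
    by (rule op_equiv_vec_mod_cong [OF linear_on_dop dop_eq_bi_op [OF assms]])
qed

lemma KG_mult_closed:
  assumes "b \<in> KG" "c \<in> KG"
  shows "b \<otimes>\<^bsub>double G\<^esub> c \<in> KG"
proof -
  have "(b \<otimes>\<^bsub>double G\<^esub> c) (x, g) = (\<Sum>h\<in>carrier G. b (\<one>, h) * c (\<one>, inv h \<otimes> g))" if "x \<in> carrier G"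
      "g \<in> carrier G" for x g
    using that KG_D(2) [OF assms(1), of x] KG_D(2) [OF assms(2), of "cnjg (inv _) x"]
        by (simp add: mult_double_apply)
  then show ?thesis by (simp add: mem_group_alg_in_double_iff)
qed

text \<open>The base algebra fits the pattern as the empty word with a group element, so depth 1
  becomes the case \<open>n = 0\<close> of one criterion.\<close>

lemma base_bimod_equiv_bi:
  "op_equiv (KG <+> KG) (base_bimod KG (double G) :: ('k::field, _, _) opmod) (vec_mod (Y 0) (bi_op
      (Y 0)))"
proof -
  let ?M = "base_bimod KG (double G) :: ('k, 'g \<times> 'g \<Rightarrow> 'k, _) opmod"
  let ?f = "\<lambda>(u :: 'g \<times> 'g \<Rightarrow> 'k) z. if z \<in> Y 0 then u (\<one>, snd z) else 0"
  have M: "carrier ?M = KG" "add ?M = (+)" "smult ?M = fscale" "zero ?M = 0"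
    "act ?M = (\<lambda>\<omega> v. case \<omega> of Inl b \<Rightarrow> b \<otimes>\<^bsub>double G\<^esub> v | Inr c \<Rightarrow> v \<otimes>\<^bsub>double G\<^esub> c)"
    by (simp_all add: base_bimod_def)
  have "opclosed (KG <+> KG) ?M"
    unfolding opclosed_def M
  proof (intro conjI ballI allI)
    show "0 \<in> KG" by (simp add: mem_group_alg_in_double_iff)
  next
    fix u v :: "'g \<times> 'g \<Rightarrow> 'k" and c assume uv: "u \<in> KG" "v \<in> KG"
    show "u + v \<in> KG"
      unfolding mem_group_alg_in_double_iff
      using KG_D(1) [OF uv(1)] KG_D(1) [OF uv(2)] KG_D(2) [OF uv(1)] KG_D(2) [OF uv(2)]
      by (intro conjI ballI free_on_simps) (simp_all only: plus_fun_def)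
  next
    fix u :: "'g \<times> 'g \<Rightarrow> 'k" and c assume u: "u \<in> KG"
    show "fscale c u \<in> KG"
      unfolding mem_group_alg_in_double_iff
      using KG_D(1) [OF u] KG_D(2) [OF u]
      by (intro conjI ballI free_on_simps) (simp_all only: fscale_apply)
  qed (auto intro: KG_mult_closed split: sum.splits)
  moreover have "opclosed (KG <+> KG) (vec_mod (Y 0) (bi_op (Y 0)) :: ('k, _, _) opmod)"
    by (intro opclosed_vec_mod linear_on_perm_op) simp
  moreover have "bij_betw ?f KG (free_on (Y 0))"
  proof (rule bij_betwI [where g = "\<lambda>F (x, g). if x \<in> carrier G \<and> g \<in> carrier G then F ([], g) else 0"])
    show "?f \<in> KG \<rightarrow> free_on (Y 0)" by (auto simp: mem_free_on_finite)
    show "(\<lambda>F (x, g). if x \<in> carrier G \<and> g \<in> carrier G then F ([], g) else 0) \<in> free_on (Y 0) \<rightarrow> KG"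
      by (auto simp: mem_group_alg_in_double_iff mem_free_on_finite)
  next
    fix u :: "'g \<times> 'g \<Rightarrow> 'k" assume u: "u \<in> KG"
    show "(\<lambda>(x, g). if x \<in> carrier G \<and> g \<in> carrier G then ?f u ([], g) else 0) = u"
    proof
      fix p :: "'g \<times> 'g"
      obtain x g where p: "p = (x, g)" by (cases p)
      show "(case p of (x, g) \<Rightarrow> if x \<in> carrier G \<and> g \<in> carrier G then ?f u ([], g) else 0) = u p"
      proof (cases "x \<in> carrier G \<and> g \<in> carrier G")
        case True
        then show ?thesis using KG_D(2) [OF u, of x g] by (simp add: p words_0)
      next
        case False
        then show ?thesis using KG_D(1) [OF u] by (auto simp: p mem_free_on_finite)
      qed
    qed
  next
    fix F :: "'g list \<times> 'g \<Rightarrow> 'k" assume "F \<in> free_on (Y 0)"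
    then show "?f (\<lambda>(x, g). if x \<in> carrier G \<and> g \<in> carrier G then F ([], g) else 0) = F"
      by (auto simp: mem_free_on_finite words_0 fun_eq_iff)
  qed
  moreover have "?f (act ?M \<omega> u) = bi_op (Y 0) \<omega> (?f u)" if \<omega>: "\<omega> \<in> KG <+> KG" and u: "u \<in> KG" for \<omega> u
  proof
    fix z :: "'g list \<times> 'g"
    show "?f (act ?M \<omega> u) z = bi_op (Y 0) \<omega> (?f u) z"
    proof (cases "z \<in> Y 0")
      case True
      then obtain k where z: "z = ([], k)" "k \<in> carrier G" by (auto simp: words_0)
      from \<omega> show ?thesis
      proof (elim PlusE)
        fix c assume c: "c \<in> KG" "\<omega> = Inl c"
        then show ?thesis using z
          by (simp add: M bi_op_apply mult_double_apply words_0 cnjg_def)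
      next
        fix c assume c: "c \<in> KG" "\<omega> = Inr c"
        have "(u \<otimes>\<^bsub>double G\<^esub> c) (\<one>, k) = (\<Sum>g\<in>carrier G. u (\<one>, g) * c (\<one>, inv g \<otimes> k))"
          using z by (simp add: mult_double_apply cnjg_def)
        also have "\<dots> = (\<Sum>h\<in>carrier G. u (\<one>, k \<otimes> inv h) * c (\<one>, h))"
          by (rule sum_mult_inv [OF z(2), symmetric])
        finally show ?thesis using c z by (simp add: M bi_op_apply words_0 mult.commute)
      qed
    qed (simp add: perm_op_def)
  qed
  moreover have "?f (u + v) = ?f u + ?f v" "?f (fscale c u) = fscale c (?f u)" "?f 0 = 0" for u v c
    by auto
  ultimately have "op_equiv_by (KG <+> KG) ?M (vec_mod (Y 0) (bi_op (Y 0))) ?f"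
    unfolding op_equiv_by_def opmod_iso_def M(1-4) vec_mod_simps by simp
  then show ?thesis by (auto simp: op_equiv_def)
qed

text \<open>A module \<open>V\<close> gives the bimodule \<open>V \<otimes> kG\<close> and is recovered from it as the coinvariants of the right
  action, which is what the sums over the second coordinate compute.\<close>

lemma pdiv_biset_iff:
  "bdiv TYPE('k::field) (Y m) (Y n) \<longleftrightarrow> gdiv TYPE('k) (X m) (X n)"
proof
  assume "gdiv TYPE('k) (X m) (X n)"
  then obtain q and A B :: "nat \<Rightarrow> 'g list \<Rightarrow> 'g list \<Rightarrow> 'k" where A: "\<forall>i<q. ginv (X m) (X n) (A i)"
    and B: "\<forall>i<q. ginv (X n) (X m) (B i)"
    and AB: "\<forall>x\<in>X m. \<forall>x'\<in>X m. (\<Sum>i<q. \<Sum>y\<in>X n. A i x y * B i y x') = of_bool (x = x')"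
    unfolding pdiv_def pdiv_by_def by blast
  \<comment> \<open>The matrix \<open>C\<close> tensored with the identity of
    \<open>kG\<close>.\<close>
  have inv: "binv (Y a) (Y b) (\<lambda>x y. C (fst x) (fst y) * of_bool (snd x = snd y))"
    if "ginv (X a) (X b) C" for a b and C :: "'g list \<Rightarrow> 'g list \<Rightarrow> 'k"
    using that unfolding inv_mat_def by (auto simp: rho_def elim!: PlusE)
  show "bdiv TYPE('k) (Y m) (Y n)"
  proof (rule pdivI [where J = "{..<q}" and A = "\<lambda>i x y. A i (fst x) (fst y) * of_bool (snd x = snd y)"
        and B = "\<lambda>i x y. B i (fst x) (fst y) * of_bool (snd x = snd y)"])
    fix z z' assume "z \<in> Y m" "z' \<in> Y m"
    then obtain x g x' g' where z: "z = (x, g)" "x \<in> X m" "g \<in> carrier G" "z'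
        = (x', g')" "x' \<in> X m" "g' \<in> carrier G"
      by auto
    have "(\<Sum>i<q. \<Sum>y\<in>Y n. A i (fst z) (fst y) * of_bool (snd z = snd y) * (B i (fst y) (fst z') *
        of_bool (snd y = snd z')))
      = (\<Sum>i<q. \<Sum>y\<in>X n. \<Sum>h\<in>carrier G. if h = g then A i x y * B i y x' * of_bool (g = g') else 0)"
      unfolding sum.cartesian_product' by (intro sum.cong refl) (auto simp: z)
    also have "\<dots> = (\<Sum>i<q. \<Sum>y\<in>X n. A i x y * B i y x') * of_bool (g = g')"
      using z by (simp add: sum_distrib_right)
    also have "\<dots> = of_bool (z = z')" using AB z by simp
    finally show "(\<Sum>i<q. \<Sum>y\<in>Y n. A i (fst z) (fst y) * of_bool (snd z = snd y) * (B i (fst y) (fst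
        z') * of_bool (snd y = snd z')))
      = of_bool (z = z')" .
  qed (use A B inv in auto)
next
  assume "bdiv TYPE('k) (Y m) (Y n)"
  then obtain q and A B :: "nat \<Rightarrow> 'g list \<times> 'g \<Rightarrow> 'g list \<times> 'g \<Rightarrow> 'k"
      where A: "\<forall>i<q. binv (Y m) (Y n) (A i)"
    and B: "\<forall>i<q. binv (Y n) (Y m) (B i)"
    and AB: "\<forall>x\<in>Y m. \<forall>x'\<in>Y m. (\<Sum>i<q. \<Sum>y\<in>Y n. A i x y * B i y x') = of_bool (x = x')"
    unfolding pdiv_def pdiv_by_def by blast
  have left: "C (cj (inv h) x, inv h \<otimes> k) (cj (inv h) y, inv h \<otimes> l) = C (x, k) (y, l)"
    and right: "C (x, k \<otimes> inv h) (y, l \<otimes> inv h) = C (x, k) (y, l)"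
    if C: "binv (Y a) (Y b) C" and "h \<in> carrier G" "x \<in> X a" "y \<in> X b" "k \<in> carrier G" "l \<in> carrier G"
    for C :: "'g list \<times> 'g \<Rightarrow> 'g list \<times> 'g \<Rightarrow> 'k" and a b h x y k l
  proof -
    have "C (rho s (x, k)) (rho s (y, l)) = C (x, k) (y, l)" if "s \<in> bi" for s
      using C \<open>x \<in> X a\<close> \<open>y \<in> X b\<close> \<open>k \<in> carrier G\<close> \<open>l \<in> carrier G\<close> that by (simp add: inv_mat_def)
    from this [of "Inl h"] this [of "Inr h"]
    show "C (cj (inv h) x, inv h \<otimes> k) (cj (inv h) y, inv h \<otimes> l) = C (x, k) (y, l)"
      "C (x, k \<otimes> inv h) (y, l \<otimes> inv h) = C (x, k) (y, l)"
      using \<open>h \<in> carrier G\<close> by auto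
  qed
  define co where "co C x y = (\<Sum>h\<in>carrier G. C (x, \<one>) (y, h))"
    for C :: "'g list \<times> 'g \<Rightarrow> 'g list \<times> 'g \<Rightarrow> 'k" and x y
  have co: "ginv (X a) (X b) (co C)" if C: "binv (Y a) (Y b) C" for C a b
    unfolding inv_mat_def
  proof (intro ballI)
    fix s x y assume s: "s \<in> carrier G" and x: "x \<in> X a" and y: "y \<in> X b"
    \<comment> \<open>Left multiplication by \<open>s\<close>, then right multiplication by its
      inverse: this restores the second coordinate \<open>\<one>\<close> and conjugates everything
      else.\<close>
    have "C (x, \<one>) (y, h) = C (cj s x, \<one>) (cj s y, cnjg s h)" if h: "h \<in> carrier G" for h
    proof -
      have "C (x, \<one>) (y, h) = C (cj s x, s) (cj s y, s \<otimes> h)"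
        using left [OF C inv_closed [OF s] x y one_closed h] s by simp
      also have "\<dots> = C (cj s x, s \<otimes> inv s) (cj s y, s \<otimes> h \<otimes> inv s)"
        using right [OF C s cj_closed [OF s x] cj_closed [OF s y], of s "s \<otimes> h"] s h by simp
      finally show ?thesis using s by (simp add: cnjg_def)
    qed
    then have "co C x y = (\<Sum>h\<in>carrier G. C (cj s x, \<one>) (cj s y, cnjg s h))"
      unfolding co_def by (intro sum.cong refl)
    also have "\<dots> = co C (cj s x) (cj s y)"
    proof -
      have "bij_betw (cnjg s) (carrier G) (carrier G)"
        using s by (intro bij_betwI [where g = "cnjg (inv s)"]) auto
      then show ?thesis unfolding co_def by (rule sum.reindex_bij_betw)
    qed
    finally show "co C (cj s x) (cj s y) = co C x y" by simp
  qed
  show "gdiv TYPE('k) (X m) (X n)"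
  proof (rule pdivI [where J = "{..<q}" and A = "\<lambda>i. co (A i)" and B = "\<lambda>i. co (B i)"])
    fix x x' assume x: "x \<in> X m" "x' \<in> X m"
    \<comment> \<open>By right invariance the sum over the second coordinate of the target does not
      depend on the base point \<open>h\<close>, so \<open>h\<close> may be replaced by
      \<open>\<one>\<close>.\<close>
    have Bsum: "(\<Sum>g\<in>carrier G. B i (y, h) (x', g)) = co (B i) y x'" if "i < q" "y \<in> X n" "h \<in>
        carrier G" for i y h
    proof -
      have "(\<Sum>g\<in>carrier G. B i (y, h) (x', g)) = (\<Sum>g\<in>carrier G. B i (y, h) (x', g \<otimes> h))"
        by (rule sum_translate(2) [OF that(3), symmetric])
      also have "\<dots> = co (B i) y x'"
        unfolding co_def
      proof (intro sum.cong refl)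
        fix g assume "g \<in> carrier G"
        then show "B i (y, h) (x', g \<otimes> h) = B i (y, \<one>) (x', g)"
          using right [of n m "B i" "inv h" y x' \<one> g] B that x by simp
      qed
      finally show ?thesis .
    qed
    have "(\<Sum>i<q. \<Sum>y\<in>X n. co (A i) x y * co (B i) y x')
      = (\<Sum>i<q. \<Sum>y\<in>X n. \<Sum>h\<in>carrier G. \<Sum>g\<in>carrier G. A i (x, \<one>) (y, h) * B i (y, h) (x', g))"
    proof (rule sum.cong [OF refl], rule sum.cong [OF refl])
      fix i y assume "i \<in> {..<q}" "y \<in> X n"
      then show "co (A i) x y * co (B i) y x' = (\<Sum>h\<in>carrier G. \<Sum>g\<in>carrier G. A i (x, \<one>) (y, h) * B i
          (y, h) (x', g))"
        by (simp add: co_def [of "A i"] sum_distrib_right sum_distrib_left [symmetric] Bsum)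
    qed
    also have "\<dots> = (\<Sum>i<q. \<Sum>z\<in>Y n. \<Sum>g\<in>carrier G. A i (x, \<one>) z * B i z (x', g))"
      by (simp add: sum.cartesian_product')
    also have "\<dots> = (\<Sum>g\<in>carrier G. \<Sum>i<q. \<Sum>z\<in>Y n. A i (x, \<one>) z * B i z (x', g))"
      by (simp only: sum.swap [of _ "carrier G"])
    \<comment> \<open>Summing the identity matrix of \<open>Y m\<close> over the points
      \<open>(x', g)\<close> leaves only \<open>g = \<one>\<close>.\<close>
    also have "\<dots> = (\<Sum>g\<in>carrier G. if g = \<one> then of_bool (x = x') else 0)"
      using AB x by (intro sum.cong refl) auto
    also have "\<dots> = of_bool (x = x')" by simp
    finally show "(\<Sum>i<q. \<Sum>y\<in>X n. co (A i) x y * co (B i) y x') = of_bool (x = x')" .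
  qed (use A B co in auto)
qed

lemma similar_mod_biset_iff:
  assumes M: "op_equiv (KG <+> KG) M (vec_mod (Y m) (bi_op (Y m)) :: ('k::field, _, _) opmod)"
    and N: "op_equiv (KG <+> KG) N (vec_mod (Y n) (bi_op (Y n)) :: ('k, _, _) opmod)"
  shows "similar_mod (KG <+> KG) M N \<longleftrightarrow>
    gdiv TYPE('k) (X m) (X n) \<and> gdiv TYPE('k) (X n) (X m)"
proof -
  have *: "(\<exists>q. iso_to_summand (KG <+> KG) (vec_mod (Y a) (bi_op (Y a))) (copies q (vec_mod (Y b)
      (bi_op (Y b)) :: ('k, _, _) opmod)))
     \<longleftrightarrow> gdiv TYPE('k) (X a) (X b)" for a b
    unfolding pdiv_biset_iff [symmetric] unfolding pdiv_def
    by (subst iso_to_summand_copies_perm_iff) (rule KG_weights bij_rho refl, assumption | simp)+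
  show ?thesis
    unfolding similar_mod_def iso_to_summand_cong [OF M op_equiv_copies [OF N]]
      iso_to_summand_cong [OF N op_equiv_copies [OF M]] * ..
qed

text \<open>Similarity asks for both divisibilities: \<open>pdiv_X_le\<close> always gives one, and
  \<open>stable_at\<close> is the other.\<close>

lemma odd_depth_iff:
  "odd_depth KG (double G :: ('k::field, _) module) n \<longleftrightarrow> stable_at TYPE('k) n"
proof -
  have le: "gdiv TYPE('k) (X n) (X (Suc n))" by (rule pdiv_X_le) simp
  show ?thesis
  proof (cases "n = 0")
    case True
    have "similar_mod (KG <+> KG) (rel_tensor_pow KG (double G) 1 :: ('k, _, _) opmod) (base_bimod
        KG (double G)) \<longleftrightarrow>
        gdiv TYPE('k) (X 1) (X 0) \<and> gdiv TYPE('k) (X 0) (X 1)"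
      by (rule similar_mod_biset_iff [OF rel_tensor_pow_equiv_bi base_bimod_equiv_bi]) simp
    then show ?thesis using le True by (simp add: odd_depth_def)
  next
    case False
    have "similar_mod (KG <+> KG) (rel_tensor_pow KG (double G) (Suc n) :: ('k, _, _) opmod)
        (rel_tensor_pow KG (double G) n) \<longleftrightarrow>
        gdiv TYPE('k) (X (Suc n)) (X n) \<and> gdiv TYPE('k) (X n) (X (Suc n))"
      by (rule similar_mod_biset_iff [OF rel_tensor_pow_equiv_bi rel_tensor_pow_equiv_bi]) (use
          False in simp_all)
    then show ?thesis using le False by (simp add: odd_depth_def)
  qed
qed

section \<open>Comparison of the depths\<close>

text \<open>Multiplying by \<open>p\<^sub>1 \<bowtie> 1\<close> on the side where \<open>D(G)\<close> acts cuts out of the \<open>(n+1)\<close>-fold tensor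
  power the \<open>n\<close>-fold one as a \<open>kG\<close>-\<open>kG\<close>-bimodule; hence depth \<open>2n\<close> implies depth \<open>2n - 1\<close>.\<close>

lemma stable_at_of_projection:
  fixes P :: "'g list \<Rightarrow> bool"
  assumes \<Omega>: "KG <+> KG \<subseteq> \<Omega>" "\<Omega> \<subseteq> carrier (double G) <+> carrier (double G)"
    and \<omega>: "\<omega> \<in> \<Omega>" "\<And>m F z. m \<ge> 1 \<Longrightarrow> z \<in> Y m \<Longrightarrow> dop m \<omega> F z = of_bool (P (fst z)) * F z"
    and P: "\<And>m h xs. m \<ge> 1 \<Longrightarrow> h \<in> carrier G \<Longrightarrow> xs \<in> X m \<Longrightarrow> P (cj h xs) \<longleftrightarrow> P xs"
    and j: "\<And>m. inj_on j (X m)" "\<And>m xs. xs \<in> X m \<Longrightarrow> j xs \<in> X (Suc m) \<and> P (j xs)"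
      "\<And>m h xs. h \<in> carrier G \<Longrightarrow> xs \<in> X m \<Longrightarrow> j (cj h xs) = cj h (j xs)"
    and j': "\<And>m. inj_on j' {xs \<in> X (Suc m). P xs}" "\<And>m xs. xs \<in> X (Suc m) \<Longrightarrow> j' xs \<in> X m"
      "\<And>m h xs. xs \<in> X (Suc m) \<Longrightarrow> j' (cj h xs) = cj h (j' xs)"
    and n: "n \<ge> 1"
    and iso: "iso_to_summand \<Omega> (rel_tensor_pow KG (double G) (n + 1) :: ('k::field, _, _) opmod)
      (copies q (rel_tensor_pow KG (double G) n))"
  shows "stable_at TYPE('k) (n - 1)"
proof -
  \<comment> \<open>The basis elements that the idempotent \<open>\<omega>\<close> fixes; it sends
    all the others to 0.\<close>
  define YP where "YP m = {z \<in> Y m. P (fst z)}" for m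
  have rhoP: "P (fst (rho s z)) \<longleftrightarrow> P (fst z)" if "s \<in> bi" "z \<in> Y m" "m \<ge> 1" for s z m
    using that P by (auto simp: rho_def)
  have bijP: "bij_betw (rho s) (YP m) (YP m)" if "s \<in> bi" "m \<ge> 1" for s m
    unfolding YP_def using that by (intro bij_betw_Collect bij_rho rhoP)
  have finP [simp]: "finite (YP m)" for m
    unfolding YP_def by simp
  have equiv: "op_equiv \<Omega> (rel_tensor_pow KG (double G) m :: ('k, _, _) opmod) (vec_mod (Y m) (dop m))"
    if "m \<ge> 1" for m
    by (rule op_equiv_mono [OF rel_tensor_pow_equiv [OF that] \<Omega>(2)])
  have "iso_to_summand \<Omega> (vec_mod (Y (Suc n)) (dop (Suc n))) (copies q (vec_mod (Y n) (dop n) ::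
      ('k, _, _) opmod))"
    using iso iso_to_summand_cong [OF equiv [of "Suc n"] op_equiv_copies [OF equiv [OF n]]] by simp
  then obtain A B where
    A: "\<forall>i<q. \<forall>\<omega>\<in>\<Omega>. \<forall>F\<in>free_on (Y (Suc n)). lin_map (Y (Suc n)) (Y n) (A i) (dop (Suc n) \<omega> F)
        = dop n \<omega> (lin_map (Y (Suc n)) (Y n) (A i) F)"
    and B: "\<forall>i<q. \<forall>\<omega>\<in>\<Omega>. \<forall>F\<in>free_on (Y n). lin_map (Y n) (Y (Suc n)) (B i) (dop n \<omega> F)
        = dop (Suc n) \<omega> (lin_map (Y n) (Y (Suc n)) (B i) F)"
    and AB: "\<forall>x\<in>Y (Suc n). \<forall>x'\<in>Y (Suc n). (\<Sum>i<q. \<Sum>y\<in>Y n. A i x y * B i y x') = (of_bool (x = x') :: 'k)"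
    unfolding iso_to_summand_copies_vec_mod_iff [OF finite_Y finite_Y linear_on_dop linear_on_dop]
    by blast
  \<comment> \<open>An intertwiner commutes with \<open>\<omega>\<close>, so its entries between the
    two halves cut out by \<open>P\<close> vanish, and the splitting restricts to the fixed
    halves.\<close>
  have inv: "binv (Y a) (Y b) C" and off: "x \<in> Y a \<Longrightarrow> y \<in> Y b \<Longrightarrow> P (fst x) \<noteq> P (fst y) \<Longrightarrow> C x y = 0"
    if C: "\<forall>\<omega>\<in>\<Omega>. \<forall>F\<in>free_on (Y a). lin_map (Y a) (Y b) C (dop a \<omega> F) = dop b \<omega> (lin_map (Y a) (Y b) C F)"
      and ab: "a \<ge> 1" "b \<ge> 1" for a b and C :: "'g list \<times> 'g \<Rightarrow> 'g list \<times> 'g \<Rightarrow> 'k" and x y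
  proof -
    show "binv (Y a) (Y b) C"
    proof (rule inv_mat_of_intertwining [OF finite_Y finite_bi bij_rho bij_betw_imp_funcset [OF
        bij_rho] KG_weights])
      fix \<omega>' :: "('g \<times> 'g \<Rightarrow> 'k) + ('g \<times> 'g \<Rightarrow> 'k)" and F :: "'g list \<times> 'g \<Rightarrow> 'k"
      assume *: "\<omega>' \<in> KG <+> KG" "F \<in> free_on (Y a)"
      then show "lin_map (Y a) (Y b) C (bi_op (Y a) \<omega>' F) = bi_op (Y b) \<omega>' (lin_map (Y a) (Y b) C F)"
        using C \<Omega>(1) ab by (auto simp: dop_eq_bi_op [symmetric])
    qed
    assume x: "x \<in> Y a" and y: "y \<in> Y b" and ne: "P (fst x) \<noteq> P (fst y)"
    have dx: "dop a \<omega> (delta x) = fscale (of_bool (P (fst x))) (delta x :: _ \<Rightarrow> 'k)"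
    proof
      fix z show "dop a \<omega> (delta x) z = fscale (of_bool (P (fst x))) (delta x :: _ \<Rightarrow> 'k) z"
        using x \<omega>(2) [OF ab(1), of z "delta x"]
            by (cases "z \<in> Y a") (auto simp: dop_def delta_apply split: prod.splits)
    qed
    have lin: "linear_on (Y a) (Y b) (lin_map (Y a) (Y b) C)" by (rule linear_on_lin_map) simp
    have "of_bool (P (fst x)) * lin_map (Y a) (Y b) C (delta x) y = lin_map (Y a) (Y b) C (dop a \<omega>
        (delta x)) y"
      using x by (simp only: dx linear_onD(3) [OF lin] delta_in_free_on fscale_apply)
    also have "\<dots> = of_bool (P (fst y)) * lin_map (Y a) (Y b) C (delta x) y"
      using C \<omega>(1) \<omega>(2) [OF ab(2) y] x by simp
    finally show "C x y = 0" using ne x y by (auto simp: lin_map_delta)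
  qed
  have step: "bdiv TYPE('k) (YP (Suc n)) (YP n)"
  proof (rule pdivI [where J = "{..<q}" and A = A and B = B])
    fix i assume "i \<in> {..<q}"
    then show "binv (YP (Suc n)) (YP n) (A i)" "binv (YP n) (YP (Suc n)) (B i)"
      using inv [of "Suc n" n "A i"] inv [of n "Suc n" "B i"] A B n by (auto simp: inv_mat_def YP_def)
  next
    fix x x' assume x: "x \<in> YP (Suc n)" "x' \<in> YP (Suc n)"
    have "(\<Sum>i<q. \<Sum>y\<in>YP n. A i x y * B i y x') = (\<Sum>i<q. \<Sum>y\<in>Y n. A i x y * B i y x')"
    proof (rule sum.cong [OF refl], rule sum.mono_neutral_left)
      fix i assume "i \<in> {..<q}"
      then show "\<forall>y\<in>Y n - YP n. A i x y * B i y x' = 0"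
        using off [of "Suc n" n "A i" x] A n x by (auto simp: YP_def)
    qed (auto simp: YP_def)
    then show "(\<Sum>i<q. \<Sum>y\<in>YP n. A i x y * B i y x') = of_bool (x = x')"
      using AB [rule_format, of x x'] x unfolding YP_def by simp
  qed simp
  \<comment> \<open>With \<open>step\<close> this starts the chain \<open>Y n\<close>,
    \<open>YP (n + 1)\<close>, \<open>YP n\<close>, \<open>Y (n - 1)\<close>, each dividing a
    multiple of the next: \<open>j\<close> embeds at the top and \<open>j'\<close> at the
    bottom.\<close>
  have "bdiv TYPE('k) (Y n) (YP (Suc n))"
  proof (rule pdiv_inj [where j = "\<lambda>z. (j (fst z), snd z)"])
    show "inj_on (\<lambda>z. (j (fst z), snd z)) (Y n)" using j(1) [of n] by (auto simp: inj_on_def)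
    show "(\<lambda>z. (j (fst z), snd z)) ` Y n \<subseteq> YP (Suc n)" using j(2) by (auto simp: YP_def)
    show "(j (fst (rho s z)), snd (rho s z)) = rho s (j (fst z), snd z)" if "s \<in> bi" "z \<in> Y n" for s z
      using that j(3) by (auto simp: rho_def)
  qed (auto intro: bijP bij_rho)
  from this step have lower: "bdiv TYPE('k) (Y n) (YP n)"
    by (rule pdiv_trans [rotated 2]) (auto intro: bijP)
  obtain l where l: "n = Suc l" using n by (cases n) auto
  have "bdiv TYPE('k) (YP n) (Y l)"
  proof (rule pdiv_inj [where j = "\<lambda>z. (j' (fst z), snd z)"])
    show "inj_on (\<lambda>z. (j' (fst z), snd z)) (YP n)" using j'(1) [of l] by (auto simp: inj_on_def YP_def l)
    show "(\<lambda>z. (j' (fst z), snd z)) ` YP n \<subseteq> Y l" using j'(2) by (auto simp: YP_def l)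
    show "(j' (fst (rho s z)), snd (rho s z)) = rho s (j' (fst z), snd z)" if "s \<in> bi" "z \<in> YP n" for s z
      using that j'(3) by (auto simp: rho_def YP_def l)
  qed (use n in \<open>auto intro: bijP bij_rho\<close>)
  with lower have "bdiv TYPE('k) (Y n) (Y l)"
    by (rule pdiv_trans [rotated 2]) (use n in \<open>auto intro: bijP\<close>)
  then show ?thesis unfolding pdiv_biset_iff by (simp add: l)
qed

lemma cnjg_eq_one_iff: "h \<in> carrier G \<Longrightarrow> x \<in> carrier G \<Longrightarrow> cnjg h x = \<one> \<longleftrightarrow> x = \<one>"
  by (simp add: cnjg_eq_iff) (simp add: cnjg_def)

lemma even_depth_imp_stable:
  assumes even: "even_depth KG (double G :: ('k::field, _) module) n" and n: "n \<ge> 1"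
  shows "stable_at TYPE('k) (n - 1)"
proof -
  \<comment> \<open>Since \<open>1\<close> is fixed by conjugation, having first or last entry
    \<open>\<one>\<close> is an invariant property of words, and deleting that entry is equivariant.
    The side on which all of \<open>D(G)\<close> acts decides between first and last.\<close>
  let ?p = "delta (\<one>, \<one>) :: 'g \<times> 'g \<Rightarrow> 'k"
  have p: "?p \<in> carrier (double G)" by simp
  have Pl: "dop m (Inl ?p) F z = of_bool (hd (fst z) = \<one>) * F z" if "m \<ge> 1" "z \<in> Y m" for m F z
  proof -
    from that(2) obtain xs k where z: "z = (xs, k)" "xs \<in> X m" "k \<in> carrier G" by auto
    have "?p (hd xs, h) * F (cj (inv h) xs, inv h \<otimes> k) = (if h = \<one> then of_bool (hd xs
        = \<one>) * F z else 0)" for h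
      using z by (auto simp: delta_apply)
    then have "dop m (Inl ?p) F z = (\<Sum>h\<in>carrier G. if h = \<one> then of_bool (hd xs = \<one>) * F z else 0)"
      using z by (simp add: dop_def)
    then show ?thesis by (simp add: z)
  qed
  have Pr: "dop m (Inr ?p) F z = of_bool (last (fst z) = \<one>) * F z" if "m \<ge> 1" "z \<in> Y m" for m F z
  proof -
    from that(2) obtain xs k where z: "z = (xs, k)" "xs \<in> X m" "k \<in> carrier G" by auto
    have "xs \<noteq> []" using that(1) z(2) by (auto simp: words_def)
    then have l: "last xs \<in> carrier G" by (rule hd_last_closed(2) [OF z(2)])
    have "F (xs, g) * ?p (cnjg (inv g) (last xs), inv g \<otimes> k) = (if g = k then of_bool (last xs
        = \<one>) * F z else 0)"
      if g: "g \<in> carrier G" for g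
    proof -
      have "inv g \<otimes> k = \<one> \<longleftrightarrow> g = k" using g z(3) by (metis inv_closed inv_equality inv_inv l_inv)
      then show ?thesis using g l by (auto simp: delta_apply cnjg_eq_one_iff z)
    qed
    then have "dop m (Inr ?p) F z = (\<Sum>g\<in>carrier G. if g = k then of_bool (last xs = \<one>) * F z else 0)"
      using z by (simp add: dop_def)
    then show ?thesis using z by simp
  qed
  let ?K = "KG :: ('g \<times> 'g \<Rightarrow> 'k) set" and ?C = "carrier (double G :: ('k, _) module)"
  have KGs: "?K \<subseteq> ?C" by (rule KG_subset)
  from even consider q where "iso_to_summand (?K <+> ?C) (rel_tensor_pow KG (double G) (n + 1) ::
      ('k, _, _) opmod)
      (copies q (rel_tensor_pow KG (double G) n))"
    | q where "iso_to_summand (?C <+> ?K) (rel_tensor_pow KG (double G) (n + 1) :: ('k, _, _) opmod)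
      (copies q (rel_tensor_pow KG (double G) n))"
    unfolding even_depth_def similar_mod_def by blast
  then show ?thesis
  proof cases
    case 1
    show ?thesis
    proof (rule stable_at_of_projection [OF _ _ _ Pr _ _ _ _ _ _ _ n 1,
        where j = "\<lambda>xs. xs @ [\<one>]" and j' = butlast])
      show "?K <+> ?K \<subseteq> ?K <+> ?C" "?K <+> ?C \<subseteq> ?C <+> ?C" "Inr ?p \<in> ?K <+> ?C"
        using KGs p by auto
      show "(last (cj h xs) = \<one>) = (last xs = \<one>)" if "m \<ge> 1" "h \<in> carrier G" "xs \<in> X m" for m h xs
      proof -
        have "xs \<noteq> []" using that by (auto simp: words_def)
        then show ?thesis using that hd_last_closed(2) [of xs m] by (simp add: last_map cnjg_eq_one_iff)
      qed
      show "inj_on butlast {xs \<in> X (Suc m). last xs = \<one>}" for m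
      proof (rule inj_onI, clarsimp)
        fix xs ys assume "xs \<in> X (Suc m)" "ys \<in> X (Suc m)" "last xs = \<one>" "last ys = \<one>" "butlast xs
            = butlast ys"
        moreover from this have "xs \<noteq> []" "ys \<noteq> []" by (auto simp: words_def)
        ultimately show "xs = ys" by (metis append_butlast_last_id)
      qed
      show "butlast xs \<in> X m" if "xs \<in> X (Suc m)" for m xs
        using that by (auto simp: words_def dest: in_set_butlastD)
    qed (auto simp: inj_on_def words_def cnjg_def map_butlast)
  next
    case 2
    show ?thesis
    proof (rule stable_at_of_projection [OF _ _ _ Pl _ _ _ _ _ _ _ n 2, where j = "(#) \<one>" and j' = tl])
      show "?K <+> ?K \<subseteq> ?C <+> ?K" "?C <+> ?K \<subseteq> ?C <+> ?C" "Inl ?p \<in> ?C <+> ?K"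
        using KGs p by auto
      show "(hd (cj h xs) = \<one>) = (hd xs = \<one>)" if "m \<ge> 1" "h \<in> carrier G" "xs \<in> X m" for m h xs
      proof -
        have "xs \<noteq> []" using that by (auto simp: words_def)
        then show ?thesis using that hd_last_closed(1) [of xs m] by (simp add: hd_map cnjg_eq_one_iff)
      qed
      show "inj_on tl {xs \<in> X (Suc m). hd xs = \<one>}" for m
        by (rule inj_onI) (auto simp: words_Suc)
      show "tl xs \<in> X m" if "xs \<in> X (Suc m)" for m xs
        using that by (auto simp: words_Suc)
    qed (auto simp: words_def cnjg_def map_tl)
  qed
qed

text \<open>An even depth \<open>2n\<close> brings along the smaller depth \<open>2n - 1\<close>, so
  the minimum is \<open>2N + 1\<close> with \<open>N\<close> the least stable index, and rounding up
  to an odd number changes nothing. Without a stable index all these depths are infinite.\<close>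

lemma subalg_depth_eq:
  "subalg_depth KG (double G :: ('k::field, _) module) = 2 * module_depth G (adjoint_mod G :: ('k,
      _, _) opmod) + 1"
    "subalg_depth_odd KG (double G :: ('k, _) module) = 2 * module_depth G (adjoint_mod G :: ('k, _,
        _) opmod) + 1"
proof -
  let ?has = "\<lambda>m. m \<ge> 1 \<and> subalg_has_depth KG (double G :: ('k, _) module) m"
  have odd: "?has (2 * n + 1)" if "stable_at TYPE('k) n" for n
    using that odd_depth_iff by (auto simp: subalg_has_depth_def)
  have has: "\<exists>n. stable_at TYPE('k) n \<and> 2 * n + 1 \<le> m" if "?has m" for m
  proof -
    from that consider n where "m = 2 * n + 1" "odd_depth KG (double G :: ('k, _) module) n"
      | n where "n \<ge> 1" "m = 2 * n" "even_depth KG (double G :: ('k, _) module) n"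
      by (auto simp: subalg_has_depth_def)
    then show ?thesis
    proof cases
      case 1
      then show ?thesis using odd_depth_iff by auto
    next
      case 2
      \<comment> \<open>The stable index is \<open>n - 1\<close>, and
        \<open>2 * (n - 1) + 1 = 2 * n - 1\<close> lies below \<open>m = 2 * n\<close>.\<close>
      then show ?thesis using even_depth_imp_stable [OF 2(3,1)] by (intro exI [of _ "n - 1"]) auto
    qed
  qed
  have "subalg_depth KG (double G :: ('k, _) module) = 2 * module_depth G (adjoint_mod G :: ('k, _,
      _) opmod) + 1 \<and>
    subalg_depth_odd KG (double G :: ('k, _) module) = 2 * module_depth G (adjoint_mod G :: ('k, _,
        _) opmod) + 1"
  proof (cases "\<exists>n. stable_at TYPE('k) n")
    case True
    define N where "N = (LEAST n. stable_at TYPE('k) n)"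
    have N: "stable_at TYPE('k) N" unfolding N_def using True by (rule LeastI_ex)
    have le: "N \<le> n" if "stable_at TYPE('k) n" for n unfolding N_def using that by (rule Least_le)
    have 1: "module_depth G (adjoint_mod G :: ('k, _, _) opmod) = enat N"
      unfolding module_depth_def module_has_depth_iff using N le by (intro Inf_enat_eq_Least)
    have 2: "subalg_depth KG (double G :: ('k, _) module) = enat (2 * N + 1)"
      unfolding subalg_depth_def
    proof (rule Inf_enat_eq_Least [of ?has, OF odd [OF N]])
      fix m assume "?has m"
      from has [OF this] show "2 * N + 1 \<le> m" using le by fastforce
    qed
    have "nat \<lceil>(real (2 * N + 1) - 1) / 2\<rceil> = N" by simp
    then show ?thesis
      unfolding subalg_depth_odd_def 1 2 by (simp add: numeral_eq_enat one_enat_def)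
  next
    case False
    then have 1: "module_depth G (adjoint_mod G :: ('k, _, _) opmod) = \<infinity>"
      unfolding module_depth_def module_has_depth_iff by (simp add: top_enat_def)
    have "{enat m | m. ?has m} = {}" using has False by blast
    then have 2: "subalg_depth KG (double G :: ('k, _) module) = \<infinity>"
      unfolding subalg_depth_def by (simp only: Inf_empty top_enat_def)
    show ?thesis
      unfolding subalg_depth_odd_def 1 2 by (simp add: numeral_eq_enat)
  qed
  then show "subalg_depth KG (double G :: ('k, _) module) = 2 * module_depth G (adjoint_mod G ::
      ('k, _, _) opmod) + 1"
    "subalg_depth_odd KG (double G :: ('k, _) module) = 2 * module_depth G (adjoint_mod G :: ('k, _,
        _) opmod) + 1"
    by auto
qed

text \<open>The two infima run over the same set of exponents, \<open>n = 0\<close>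
  included.\<close>

lemma faithful_length_eq:
  assumes "group_center G = {\<one>}" and "\<not> CHAR('k::field) dvd card (carrier G)"
  shows "faithful_length G (adjoint_mod G :: ('k, _, _) opmod) = module_depth G (adjoint_mod G ::
      ('k, _, _) opmod)"
  unfolding faithful_length_def module_depth_def module_has_depth_iff Ann_tensor_pow
    stable_iff_faithful [OF assms] ..

lemma conditionally_faithful_adjoint:
  assumes "group_center G = {\<one>}"
  shows "conditionally_faithful G (adjoint_mod G :: ('k::field, _, _) opmod)"
proof -
  \<comment> \<open>The faithful power has exponent \<open>|G| \<ge> 1\<close> and so occurs in an
    intersection that starts at 1.\<close>
  have "card (carrier G) \<in> {1..}"
    using one_closed finite_carrier by (auto simp: Suc_le_eq card_gt_0_iff)
  then have "(\<Inter>n\<in>{1..}. annih n) \<subseteq> (annih (card (carrier G)) :: ('g \<Rightarrow> 'k) set)" by (rule INF_lower)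
  then have "(\<Inter>n\<in>{1..}. annih n) = {0 :: 'g \<Rightarrow> 'k}"
    using annih_card_eq_0 [OF assms] zero_in_annih by auto
  then show ?thesis by (simp add: conditionally_faithful_def Ann_tensor_pow)
qed

end

theorem corollary6p4:
  fixes G :: "('g, 'z) monoid_scheme"
    and Q :: "('k::field, 'g \<Rightarrow> 'k, 'g \<Rightarrow> 'k) opmod"
    and kG :: "('g \<times> 'g \<Rightarrow> 'k) set"
    and DG :: "('k, 'g \<times> 'g \<Rightarrow> 'k) module"
  assumes "group G" and "finite (carrier G)"
    and "\<not> CHAR('k) dvd card (carrier G)"
    and "Q = adjoint_mod G"
    and "kG = group_alg_in_double G"
    and "DG = double G"
  shows "subalg_depth_odd kG DG = 2 * module_depth G Q + 1 \<and>
    (alg_closed_type TYPE('k) \<and> CHAR('k) = 0 \<and> group_center G = {\<one>\<^bsub>G\<^esub>}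
     \<longrightarrow> conditionally_faithful G Q \<and>
         subalg_depth kG DG = 2 * faithful_length G Q + 1)"
proof -
  interpret finite_group G
    using assms(1,2) by (simp add: finite_group_def finite_group_axioms_def)
  show ?thesis
    unfolding assms(4-6)
    using subalg_depth_eq [where 'k = 'k] conditionally_faithful_adjoint [where 'k = 'k]
      faithful_length_eq [where 'k = 'k] assms(3)
    by auto
qed

end
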